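(* For any planar or symmetric set-operad $P$ the pair of subcategories $(Upper,Lower)$ is a strict factorization system on $\mathrm{Tw}(P)$ and on $\mathcal U(P)$.
   Context: Operads are coloured operads in sets with identity operations. **Twisted arrow category $\mathrm{Tw}(P)$, symmetric case.** Objects: operations of $P$. A morphism with source $p\in P(c_1,\dots,c_n;c_0)$ is (uniquely) a tuple $f=(q_0;q_1,\dots,q_n;\lambda)$, where $q_0\in P$ has arity $m_0\ge 1$ and first input colour $c_0$, $q_i\in P$ ($1\le i\le n$) has arity $m_i\ge 0$ and output colour $c_i$, and $\lambda$ is a bijection from the set of leaves $\{(i,k):1\le i\le n,1\le k\le m_i\}\cup\{(0,k):2\le k\le m_0\}$ onto $\{1,\dots,N\}$ with $k\mapsto\lambda(i,k)$ increasing for each fixed $i$. The target is the operation $t$ with $t(x_1,\dots,x_N)=q_0\bigl(p(q_1(x_{\lambda(1,1)},\dots,x_{\lambda(1,m_1)}),\dots,q_n(x_{\lambda(n,1)},\dots)),x_{\lambda(0,2)},\dots,x_{\lambda(0,m_0)}\bigr)$. The composite of $f:p\to t$ with $g=(r_0;r_1,\dots,r_N;\mu):t\to u$ has upper vertices $q_i(r_{\lambda(i,1)},\dots,r_{\lambda(i,m_i)})$ and lower vertex $r_0\circ_1 q_0(\mathrm{id},r_{\lambda(0,2)},\dots,r_{\lambda(0,m_0)})$, with leaves numbered by $\mu$, and with inputs of each vertex (other than the first input of the lower one) then permuted so that the numbers increase. **Planar case.** A morphism from $p$ is a tuple $(q_0,i;q_1,\dots,q_n)$, where the $i$-th input of $q_0$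 has colour $c_0$, with target $q_0\circ_ip(q_1,\dots,q_n)$, and composition by grafting (no numbering of leaves). **Enveloping category $\mathcal U(P)$.** Objects are profiles $(c_1,\dots,c_n;c_0)$ of colours; morphisms from a profile $(c_1,\dots,c_n;c_0)$ are, in the symmetric case, the tuples $(q_0;q_1,\dots,q_n;\lambda)$, where $q_0\in P$ has arity $m_0\ge 1$ and first input colour $c_0$, $q_i\in P$ ($1\le i\le n$) has arity $m_i\ge 0$ and output colour $c_i$, and $\lambda$ is a bijection from $\{(i,k):1\le i\le n,1\le k\le m_i\}\cup\{(0,k):2\le k\le m_0\}$ onto $\{1,\dots,N\}$ with $k\mapsto\lambda(i,k)$ increasing for each fixed $i$, and, in the planar case, the tuples $(q_0,i;q_1,\dots,q_n)$, where the $i$-th input of $q_0$ has colour $c_0$ and $q_j$ has output colour $c_j$ for $1\le j\le n$, with the source vertex unmarked; the target is the resulting profile; tuples are composed by the same rule as in $\mathrm{Tw}(P)$ (this rule involves only the operations $q_j$, $r_j$ and the numberings of leaves, and not the source operation). $Upper$: morphisms with $q_0$ an identity operation. $Lower$: morphisms with $q_1,\dots,q_n$ identity operations and, in the symmetric case, $\lambda(1,1)<\lambda(2,1)<\dots<\lambda(n,1)$. A pair of subcategories $(sL,sR)$ of a category is a strict factorization system if any morphism has a unique factorization $r\circ l$ with $l\in sL$, $r\in sR$. *)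

theory Defs
  imports "HOL-Combinatorics.Permutations"
begin

(* Convention: everything is numbered from 0.  The inputs of an operation of arity n are numbered
   0, ..., n - 1, and "the first input" is input 0. *)

section \<open>Categories and strict factorization systems\<close>

record ('x, 'a) cat_data =
  Ob  :: "'x set"
  Ar  :: "'a set"
  src :: "'a \<Rightarrow> 'x"
  tgt :: "'a \<Rightarrow> 'x"
  idt :: "'x \<Rightarrow> 'a"
  cmp :: "'a \<Rightarrow> 'a \<Rightarrow> 'a"   (* cmp C g f is the composite "g after f" *)

locale category =
  fixes C :: "('x, 'a) cat_data"
  assumes src_in: "f \<in> Ar C \<Longrightarrow> src C f \<in> Ob C"
    and tgt_in: "f \<in> Ar C \<Longrightarrow> tgt C f \<in> Ob C"
    and idt_in: "x \<in> Ob C \<Longrightarrow> idt C x \<in> Ar C"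
    and src_idt: "x \<in> Ob C \<Longrightarrow> src C (idt C x) = x"
    and tgt_idt: "x \<in> Ob C \<Longrightarrow> tgt C (idt C x) = x"
    and cmp_in: "\<lbrakk>f \<in> Ar C; g \<in> Ar C; tgt C f = src C g\<rbrakk> \<Longrightarrow> cmp C g f \<in> Ar C"
    and src_cmp: "\<lbrakk>f \<in> Ar C; g \<in> Ar C; tgt C f = src C g\<rbrakk> \<Longrightarrow> src C (cmp C g f) = src C f"
    and tgt_cmp: "\<lbrakk>f \<in> Ar C; g \<in> Ar C; tgt C f = src C g\<rbrakk> \<Longrightarrow> tgt C (cmp C g f) = tgt C g"
    and cmp_idt_right: "f \<in> Ar C \<Longrightarrow> cmp C f (idt C (src C f)) = f"
    and cmp_idt_left: "f \<in> Ar C \<Longrightarrow> cmp C (idt C (tgt C f)) f = f"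
    and cmp_assoc: "\<lbrakk>f \<in> Ar C; g \<in> Ar C; h \<in> Ar C; tgt C f = src C g; tgt C g = src C h\<rbrakk>
        \<Longrightarrow> cmp C h (cmp C g f) = cmp C (cmp C h g) f"

(* Both classes of a strict factorization system contain every identity (factor the identity),
   so that a subcategory is given by a set of morphisms, its objects being all objects. *)
definition wide_subcategory :: "('x, 'a) cat_data \<Rightarrow> 'a set \<Rightarrow> bool" where
  "wide_subcategory C S \<longleftrightarrow> S \<subseteq> Ar C \<and> (\<forall>x\<in>Ob C. idt C x \<in> S) \<and>
     (\<forall>f\<in>S. \<forall>g\<in>S. tgt C f = src C g \<longrightarrow> cmp C g f \<in> S)"

definition strict_factorization_system :: "('x, 'a) cat_data \<Rightarrow> 'a set \<Rightarrow> 'a set \<Rightarrow> bool" where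
  "strict_factorization_system C sL sR \<longleftrightarrow>
     category C \<and> wide_subcategory C sL \<and> wide_subcategory C sR \<and>
     (\<forall>f\<in>Ar C. \<exists>!lr. fst lr \<in> sL \<and> snd lr \<in> sR \<and> tgt C (fst lr) = src C (snd lr) \<and>
        cmp C (snd lr) (fst lr) = f)"

section \<open>Coloured operads in sets\<close>

(* P(c_1, ..., c_n; c_0) is the set of p in opn P with inp P p = [c_1, ..., c_n] and
   outp P p = c_0, and ocomp P p [q_1, ..., q_n] is p(q_1, ..., q_n). *)
record ('c, 'o) operad =
  col   :: "'c set"
  opn   :: "'o set"
  inp   :: "'o \<Rightarrow> 'c list"
  outp  :: "'o \<Rightarrow> 'c"
  idop  :: "'c \<Rightarrow> 'o"
  ocomp :: "'o \<Rightarrow> 'o list \<Rightarrow> 'o"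

abbreviation arity :: "('c, 'o, 'm) operad_scheme \<Rightarrow> 'o \<Rightarrow> nat" where
  "arity P p \<equiv> length (inp P p)"

definition composable :: "('c, 'o, 'm) operad_scheme \<Rightarrow> 'o \<Rightarrow> 'o list \<Rightarrow> bool" where
  "composable P p qs \<longleftrightarrow> p \<in> opn P \<and> set qs \<subseteq> opn P \<and> map (outp P) qs = inp P p"

locale planar_operad =
  fixes P :: "('c, 'o, 'm) operad_scheme"
  assumes inp_col: "p \<in> opn P \<Longrightarrow> set (inp P p) \<subseteq> col P"
    and outp_col: "p \<in> opn P \<Longrightarrow> outp P p \<in> col P"
    and idop_opn: "c \<in> col P \<Longrightarrow> idop P c \<in> opn P"
    and inp_idop: "c \<in> col P \<Longrightarrow> inp P (idop P c) = [c]"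
    and outp_idop: "c \<in> col P \<Longrightarrow> outp P (idop P c) = c"
    and ocomp_opn: "composable P p qs \<Longrightarrow> ocomp P p qs \<in> opn P"
    and inp_ocomp: "composable P p qs \<Longrightarrow> inp P (ocomp P p qs) = concat (map (inp P) qs)"
    and outp_ocomp: "composable P p qs \<Longrightarrow> outp P (ocomp P p qs) = outp P p"
    and ocomp_idop_right: "p \<in> opn P \<Longrightarrow> ocomp P p (map (idop P) (inp P p)) = p"
    and ocomp_idop_left: "p \<in> opn P \<Longrightarrow> ocomp P (idop P (outp P p)) [p] = p"
    and ocomp_assoc: "\<lbrakk>composable P p qs; list_all2 (composable P) qs rss\<rbrakk>
        \<Longrightarrow> ocomp P (ocomp P p qs) (concat rss) = ocomp P p (map2 (ocomp P) qs rss)"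

(* The permutation of {..<N} with one-line notation L; it fixes all numbers from N on, as
   required by "permutes". *)
definition lperm :: "nat list \<Rightarrow> nat \<Rightarrow> nat" where
  "lperm L i = (if i < length L then L ! i else i)"

(* blocks [m_0, ..., m_{n-1}] cuts [0, ..., m_0 + ... + m_{n-1} - 1] into consecutive blocks of
   lengths m_0, ..., m_{n-1}. *)
definition blocks :: "nat list \<Rightarrow> nat list list" where
  "blocks ms = map (\<lambda>i. [sum_list (take i ms)..<sum_list (take (Suc i) ms)]) [0..<length ms]"

(* act P s p is the operation (x_0, ..., x_{n-1}) |-> p(x_{s 0}, ..., x_{s (n-1)}).  This is a
   left action; input i of p becomes input s i of act P s p. *)
record ('c, 'o) sym_operad = "('c, 'o) operad" +
  act :: "(nat \<Rightarrow> nat) \<Rightarrow> 'o \<Rightarrow> 'o"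

(* The last two axioms are the usual equivariance of composition: block permutations and direct
   sums of permutations, written in one-line notation. *)
locale symmetric_operad = planar_operad P for P :: "('c, 'o, 'm) sym_operad_scheme" +
  assumes act_opn: "\<lbrakk>p \<in> opn P; s permutes {..<arity P p}\<rbrakk> \<Longrightarrow> act P s p \<in> opn P"
    and inp_act: "\<lbrakk>p \<in> opn P; s permutes {..<arity P p}\<rbrakk>
        \<Longrightarrow> inp P (act P s p) = permute_list (inv s) (inp P p)"
    and outp_act: "\<lbrakk>p \<in> opn P; s permutes {..<arity P p}\<rbrakk> \<Longrightarrow> outp P (act P s p) = outp P p"
    and act_id: "p \<in> opn P \<Longrightarrow> act P id p = p"
    and act_comp: "\<lbrakk>p \<in> opn P; s permutes {..<arity P p}; t permutes {..<arity P p}\<rbrakk>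
        \<Longrightarrow> act P t (act P s p) = act P (t \<circ> s) p"
    and ocomp_act_outer:
      "\<lbrakk>p \<in> opn P; s permutes {..<arity P p}; composable P (act P s p) qs\<rbrakk>
        \<Longrightarrow> ocomp P (act P s p) qs =
            act P (lperm (concat (permute_list s (blocks (map (arity P) qs)))))
              (ocomp P p (permute_list s qs))"
    and ocomp_act_inner:
      "\<lbrakk>composable P p qs; list_all2 (\<lambda>t q. t permutes {..<arity P q}) ts qs\<rbrakk>
        \<Longrightarrow> ocomp P p (map2 (act P) ts qs) =
            act P (lperm (concat (map2 permute_list ts (blocks (map (arity P) qs)))))
              (ocomp P p qs)"

(* Partial composition: q composed with p at input i of q. *)
definition pcomp :: "('c, 'o, 'm) operad_scheme \<Rightarrow> 'o \<Rightarrow> nat \<Rightarrow> 'o \<Rightarrow> 'o" where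
  "pcomp P q i p = ocomp P q ((map (idop P) (inp P q))[i := p])"

definition profiles :: "('c, 'o, 'm) operad_scheme \<Rightarrow> ('c list \<times> 'c) set" where
  "profiles P = {(cs, c). set cs \<subseteq> col P \<and> c \<in> col P}"

definition profile :: "('c, 'o, 'm) operad_scheme \<Rightarrow> 'o \<Rightarrow> 'c list \<times> 'c" where
  "profile P p = (inp P p, outp P p)"

section \<open>The planar case\<close>

datatype 'o ptuple = PTuple (plow: 'o) (ppos: nat) (pups: "'o list")

fun ptuple_from :: "('c, 'o, 'm) operad_scheme \<Rightarrow> 'c list \<times> 'c \<Rightarrow> 'o ptuple \<Rightarrow> bool" where
  "ptuple_from P (cs, c) (PTuple q0 i qs) \<longleftrightarrow>
     q0 \<in> opn P \<and> i < arity P q0 \<and> inp P q0 ! i = c \<and>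
     set qs \<subseteq> opn P \<and> map (outp P) qs = cs"

fun ptuple_id :: "('c, 'o, 'm) operad_scheme \<Rightarrow> 'c list \<times> 'c \<Rightarrow> 'o ptuple" where
  "ptuple_id P (cs, c) = PTuple (idop P c) 0 (map (idop P) cs)"

fun ptuple_tgt :: "('c, 'o, 'm) operad_scheme \<Rightarrow> 'o \<Rightarrow> 'o ptuple \<Rightarrow> 'o" where
  "ptuple_tgt P p (PTuple q0 i qs) = pcomp P q0 i (ocomp P p qs)"

fun ptuple_tgt_profile :: "('c, 'o, 'm) operad_scheme \<Rightarrow> 'o ptuple \<Rightarrow> 'c list \<times> 'c" where
  "ptuple_tgt_profile P (PTuple q0 i qs) =
     (take i (inp P q0) @ concat (map (inp P) qs) @ drop (Suc i) (inp P q0), outp P q0)"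

(* ptuple_comp P g f is "g after f".  The inputs of the target of f, to which the vertices rs of g
   are grafted, are the inputs of q0 before the i-th one, then the inputs of the qs, then the
   inputs of q0 after the i-th one. *)
fun ptuple_comp :: "('c, 'o, 'm) operad_scheme \<Rightarrow> 'o ptuple \<Rightarrow> 'o ptuple \<Rightarrow> 'o ptuple" where
  "ptuple_comp P (PTuple r0 j rs) (PTuple q0 i qs) =
     (let ms = map (arity P) qs; before = take i rs; after = drop (i + sum_list ms) rs in
      PTuple (pcomp P r0 j (ocomp P q0 (before @ [idop P (inp P q0 ! i)] @ after)))
             (j + sum_list (map (arity P) before))
             (map2 (\<lambda>q b. ocomp P q (map (\<lambda>k. rs ! (i + k)) b)) qs (blocks ms)))"

definition pTw :: "('c, 'o, 'm) operad_scheme \<Rightarrow> ('o, 'o \<times> 'o ptuple) cat_data" where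
  "pTw P = \<lparr> Ob = opn P,
             Ar = {(p, f). p \<in> opn P \<and> ptuple_from P (profile P p) f},
             src = fst,
             tgt = (\<lambda>(p, f). ptuple_tgt P p f),
             idt = (\<lambda>p. (p, ptuple_id P (profile P p))),
             cmp = (\<lambda>(t, g) (p, f). (p, ptuple_comp P g f)) \<rparr>"

definition pU :: "('c, 'o, 'm) operad_scheme
    \<Rightarrow> ('c list \<times> 'c, ('c list \<times> 'c) \<times> 'o ptuple) cat_data" where
  "pU P = \<lparr> Ob = profiles P,
            Ar = {(a, f). a \<in> profiles P \<and> ptuple_from P a f},
            src = fst,
            tgt = (\<lambda>(a, f). ptuple_tgt_profile P f),
            idt = (\<lambda>a. (a, ptuple_id P a)),
            cmp = (\<lambda>(b, g) (a, f). (a, ptuple_comp P g f)) \<rparr>"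

(* The classes Upper and Lower are defined for both categories at once; 'x is the type of
   objects. *)
definition pUpper :: "('c, 'o, 'm) operad_scheme \<Rightarrow> ('x, 'x \<times> 'o ptuple) cat_data
    \<Rightarrow> ('x \<times> 'o ptuple) set" where
  "pUpper P C = {(a, f) \<in> Ar C. plow f \<in> idop P ` col P}"

definition pLower :: "('c, 'o, 'm) operad_scheme \<Rightarrow> ('x, 'x \<times> 'o ptuple) cat_data
    \<Rightarrow> ('x \<times> 'o ptuple) set" where
  "pLower P C = {(a, f) \<in> Ar C. set (pups f) \<subseteq> idop P ` col P}"

section \<open>The symmetric case\<close>

(* STuple q_0 [q_1, ..., q_n] l0 [l1, ..., ln] is the tuple (q_0; q_1, ..., q_n; lambda), where
   li lists the numbers lambda(i,1), ..., lambda(i,m_i) and l0 the numbers lambda(0,2), ...,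
   lambda(0,m_0), all decreased by 1, so that leaves are numbered 0, ..., N - 1. *)
datatype 'o stuple =
  STuple (slow: 'o) (sups: "'o list") (slowlab: "nat list") (suplab: "nat list list")

fun stuple_from :: "('c, 'o, 'm) operad_scheme \<Rightarrow> 'c list \<times> 'c \<Rightarrow> 'o stuple \<Rightarrow> bool" where
  "stuple_from P (cs, c) (STuple q0 qs l0 ls) \<longleftrightarrow>
     q0 \<in> opn P \<and> arity P q0 \<ge> 1 \<and> inp P q0 ! 0 = c \<and>
     set qs \<subseteq> opn P \<and> map (outp P) qs = cs \<and>
     length l0 = arity P q0 - 1 \<and> map length ls = map (arity P) qs \<and>
     sorted_wrt (<) l0 \<and> (\<forall>l\<in>set ls. sorted_wrt (<) l) \<and>
     distinct (concat ls @ l0) \<and> set (concat ls @ l0) = {..<length (concat ls @ l0)}"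

fun stuple_id :: "('c, 'o, 'm) operad_scheme \<Rightarrow> 'c list \<times> 'c \<Rightarrow> 'o stuple" where
  "stuple_id P (cs, c) = STuple (idop P c) (map (idop P) cs) [] (map (\<lambda>i. [i]) [0..<length cs])"

(* The inputs of q_0(p(q_1, ..., q_n), -, ..., -) are, in this order, those of q_1, ..., q_n and
   those of q_0 other than the first one. *)
fun stuple_tgt :: "('c, 'o, 'm) sym_operad_scheme \<Rightarrow> 'o \<Rightarrow> 'o stuple \<Rightarrow> 'o" where
  "stuple_tgt P p (STuple q0 qs l0 ls) = act P (lperm (concat ls @ l0)) (pcomp P q0 0 (ocomp P p qs))"

fun stuple_tgt_profile :: "('c, 'o, 'm) operad_scheme \<Rightarrow> 'o stuple \<Rightarrow> 'c list \<times> 'c" where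
  "stuple_tgt_profile P (STuple q0 qs l0 ls) =
     (permute_list (inv (lperm (concat ls @ l0))) (concat (map (inp P) qs) @ tl (inp P q0)),
      outp P q0)"

(* Replaces each number in a list of distinct numbers by its position in the sorted list.  Hence,
   if the inputs of q carry the numbers L, then those of act P (lperm (ranks L)) q carry sort L. *)
definition ranks :: "nat list \<Rightarrow> nat list" where
  "ranks L = map (\<lambda>x. card {y \<in> set L. y < x}) L"

(* stuple_comp P g f is "g after f".  Up i and Lab0 are the numbers given by mu to the inputs of
   the grafted vertices, before these inputs are permuted. *)
fun stuple_comp :: "('c, 'o, 'm) sym_operad_scheme \<Rightarrow> 'o stuple \<Rightarrow> 'o stuple \<Rightarrow> 'o stuple" where
  "stuple_comp P (STuple r0 rs m0 ms) (STuple q0 qs l0 ls) =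
     (let Up = (\<lambda>l. concat (map (\<lambda>j. ms ! j) l));
          Lab0 = Up l0 @ m0;
          q0' = pcomp P r0 0 (ocomp P q0 (idop P (inp P q0 ! 0) # map (\<lambda>j. rs ! j) l0))
      in STuple (act P (lperm (0 # map Suc (ranks Lab0))) q0')
                (map2 (\<lambda>q l. act P (lperm (ranks (Up l))) (ocomp P q (map (\<lambda>j. rs ! j) l))) qs ls)
                (sort Lab0)
                (map (\<lambda>l. sort (Up l)) ls))"

definition sTw :: "('c, 'o, 'm) sym_operad_scheme \<Rightarrow> ('o, 'o \<times> 'o stuple) cat_data" where
  "sTw P = \<lparr> Ob = opn P,
             Ar = {(p, f). p \<in> opn P \<and> stuple_from P (profile P p) f},
             src = fst,
             tgt = (\<lambda>(p, f). stuple_tgt P p f),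
             idt = (\<lambda>p. (p, stuple_id P (profile P p))),
             cmp = (\<lambda>(t, g) (p, f). (p, stuple_comp P g f)) \<rparr>"

definition sU :: "('c, 'o, 'm) sym_operad_scheme
    \<Rightarrow> ('c list \<times> 'c, ('c list \<times> 'c) \<times> 'o stuple) cat_data" where
  "sU P = \<lparr> Ob = profiles P,
            Ar = {(a, f). a \<in> profiles P \<and> stuple_from P a f},
            src = fst,
            tgt = (\<lambda>(a, f). stuple_tgt_profile P f),
            idt = (\<lambda>a. (a, stuple_id P a)),
            cmp = (\<lambda>(b, g) (a, f). (a, stuple_comp P g f)) \<rparr>"

definition sUpper :: "('c, 'o, 'm) sym_operad_scheme \<Rightarrow> ('x, 'x \<times> 'o stuple) cat_data
    \<Rightarrow> ('x \<times> 'o stuple) set" where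
  "sUpper P C = {(a, f) \<in> Ar C. slow f \<in> idop P ` col P}"

(* As the upper vertices are identities, each list in suplab f has exactly one element. *)
definition sLower :: "('c, 'o, 'm) sym_operad_scheme \<Rightarrow> ('x, 'x \<times> 'o stuple) cat_data
    \<Rightarrow> ('x \<times> 'o stuple) set" where
  "sLower P C = {(a, f) \<in> Ar C. set (sups f) \<subseteq> idop P ` col P \<and>
     sorted_wrt (<) (map (\<lambda>l. l ! 0) (suplab f))}"

end

theory Submission
  imports Defs
begin

text \<open>The twisted arrow category is the category of elements of a functor on the enveloping
category: a tuple \<open>f\<close> that starts at a profile sends every operation \<open>p\<close> of that profile to the
target of \<open>f\<close> at \<open>p\<close>, and this respects identities and composites. A strict factorization system
lifts from a category to every category of elements over it, because the factors of \<open>(p, f)\<close> can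
only be \<open>(p, l)\<close> and \<open>(p l, r)\<close>, where \<open>l\<close> and \<open>r\<close> are the factors of \<open>f\<close>. This is
\<open>strict_factorization_system_elements\<close>; what remains concerns tuples only.

The factors of a tuple are visible at once: the upper one keeps the upper vertices above an
identity, the lower one keeps the lower vertex below identities. In the planar case nothing is
left to choose. In the symmetric case the leaves between the two factors have to be numbered. A
lower tuple embeds these numbers increasingly into the numbers of all leaves of the composite,
hence the number of an intermediate leaf is its rank among the leaves of the upper vertices
(\<open>factors\<close>, \<open>factors_unique\<close>).

The work lies in showing that tuples form a category which acts on operations. In the planar case
this is associativity of operadic composition, once the list of vertices grafted onto a tuple has
been cut into those left of the distinguished input, those on each upper vertex, and those right
of it. In the symmetric case the composite of two tuples is defined by composing vertices and then
permuting the inputs of the results. These permutations never have to be followed through the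
associativity law, for the following reason. A vertex together with the numbers of its
inputs is an operation whose inputs carry labels. Grafting labelled operations onto labels behaves
like substitution into terms: it is strictly associative and unital, with no permutation involved
(\<open>graft_graft\<close>, \<open>graft_unit_right\<close>, \<open>graft_unit_left\<close>). Say that two labelled operations are
similar if they differ by a permutation of the inputs that carries the labels along. The
equivariance axioms of a symmetric operad state precisely that grafting respects similarity in
both arguments (\<open>sim_graft_left\<close>, \<open>sim_graft_right\<close>), and a similarity class contains at most one
labelled operation with increasing labels (\<open>sim_sorted_eq\<close>). The vertices of a composite are, up
to similarity, grafts of the vertices of its factors (\<open>tuple_stuple_comp\<close>). So an equation between
tuples only has to be checked up to similarity (\<open>tuple_eqI\<close>), and there it becomes an equation
between iterated grafts.\<close>

section \<open>Categories of elements\<close>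

text \<open>The enveloping category is the case in which \<open>X\<close> is the set of profiles, \<open>\<pi>\<close> the identity
and \<open>T\<close> the target profile; for the twisted arrow category \<open>X\<close> is the set of operations and \<open>\<pi>\<close>
takes profiles.\<close>

definition elements ::
    "'x set \<Rightarrow> ('x \<Rightarrow> 'a) \<Rightarrow> ('a \<Rightarrow> 'f \<Rightarrow> bool) \<Rightarrow> ('x \<Rightarrow> 'f \<Rightarrow> 'x) \<Rightarrow> ('a \<Rightarrow> 'f) \<Rightarrow> ('f \<Rightarrow> 'f \<Rightarrow> 'f)
      \<Rightarrow> ('x, 'x \<times> 'f) cat_data" where
  "elements X \<pi> starts T ident composite =
     \<lparr> Ob = X, Ar = {(x, f). x \<in> X \<and> starts (\<pi> x) f}, src = fst, tgt = (\<lambda>(x, f). T x f),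
       idt = (\<lambda>x. (x, ident (\<pi> x))), cmp = (\<lambda>(y, g) (x, f). (x, composite g f)) \<rparr>"

text \<open>A category with a strict factorization system, presented by arrows which do not record their
source: the same tuple may start at several objects, but its target is determined by the tuple
alone.\<close>

locale factorized_tuples =
  fixes A :: "'a set" and starts :: "'a \<Rightarrow> 'f \<Rightarrow> bool" and target :: "'f \<Rightarrow> 'a"
    and ident :: "'a \<Rightarrow> 'f" and composite :: "'f \<Rightarrow> 'f \<Rightarrow> 'f"
    and upper :: "'f \<Rightarrow> bool" and lower :: "'f \<Rightarrow> bool"
  assumes target_in: "\<lbrakk>a \<in> A; starts a f\<rbrakk> \<Longrightarrow> target f \<in> A"
    and ident_starts: "a \<in> A \<Longrightarrow> starts a (ident a)"
    and ident_target: "a \<in> A \<Longrightarrow> target (ident a) = a"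
    and composite_starts: "\<lbrakk>a \<in> A; starts a f; starts (target f) g\<rbrakk> \<Longrightarrow> starts a (composite g f)"
    and composite_target: "\<lbrakk>a \<in> A; starts a f; starts (target f) g\<rbrakk>
      \<Longrightarrow> target (composite g f) = target g"
    and composite_ident_right: "\<lbrakk>a \<in> A; starts a f\<rbrakk> \<Longrightarrow> composite f (ident a) = f"
    and composite_ident_left: "\<lbrakk>a \<in> A; starts a f\<rbrakk> \<Longrightarrow> composite (ident (target f)) f = f"
    and composite_assoc: "\<lbrakk>a \<in> A; starts a f; starts (target f) g; starts (target g) h\<rbrakk>
      \<Longrightarrow> composite h (composite g f) = composite (composite h g) f"
    and upper_ident: "a \<in> A \<Longrightarrow> upper (ident a)"
    and lower_ident: "a \<in> A \<Longrightarrow> lower (ident a)"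
    and upper_composite: "\<lbrakk>a \<in> A; starts a f; starts (target f) g; upper f; upper g\<rbrakk>
      \<Longrightarrow> upper (composite g f)"
    and lower_composite: "\<lbrakk>a \<in> A; starts a f; starts (target f) g; lower f; lower g\<rbrakk>
      \<Longrightarrow> lower (composite g f)"
    and factorization_exists: "\<lbrakk>a \<in> A; starts a f\<rbrakk>
      \<Longrightarrow> \<exists>l r. starts a l \<and> starts (target l) r \<and> upper l \<and> lower r \<and> composite r l = f"
    and factorization_unique: "\<lbrakk>a \<in> A; starts a l; starts (target l) r; upper l; lower r;
        starts a l'; starts (target l') r'; upper l'; lower r'; composite r l = composite r' l'\<rbrakk>
          \<Longrightarrow> l = l' \<and> r = r'"

text \<open>The functor from the category of elements to the category of tuples is a discrete
opfibration: an arrow is determined by its source and its image, and every arrow starting at the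
image of an object lifts. All laws and the factorizations are therefore inherited.\<close>

lemma (in factorized_tuples) strict_factorization_system_elements:
  fixes X :: "'x set" and \<pi> :: "'x \<Rightarrow> 'a" and T :: "'x \<Rightarrow> 'f \<Rightarrow> 'x"
  defines "C \<equiv> elements X \<pi> starts T ident composite"
  assumes \<pi>: "\<And>x. x \<in> X \<Longrightarrow> \<pi> x \<in> A"
    and T_in: "\<And>x f. \<lbrakk>x \<in> X; starts (\<pi> x) f\<rbrakk> \<Longrightarrow> T x f \<in> X"
    and \<pi>_T: "\<And>x f. \<lbrakk>x \<in> X; starts (\<pi> x) f\<rbrakk> \<Longrightarrow> \<pi> (T x f) = target f"
    and T_ident: "\<And>x. x \<in> X \<Longrightarrow> T x (ident (\<pi> x)) = x"
    and T_composite: "\<And>x f g. \<lbrakk>x \<in> X; starts (\<pi> x) f; starts (target f) g\<rbrakk>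
      \<Longrightarrow> T x (composite g f) = T (T x f) g"
  shows "strict_factorization_system C {(x, f) \<in> Ar C. upper f} {(x, f) \<in> Ar C. lower f}"
proof -
  have C: "Ob C = X" "Ar C = {(x, f). x \<in> X \<and> starts (\<pi> x) f}" "src C = fst"
    "\<And>x f. tgt C (x, f) = T x f" "\<And>x. idt C x = (x, ident (\<pi> x))"
    "\<And>y g x f. cmp C (y, g) (x, f) = (x, composite g f)"
    by (simp_all add: C_def elements_def)
  have cat: "category C"
  proof (unfold_locales, goal_cases)
    case (6 f g) then show ?case by (cases f; cases g) (auto simp: C \<pi> \<pi>_T composite_starts)
  next
    case (8 f g) then show ?case by (cases f; cases g) (auto simp: C \<pi> \<pi>_T T_composite)
  next
    case (9 f) then show ?case by (cases f) (auto simp: C \<pi> composite_ident_right)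
  next
    case (10 f) then show ?case
      by (cases f) (auto simp: C \<pi>_T composite_ident_left[OF \<pi>])
  next
    case (11 f g h) then show ?case
      by (cases f; cases g; cases h) (auto simp: C \<pi>_T T_in composite_assoc[OF \<pi>])
  qed (auto simp: C \<pi> T_in ident_starts T_ident)
  have wide: "wide_subcategory C {(x, f) \<in> Ar C. upper f}"
    "wide_subcategory C {(x, f) \<in> Ar C. lower f}"
    unfolding wide_subcategory_def
    by (auto simp: C \<pi> \<pi>_T ident_starts composite_starts upper_ident lower_ident
        upper_composite[OF \<pi>] lower_composite[OF \<pi>])
  have factor: "\<exists>!lr. fst lr \<in> {(x, f) \<in> Ar C. upper f} \<and> snd lr \<in> {(x, f) \<in> Ar C. lower f} \<and>
      tgt C (fst lr) = src C (snd lr) \<and> cmp C (snd lr) (fst lr) = f" if f: "f \<in> Ar C" for f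
  proof -
    obtain x t where [simp]: "f = (x, t)" by fastforce
    have x: "x \<in> X" "starts (\<pi> x) t" using f by (auto simp: C)
    then obtain l r where lr: "starts (\<pi> x) l" "starts (target l) r" "upper l" "lower r"
      "composite r l = t"
      using factorization_exists[OF \<pi>] by blast
    show ?thesis
    proof (rule ex1I[of _ "((x, l), (T x l, r))"], goal_cases)
      case 1 show ?case using x lr by (simp add: C T_in \<pi>_T)
    next
      case (2 lr')
      then obtain l' r' where lr': "lr' = ((x, l'), (T x l', r'))" "starts (\<pi> x) l'"
        "starts (target l') r'" "upper l'" "lower r'" "composite r' l' = t"
        by (cases lr') (auto simp: C \<pi>_T)
      then have "l = l' \<and> r = r'"
        using lr by (intro factorization_unique[OF \<pi>[OF x(1)]]) auto
      with lr' show ?case by simp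
    qed
  qed
  show ?thesis
    unfolding strict_factorization_system_def by (intro conjI ballI cat wide factor)
qed

section \<open>Lists cut into blocks\<close>

lemma map_plus_upt: "map ((+) m) [a..<b] = [m + a..<m + b]" for m :: nat
  by (rule nth_equalityI) simp_all

text \<open>The recursion that makes blocks accessible to induction over lists.\<close>

lemma blocks_Cons: "blocks (m # ms) = [0..<m] # map (map ((+) m)) (blocks ms)"
proof -
  have "[0..<length (m # ms)] = 0 # map Suc [0..<length ms]"
    by (simp add: map_Suc_upt upt_conv_Cons del: upt_Suc)
  then show ?thesis by (simp only: blocks_def) (simp add: o_def map_plus_upt)
qed

lemma blocks_Nil: "blocks [] = []"
  by (simp add: blocks_def)

lemma map_length_blocks: "map length (blocks ms) = ms"
  by (induction ms) (simp_all add: blocks_Nil blocks_Cons o_def)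

lemma concat_blocks: "concat (blocks ms) = [0..<sum_list ms]"
proof (induction ms)
  case (Cons m ms)
  then have "concat (blocks (m # ms)) = [0..<m] @ map ((+) m) [0..<sum_list ms]"
    by (simp add: blocks_Cons map_concat[symmetric])
  then show ?case by (simp add: upt_add_eq_append[of 0] map_plus_upt)
qed (simp add: blocks_Nil)

text \<open>Indexing a concatenated list by the blocks recovers the pieces; it turns the index
arithmetic in the definitions of composites and in the equivariance axioms into statements on
lists of lists.\<close>

lemma map_nth_blocks: "map (map ((!) (concat xss))) (blocks (map length xss)) = xss"
proof (induction xss)
  case (Cons xs xss)
  have "map ((!) (xs @ concat xss)) [0..<length xs] = xs"
    by (rule nth_equalityI) (auto simp: nth_append)
  moreover have "map (map ((!) (xs @ concat xss))) (map (map ((+) (length xs))) (blocks (map length xss)))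
      = map (map ((!) (concat xss))) (blocks (map length xss))"
    by (simp add: o_def nth_append)
  ultimately show ?case using Cons by (simp add: blocks_Cons)
qed (simp add: blocks_Nil)

lemma length_blocks: "length (blocks ms) = length ms"
  by (simp add: blocks_def)

lemma concat_concat_map: "concat (concat xsss) = concat (map concat xsss)"
  by (induction xsss) simp_all

lemma concat_singletons: "concat (map (\<lambda>x. [x]) xs) = xs"
  by (induction xs) auto

lemma map_eq_concat_conv:
  "map f xs = concat yss \<Longrightarrow> \<exists>xss. xs = concat xss \<and> map (map f) xss = yss"
proof (induction yss arbitrary: xs)
  case (Cons ys yss)
  then obtain us vs where "xs = us @ vs" "map f us = ys" "map f vs = concat yss"
    by (auto simp: map_eq_append_conv)
  moreover from this obtain xss where "vs = concat xss" "map (map f) xss = yss"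
    using Cons.IH by blast
  ultimately show ?case by (intro exI[of _ "us # xss"]) simp
qed simp

lemma map2_map_right: "map2 f xs (map g ys) = map2 (\<lambda>x y. f x (g y)) xs ys"
  by (simp add: zip_map2 case_prod_unfold)

lemma list_all2_concat_left:
  "list_all2 p (concat xss) zs \<Longrightarrow> \<exists>zss. zs = concat zss \<and> list_all2 (list_all2 p) xss zss"
proof (induction xss arbitrary: zs)
  case (Cons xs xss)
  then obtain us vs where "zs = us @ vs" "list_all2 p xs us" "list_all2 p (concat xss) vs"
    by (auto simp: list_all2_append1)
  moreover from this obtain vss where "vs = concat vss" "list_all2 (list_all2 p) xss vss"
    using Cons.IH by blast
  ultimately show ?case by (intro exI[of _ "us # vss"]) simp
qed simp

lemma map2_concat:
  "list_all2 (list_all2 p) xss yss \<Longrightarrow> map2 f (concat xss) (concat yss) = concat (map2 (map2 f) xss yss)"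
  by (induction rule: list_all2_induct) (auto dest: list_all2_lengthD)

section \<open>Composition in planar operads\<close>

context planar_operad
begin

definition family :: "'c list \<Rightarrow> 'o list \<Rightarrow> bool" where
  "family cs qs \<longleftrightarrow> set qs \<subseteq> opn P \<and> map (outp P) qs = cs"

abbreviation families :: "'o list \<Rightarrow> 'o list list \<Rightarrow> bool" where
  "families \<equiv> list_all2 (composable P)"

lemma composable_iff_family: "composable P p qs \<longleftrightarrow> p \<in> opn P \<and> family (inp P p) qs"
  by (auto simp: composable_def family_def)

lemma family_Nil: "family [] qs \<longleftrightarrow> qs = []"
  and family_Cons_Cons: "family (c # cs) (q # qs) \<longleftrightarrow> q \<in> opn P \<and> outp P q = c \<and> family cs qs"
  by (auto simp: family_def)

lemma family_append: "\<lbrakk>family as xs; family bs ys\<rbrakk> \<Longrightarrow> family (as @ bs) (xs @ ys)"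
  by (auto simp: family_def)

lemma family_appendE:
  assumes "family (as @ bs) zs"
  obtains xs ys where "zs = xs @ ys" "family as xs" "family bs ys"
  using assms unfolding family_def by (fastforce simp: map_eq_append_conv)

lemma family_length: "family cs qs \<Longrightarrow> length qs = length cs"
  by (auto simp: family_def)

lemma family_idop: "set cs \<subseteq> col P \<Longrightarrow> family cs (map (idop P) cs)"
  by (auto simp: family_def idop_opn outp_idop map_idI subset_iff)

lemma family_idop_inp: "q \<in> opn P \<Longrightarrow> family (inp P q) (map (idop P) (inp P q))"
  by (rule family_idop[OF inp_col])

lemma families_family: "families qs Rs \<Longrightarrow> family (concat (map (inp P) qs)) (concat Rs)"
  by (induction rule: list_all2_induct) (auto simp: composable_iff_family family_Nil intro: family_append)

text \<open>Operations that fit the inputs of a whole row of vertices can be distributed over the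
vertices.\<close>

lemma families_exist:
  assumes "set qs \<subseteq> opn P" "family (concat (map (inp P) qs)) rs"
  obtains Rs where "rs = concat Rs" "families qs Rs"
proof -
  obtain Rs where Rs: "rs = concat Rs" "map (map (outp P)) Rs = map (inp P) qs"
    using assms(2) map_eq_concat_conv unfolding family_def by blast
  have "families qs Rs"
    unfolding list_all2_conv_all_nth
  proof (intro conjI allI impI)
    show len: "length qs = length Rs" using Rs(2) by (metis length_map)
    fix i assume i: "i < length qs"
    have "map (outp P) (Rs ! i) = inp P (qs ! i)"
      using arg_cong[OF Rs(2), of "\<lambda>xs. xs ! i"] i len by simp
    moreover have "set (Rs ! i) \<subseteq> opn P"
    proof -
      have "\<forall>R\<in>set Rs. set R \<subseteq> opn P" using assms(2) by (auto simp: family_def Rs(1))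
      then show ?thesis using i len by simp
    qed
    ultimately show "composable P (qs ! i) (Rs ! i)"
      using assms(1) i by (auto simp: composable_def)
  qed
  with Rs(1) that show thesis by blast
qed

lemma families_lengths: "families qs Rs \<Longrightarrow> map length Rs = map (arity P) qs"
  by (induction rule: list_all2_induct) (auto simp: composable_iff_family family_length)

lemma family_map2_ocomp: "\<lbrakk>family cs qs; families qs Rs\<rbrakk> \<Longrightarrow> family cs (map2 (ocomp P) qs Rs)"
  by (rotate_tac, induction arbitrary: cs rule: list_all2_induct)
    (auto simp: family_def ocomp_opn outp_ocomp)

lemma inp_map2_ocomp:
  "families qs Rs \<Longrightarrow> concat (map (inp P) (map2 (ocomp P) qs Rs)) = concat (map (inp P) (concat Rs))"
  by (induction rule: list_all2_induct) (auto simp: inp_ocomp)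

lemma families_idop: "set qs \<subseteq> opn P \<Longrightarrow> families qs (map (map (idop P) \<circ> inp P) qs)"
  by (auto simp: list_all2_conv_all_nth composable_iff_family family_idop_inp subset_iff)

lemma map2_ocomp_idop: "set qs \<subseteq> opn P \<Longrightarrow> map2 (ocomp P) qs (map (map (idop P) \<circ> inp P) qs) = qs"
  by (auto intro!: nth_equalityI simp: ocomp_idop_right subset_iff)

lemma families_singletons:
  "family cs qs \<Longrightarrow> set cs \<subseteq> col P \<Longrightarrow> families (map (idop P) cs) (map (\<lambda>q. [q]) qs)"
  by (auto simp: list_all2_conv_all_nth composable_iff_family family_def inp_idop idop_opn subset_iff)

lemma map2_idop_ocomp:
  "family cs qs \<Longrightarrow> map2 (ocomp P) (map (idop P) cs) (map (\<lambda>q. [q]) qs) = qs"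
  by (auto intro!: nth_equalityI simp: family_def ocomp_idop_left subset_iff)

lemma map2_ocomp_assoc:
  "\<lbrakk>families qs Rs; list_all2 families Rs Ss\<rbrakk>
    \<Longrightarrow> map2 (ocomp P) (map2 (ocomp P) qs Rs) (map concat Ss) = map2 (ocomp P) qs (map2 (map2 (ocomp P)) Rs Ss)"
  by (induction arbitrary: Ss rule: list_all2_induct) (auto simp: list_all2_Cons1 ocomp_assoc)

text \<open>Associativity of operadic composition with one distinguished input, onto which \<open>x\<close> is
grafted.\<close>

lemma ocomp_middle:
  assumes "q \<in> opn P" "inp P q = as @ c # bs" "family as B" "family bs A" "composable P x X"
    "outp P x = c"
    and "families B BB" "families A AA"
  shows "ocomp P (ocomp P q (B @ x # A)) (concat BB @ X @ concat AA) =
    ocomp P q (map2 (ocomp P) B BB @ ocomp P x X # map2 (ocomp P) A AA)"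
proof -
  have "composable P q (B @ x # A)"
    using assms(1-6) by (auto simp: composable_iff_family intro!: family_append simp: family_Cons_Cons)
  moreover have "families (B @ x # A) (BB @ X # AA)"
    using assms(5,7,8) by (intro list_all2_appendI) auto
  ultimately show ?thesis
    using ocomp_assoc[of q "B @ x # A" "BB @ X # AA"] list_all2_lengthD[OF assms(7)] by simp
qed

lemma composable_middle:
  assumes "q \<in> opn P" "inp P q = as @ c # bs" "family as B" "family bs A" "x \<in> opn P" "outp P x = c"
  shows "composable P q (B @ x # A)"
  using assms by (auto simp: composable_iff_family intro!: family_append simp: family_Cons_Cons)

lemma ocomp_middle_props:
  assumes "q \<in> opn P" "inp P q = as @ c # bs" "family as B" "family bs A" "x \<in> opn P" "outp P x = c"
  shows "ocomp P q (B @ x # A) \<in> opn P"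
    "inp P (ocomp P q (B @ x # A)) = concat (map (inp P) B) @ inp P x @ concat (map (inp P) A)"
    "outp P (ocomp P q (B @ x # A)) = outp P q"
  using composable_middle[OF assms] by (simp_all add: ocomp_opn inp_ocomp outp_ocomp)

lemma pcomp_eq:
  assumes "inp P q = as @ c # bs"
  shows "pcomp P q (length as) x = ocomp P q (map (idop P) as @ x # map (idop P) bs)"
proof -
  have "(map (idop P) (as @ c # bs))[length as := x] = map (idop P) as @ x # map (idop P) bs"
    by (simp add: list_update_append)
  then show ?thesis by (simp only: pcomp_def assms)
qed

lemma concat_inp_idop: "set cs \<subseteq> col P \<Longrightarrow> concat (map (inp P) (map (idop P) cs)) = cs"
  by (induction cs) (auto simp: inp_idop)

lemma inp_split_col:
  assumes "q \<in> opn P" "inp P q = as @ c # bs"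
  shows "set as \<subseteq> col P" "c \<in> col P" "set bs \<subseteq> col P"
  using inp_col[OF assms(1)] assms(2) by auto

lemma pcomp_props:
  assumes "q \<in> opn P" "inp P q = as @ c # bs" "x \<in> opn P" "outp P x = c"
  shows "pcomp P q (length as) x \<in> opn P" "inp P (pcomp P q (length as) x) = as @ inp P x @ bs"
    "outp P (pcomp P q (length as) x) = outp P q"
  using ocomp_middle_props[OF assms(1,2) family_idop family_idop assms(3,4)] inp_split_col[OF assms(1,2)]
  by (simp_all add: pcomp_eq[OF assms(2)] concat_inp_idop del: map_map)

text \<open>Plugging identities into all inputs but one does nothing, so grafting onto a partial
composite splits into grafting onto the upper operation and filling the other inputs of the lower
one.\<close>

lemma ocomp_pcomp:
  assumes "q \<in> opn P" "inp P q = as @ c # bs" "composable P x X" "outp P x = c" "family as B"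
    "family bs A"
  shows "ocomp P (pcomp P q (length as) x) (B @ X @ A) = ocomp P q (B @ ocomp P x X # A)"
proof -
  note cols = inp_split_col[OF assms(1,2)]
  show ?thesis
    using ocomp_middle[OF assms(1,2) family_idop[OF cols(1)] family_idop[OF cols(3)] assms(3,4)
        families_singletons[OF assms(5) cols(1)] families_singletons[OF assms(6) cols(3)]]
    unfolding pcomp_eq[OF assms(2)] map2_idop_ocomp[OF assms(5)] map2_idop_ocomp[OF assms(6)] concat_singletons .
qed

text \<open>An identity keeps the distinguished input open; composing there afterwards replaces the
identity.\<close>

lemma pcomp_ocomp_idop:
  assumes "q \<in> opn P" "inp P q = as @ c # bs" "family as B" "family bs A" "e \<in> col P" "c = e"
    "y \<in> opn P" "outp P y = e"
  shows "pcomp P (ocomp P q (B @ idop P e # A)) (length (concat (map (inp P) B))) y = ocomp P q (B @ y # A)"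
proof -
  let ?W = "ocomp P q (B @ idop P e # A)"
  have "inp P ?W = concat (map (inp P) B) @ e # concat (map (inp P) A)"
    using ocomp_middle_props(2)[OF assms(1-4), of "idop P e"] assms(5,6)
      by (simp add: idop_opn outp_idop inp_idop)
  note W = pcomp_eq[OF this, of y]
  have B: "set B \<subseteq> opn P" "set A \<subseteq> opn P" using assms(3,4) by (auto simp: family_def)
  have "ocomp P ?W (concat (map (map (idop P) \<circ> inp P) B) @ [y] @ concat (map (map (idop P) \<circ> inp P) A)) =
    ocomp P q (B @ ocomp P (idop P e) [y] # A)"
    using ocomp_middle[OF assms(1-4), of "idop P e"
      "[y]", OF _ _ families_idop[OF B(1)] families_idop[OF B(2)]]
      assms(5-8) by (simp add: map2_ocomp_idop B composable_def idop_opn inp_idop outp_idop)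
  then show ?thesis
    using ocomp_idop_left[OF assms(7)] assms(8) by (simp add: W map_concat)
qed

lemma pcomp_pcomp:
  assumes "q \<in> opn P" "inp P q = as @ c # bs" "x \<in> opn P" "outp P x = c" "inp P x = ds @ e # es"
    "y \<in> opn P" "outp P y = e"
  shows "pcomp P (pcomp P q (length as) x) (length as + length ds) y = pcomp P q (length as) (pcomp P x (length ds) y)"
proof -
  note cols = inp_split_col[OF assms(1,2)] and cols' = inp_split_col[OF assms(3,5)]
  have "inp P (pcomp P q (length as) x) = (as @ ds) @ e # es @ bs"
    using pcomp_props(2)[OF assms(1-4)] assms(5) by simp
  from pcomp_eq[OF this, of y]
  have "pcomp P (pcomp P q (length as) x) (length as + length ds) y =
    ocomp P (pcomp P q (length as) x)
      (map (idop P) as @ (map (idop P) ds @ y # map (idop P) es) @ map (idop P) bs)" by simp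
  also have "\<dots> = ocomp P q (map (idop P) as @ ocomp P x (map (idop P) ds @ y # map (idop P) es) # map (idop P) bs)"
    by (rule ocomp_pcomp[OF assms(1,2) composable_middle[OF assms(3,5) family_idop family_idop assms(6,7)] assms(4)
        family_idop family_idop]) (use cols cols' in auto)
  finally show ?thesis by (simp add: pcomp_eq[OF assms(2)] pcomp_eq[OF assms(5)])
qed

lemma pcomp_idop_right:
  assumes "q \<in> opn P" "inp P q = as @ c # bs"
  shows "pcomp P q (length as) (idop P c) = q"
  using ocomp_idop_right[OF assms(1)] by (simp add: pcomp_eq[OF assms(2)] assms(2))

lemma pcomp_idop_left: "\<lbrakk>x \<in> opn P; outp P x = c\<rbrakk> \<Longrightarrow> pcomp P (idop P c) 0 x = x"
  using ocomp_idop_left[of x] outp_col[of x] by (auto simp: pcomp_def inp_idop)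

section \<open>Planar tuples\<close>

text \<open>A planar tuple from \<open>a\<close> to \<open>b\<close>, with the input colours of its lower vertex \<open>q0\<close> split at the
distinguished input, whose position is therefore the length of \<open>as\<close>.\<close>

definition planar_tuple ::
    "'c list \<times> 'c \<Rightarrow> 'c list \<times> 'c \<Rightarrow> 'o \<Rightarrow> 'c list \<Rightarrow> 'c list \<Rightarrow> 'o list \<Rightarrow> bool" where
  "planar_tuple a b q0 as bs qs \<longleftrightarrow> q0 \<in> opn P \<and> inp P q0 = as @ snd a # bs \<and> family (fst a) qs \<and>
     b = (as @ concat (map (inp P) qs) @ bs, outp P q0)"

lemma planar_tupleE:
  assumes "ptuple_from P a f"
  obtains q0 as bs qs where "f = PTuple q0 (length as) qs"
    "planar_tuple a (ptuple_tgt_profile P f) q0 as bs qs"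
proof -
  obtain q0 i qs where f: "f = PTuple q0 i qs" by (cases f)
  obtain cs c where a: "a = (cs, c)" by fastforce
  have i: "i < arity P q0" "inp P q0 ! i = c" using assms by (simp_all add: f a)
  show thesis
    by (rule that[of q0 "take i (inp P q0)" qs "drop (Suc i) (inp P q0)"])
      (use assms i id_take_nth_drop[OF i(1)] in \<open>simp_all add: f a planar_tuple_def family_def\<close>)
qed

lemma planar_tuple_from:
  assumes "planar_tuple a b q0 as bs qs"
  shows "ptuple_from P a (PTuple q0 (length as) qs)"
    "ptuple_tgt_profile P (PTuple q0 (length as) qs) = b"
  using assms by (cases a; auto simp: planar_tuple_def family_def)+

text \<open>When the list of vertices of the second tuple is presented as already cut along the first
one, the composite involves neither \<open>take\<close> and \<open>drop\<close> nor blocks.\<close>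

lemma ptuple_comp_split:
  assumes "map length Rs = map (arity P) qs"
  shows "ptuple_comp P (PTuple r0 j (B @ concat Rs @ A)) (PTuple q0 (length B) qs) =
    PTuple (pcomp P r0 j (ocomp P q0 (B @ idop P (inp P q0 ! length B) # A)))
      (j + length (concat (map (inp P) B))) (map2 (ocomp P) qs Rs)"
proof -
  have sum: "sum_list (map (arity P) qs) = length (concat Rs)"
    by (simp only: assms[symmetric] length_concat)
  have "map (\<lambda>b. map (\<lambda>k. (B @ concat Rs @ A) ! (length B + k)) b) (blocks (map (arity P) qs)) =
      map (map ((!) (concat Rs))) (blocks (map length Rs))"
  proof -
    have "k < length (concat Rs)" if "b \<in> set (blocks (map length Rs))" "k \<in> set b" for b k
    proof -
      have "k \<in> set (concat (blocks (map length Rs)))" using that by auto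
      then show ?thesis unfolding concat_blocks length_concat by simp
    qed
    then show ?thesis unfolding assms[symmetric] by (auto simp: nth_append)
  qed
  also have "\<dots> = Rs" by (rule map_nth_blocks)
  finally have "map2 (\<lambda>q b. ocomp P q (map (\<lambda>k. (B @ concat Rs @ A) ! (length B + k)) b)) qs (blocks (map (arity P) qs))
      = map2 (ocomp P) qs Rs"
    by (metis map2_map_right)
  then show ?thesis by (simp add: Let_def sum length_concat o_def)
qed

lemma families_map2:
  "\<lbrakk>families qs Rs; list_all2 families Rs Qss\<rbrakk> \<Longrightarrow> families qs (map2 (map2 (ocomp P)) Rs Qss)"
  by (induction arbitrary: Qss rule: list_all2_induct)
    (auto simp: list_all2_Cons1 composable_iff_family family_map2_ocomp)

lemma families_ocomp:
  "\<lbrakk>families qs Rs; list_all2 families Rs Qss\<rbrakk> \<Longrightarrow> families (map2 (ocomp P) qs Rs) (map concat Qss)"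
  by (induction arbitrary: Qss rule: list_all2_induct)
    (auto simp: list_all2_Cons1 composable_iff_family[of "ocomp P _ _"] ocomp_opn inp_ocomp
      composable_iff_family[THEN iffD1, THEN conjunct1] families_family)

lemma planar_tuple_splitE:
  assumes f: "planar_tuple a b q0 as bs qs" and g: "planar_tuple b e r0 as' bs' rs"
  obtains B Rs A where "rs = B @ concat Rs @ A" "family as B" "families qs Rs" "family bs A"
proof -
  have qs: "set qs \<subseteq> opn P" using f by (simp add: planar_tuple_def family_def)
  have "family (as @ concat (map (inp P) qs) @ bs) rs" using f g by (simp add: planar_tuple_def)
  then obtain B M A where "rs = B @ M @ A" "family as B" "family (concat (map (inp P) qs)) M"
    "family bs A"
    by (metis family_appendE)
  with families_exist[OF qs] that show thesis by metis
qed

lemma planar_tuple_comp: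
  assumes f: "planar_tuple a b q0 as bs qs" and g: "planar_tuple b e r0 as' bs' (B @ concat Rs @ A)"
    and B: "family as B" and Rs: "families qs Rs" and A: "family bs A"
  defines "p \<equiv> pcomp P r0 (length as') (ocomp P q0 (B @ idop P (snd a) # A))"
  shows "ptuple_comp P (PTuple r0 (length as') (B @ concat Rs @ A)) (PTuple q0 (length as) qs) =
      PTuple p (length (as' @ concat (map (inp P) B))) (map2 (ocomp P) qs Rs)"
    and "planar_tuple a e p (as' @ concat (map (inp P) B)) (concat (map (inp P) A) @ bs') (map2 (ocomp P) qs Rs)"
proof -
  note f' = f[unfolded planar_tuple_def] and g' = g[unfolded planar_tuple_def]
  have q0: "q0 \<in> opn P" "inp P q0 = as @ snd a # bs" and r0: "r0 \<in> opn P"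
    "inp P r0 = as' @ snd b # bs'"
    using f' g' by blast+
  have c: "snd a \<in> col P" using inp_split_col(2)[OF q0] .
  have len: "length B = length as" using family_length[OF B] .
  show "ptuple_comp P (PTuple r0 (length as') (B @ concat Rs @ A)) (PTuple q0 (length as) qs) =
      PTuple p (length (as' @ concat (map (inp P) B))) (map2 (ocomp P) qs Rs)"
    using ptuple_comp_split[OF families_lengths[OF Rs], of r0 "length as'" B A q0] q0(2)
    by (simp add: len p_def)
  note mid = ocomp_middle_props[OF q0 B A idop_opn[OF c] outp_idop[OF c]]
  have "outp P (ocomp P q0 (B @ idop P (snd a) # A)) = snd b" using mid(3) f' by simp
  note p = pcomp_props[OF r0 mid(1) this, folded p_def]
  show "planar_tuple a e p (as' @ concat (map (inp P) B)) (concat (map (inp P) A) @ bs') (map2 (ocomp P) qs Rs)"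
    unfolding planar_tuple_def
    using p mid(2) g' family_map2_ocomp[OF _ Rs] f' by (simp add: inp_idop c inp_map2_ocomp[OF Rs] del: map_map)
qed

text \<open>Each vertex of \<open>H\<close> sits on an input of \<open>G\<close> that belongs either to the lower vertex of \<open>G\<close>
(\<open>B2\<close>, \<open>A2\<close>), or to a vertex grafted onto the lower vertex of \<open>F\<close> (\<open>SB\<close>, \<open>SA\<close>), or to a vertex
grafted onto an upper vertex of \<open>F\<close> (\<open>Qss\<close>). With \<open>H\<close> cut accordingly, both composites have
explicit vertices, and these agree by associativity in the operad.\<close>

lemma ptuple_comp_assoc:
  assumes f: "planar_tuple a b q0 as bs qs" and g: "planar_tuple b e r0 as' bs' rs"
    and h: "planar_tuple e w s0 as'' bs'' ss"
  defines "F \<equiv> PTuple q0 (length as) qs" and "G \<equiv> PTuple r0 (length as') rs" and "H \<equiv> PTuple s0 (length as'') ss"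
  shows "ptuple_comp P H (ptuple_comp P G F) = ptuple_comp P (ptuple_comp P H G) F"
proof -
  obtain B Rs A where rs: "rs = B @ concat Rs @ A" and B: "family as B" and Rs: "families qs Rs" and A: "family bs A"
    by (rule planar_tuple_splitE[OF f g])
  obtain B2 Sss A2 where ss: "ss = B2 @ concat Sss @ A2" and B2: "family as' B2" and Sss: "families rs Sss"
    and A2: "family bs' A2"
    by (rule planar_tuple_splitE[OF g h])
  obtain SB S' where S1: "Sss = SB @ S'" "families B SB" "families (concat Rs @ A) S'"
    using Sss unfolding rs by (auto simp: list_all2_append1)
  then obtain S'' SA where S2: "S' = S'' @ SA" "families (concat Rs) S''" "families A SA"
    by (auto simp: list_all2_append1)
  obtain Qss where Qss: "S'' = concat Qss" "list_all2 families Rs Qss"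
    using list_all2_concat_left[OF S2(2)] by blast
  let ?c = "snd a" and ?d = "snd b"
  let ?o = "ocomp P"
  let ?k = "length as''"
  note f' = f[unfolded planar_tuple_def] and g' = g[unfolded planar_tuple_def] and h' = h[unfolded planar_tuple_def]
  have q0: "q0 \<in> opn P" "inp P q0 = as @ ?c # bs" and r0: "r0 \<in> opn P" "inp P r0 = as' @ ?d # bs'"
    and s0: "s0 \<in> opn P" "inp P s0 = as'' @ snd e # bs''" using f' g' h' by blast+
  have c: "?c \<in> col P" and d: "?d \<in> col P" using inp_split_col(2)[OF q0] inp_split_col(2)[OF r0] .
  define W where "W = ?o r0 (B2 @ idop P ?d # A2)"
  define L where "L = pcomp P r0 (length as') (?o q0 (B @ idop P ?c # A))"
  define Z where "Z = ?o q0 (map2 ?o B SB @ idop P ?c # map2 ?o A SA)"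
  have SB: "family as (map2 ?o B SB)" and SA: "family bs (map2 ?o A SA)"
    using family_map2_ocomp[OF B S1(2)] family_map2_ocomp[OF A S2(3)] .
  note Rs' = families_map2[OF Rs Qss(2)] and Qs = families_ocomp[OF Rs Qss(2)]
  have ups: "map2 ?o rs Sss = map2 ?o B SB @ concat (map2 (map2 ?o) Rs Qss) @ map2 ?o A SA"
    using list_all2_lengthD[OF S1(2)] list_all2_lengthD[OF S2(2)]
    by (simp add: rs S1(1) S2(1) Qss(1) map2_concat[OF Qss(2)])
  note gf = planar_tuple_comp[OF f g[unfolded rs] B Rs A, folded rs L_def]
  note hg = planar_tuple_comp[OF g h[unfolded ss] B2 Sss A2, folded ss W_def]
  have ss': "ss = (B2 @ concat SB) @ concat (map concat Qss) @ (concat SA @ A2)"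
    by (simp add: ss S1(1) S2(1) Qss(1) concat_concat_map)
  have B_SB: "family (as' @ concat (map (inp P) B)) (B2 @ concat SB)"
    and A_SA: "family (concat (map (inp P) A) @ bs') (concat SA @ A2)"
    using family_append[OF B2 families_family[OF S1(2)]] family_append[OF families_family[OF S2(3)] A2] .
  have "ptuple_comp P H (ptuple_comp P G F) =
    PTuple (pcomp P s0 ?k (?o L ((B2 @ concat SB) @ idop P ?c # (concat SA @ A2))))
      (length (as'' @ concat (map (inp P) (B2 @ concat SB)))) (map2 ?o (map2 ?o qs Rs) (map concat Qss))"
    unfolding F_def G_def H_def gf(1) ss'
    by (rule planar_tuple_comp(1)[OF gf(2) h[unfolded ss'] B_SB Qs A_SA])
  also have "?o L ((B2 @ concat SB) @ idop P ?c # (concat SA @ A2)) = ?o r0 (B2 @ Z # A2)"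
  proof -
    let ?x = "?o q0 (B @ idop P ?c # A)"
    have idc: "composable P (idop P ?c) [idop P ?c]" and idc': "?o (idop P ?c) [idop P ?c] = idop P ?c"
      using c ocomp_idop_left[of "idop P ?c"] by (auto simp: composable_def idop_opn inp_idop outp_idop)
    note mid = ocomp_middle_props[OF q0 B A idop_opn[OF c] outp_idop[OF c]]
    have comp: "composable P ?x (concat SB @ [idop P ?c] @ concat SA)"
      unfolding composable_iff_family mid(2)
      using mid(1) families_family[OF S1(2)] families_family[OF S2(3)] c
      by (auto intro!: family_append simp: inp_idop family_def idop_opn outp_idop)
    have "outp P ?x = ?d" using mid(3) f' by simp
    from ocomp_pcomp[OF r0 comp this B2 A2]
    have "?o L (B2 @ (concat SB @ [idop P ?c] @ concat SA) @ A2) = ?o r0 (B2 @ ?o ?x (concat SB @ [idop P ?c] @ concat SA) # A2)"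
      by (simp add: L_def)
    also have "?o ?x (concat SB @ [idop P ?c] @ concat SA) = Z"
      using ocomp_middle[OF q0 B A idc outp_idop[OF c] S1(2) S2(3)] by (simp add: Z_def idc')
    finally show ?thesis by simp
  qed
  also have "map2 ?o (map2 ?o qs Rs) (map concat Qss) = map2 ?o qs (map2 (map2 ?o) Rs Qss)"
    by (rule map2_ocomp_assoc[OF Rs Qss(2)])
  also have "pcomp P s0 ?k (?o r0 (B2 @ Z # A2)) =
    pcomp P (pcomp P s0 ?k W) (length (as'' @ concat (map (inp P) B2))) Z"
  proof -
    note Z = ocomp_middle_props[OF q0 SB SA idop_opn[OF c] outp_idop[OF c], folded Z_def]
    have outZ: "outp P Z = ?d" using Z(3) f' by simp
    note W = ocomp_middle_props[OF r0 B2 A2 idop_opn[OF d] outp_idop[OF d], folded W_def]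
    have W': "inp P W = concat (map (inp P) B2) @ ?d # concat (map (inp P) A2)" "outp P W = snd e"
      using W(2,3) g' d by (simp_all add: inp_idop)
    have "?o r0 (B2 @ Z # A2) = pcomp P W (length (concat (map (inp P) B2))) Z"
      unfolding W_def by (rule pcomp_ocomp_idop[OF r0 B2 A2 d refl Z(1) outZ, symmetric])
    then show ?thesis
      using pcomp_pcomp[OF s0 W(1) W'(2,1) Z(1) outZ] by simp
  qed
  also have "length (as'' @ concat (map (inp P) (B2 @ concat SB))) =
    length ((as'' @ concat (map (inp P) B2)) @ concat (map (inp P) (map2 ?o B SB)))"
    by (simp add: inp_map2_ocomp[OF S1(2)] del: map_map)
  also have "PTuple (pcomp P (pcomp P s0 ?k W) (length (as'' @ concat (map (inp P) B2))) Z)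
      (length ((as'' @ concat (map (inp P) B2)) @ concat (map (inp P) (map2 ?o B SB))))
      (map2 ?o qs (map2 (map2 ?o) Rs Qss)) = ptuple_comp P (ptuple_comp P H G) F"
    unfolding F_def G_def H_def hg(1) ups Z_def
    by (rule planar_tuple_comp(1)[OF f hg(2)[unfolded ups] SB Rs' SA, symmetric])
  finally show ?thesis .
qed

definition upper_planar :: "'o ptuple \<Rightarrow> bool" where
  "upper_planar f \<longleftrightarrow> plow f \<in> idop P ` col P"

definition lower_planar :: "'o ptuple \<Rightarrow> bool" where
  "lower_planar f \<longleftrightarrow> set (pups f) \<subseteq> idop P ` col P"

lemma ptuple_tgt_props:
  assumes p: "p \<in> opn P" and f: "planar_tuple (profile P p) b q0 as bs qs"
  shows "composable P p qs" "ptuple_tgt P p (PTuple q0 (length as) qs) \<in> opn P"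
    "profile P (ptuple_tgt P p (PTuple q0 (length as) qs)) = b"
proof -
  note f' = f[unfolded planar_tuple_def profile_def fst_conv snd_conv]
  show c: "composable P p qs" using f' p by (simp add: composable_iff_family)
  have q0: "q0 \<in> opn P" "inp P q0 = as @ outp P p # bs" using f' by blast+
  note t = pcomp_props[OF q0 ocomp_opn[OF c] outp_ocomp[OF c]]
  show "ptuple_tgt P p (PTuple q0 (length as) qs) \<in> opn P"
    "profile P (ptuple_tgt P p (PTuple q0 (length as) qs)) = b"
    using t f' by (simp_all add: profile_def inp_ocomp[OF c])
qed

lemma ptuple_tgt_comp:
  assumes p: "p \<in> opn P" and f: "planar_tuple (profile P p) b q0 as bs qs" and g: "planar_tuple b e r0 as' bs' rs"
  shows "ptuple_tgt P p (ptuple_comp P (PTuple r0 (length as') rs) (PTuple q0 (length as) qs)) =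
    ptuple_tgt P (ptuple_tgt P p (PTuple q0 (length as) qs)) (PTuple r0 (length as') rs)"
proof -
  obtain B Rs A where rs: "rs = B @ concat Rs @ A" and B: "family as B" and Rs: "families qs Rs" and A: "family bs A"
    by (rule planar_tuple_splitE[OF f g])
  let ?c = "outp P p" and ?o = "ocomp P"
  note f' = f[unfolded planar_tuple_def profile_def fst_conv snd_conv] and g' = g[unfolded planar_tuple_def]
  have q0: "q0 \<in> opn P" "inp P q0 = as @ ?c # bs" and r0: "r0 \<in> opn P"
    "inp P r0 = as' @ snd b # bs'"
    using f' g' by blast+
  have c: "?c \<in> col P" using inp_split_col(2)[OF q0] .
  have pq: "composable P p qs" by (rule ptuple_tgt_props(1)[OF p f])
  define y where "y = ?o p (map2 ?o qs Rs)"
  have py: "composable P p (map2 ?o qs Rs)"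
    using pq family_map2_ocomp[OF _ Rs] by (simp add: composable_iff_family)
  have y: "y \<in> opn P" "outp P y = ?c" using ocomp_opn[OF py]
    outp_ocomp[OF py] by (simp_all add: y_def)
  have y_eq: "y = ?o (?o p qs) (concat Rs)" unfolding y_def by (rule ocomp_assoc[OF pq Rs, symmetric])
  have comp: "composable P (?o p qs) (concat Rs)"
    using families_family[OF Rs] by (simp add: composable_iff_family ocomp_opn[OF pq] inp_ocomp[OF pq])
  define W where "W = ?o q0 (B @ idop P ?c # A)"
  note W = ocomp_middle_props[OF q0 B A idop_opn[OF c] outp_idop[OF c], folded W_def]
  have W': "inp P W = concat (map (inp P) B) @ ?c # concat (map (inp P) A)" "outp P W = snd b"
    using W(2,3) f' c by (simp_all add: inp_idop)
  have "ptuple_tgt P p (ptuple_comp P (PTuple r0 (length as') rs) (PTuple q0 (length as) qs)) =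
      pcomp P (pcomp P r0 (length as') W) (length as' + length (concat (map (inp P) B))) y"
    using planar_tuple_comp(1)[OF f g[unfolded rs] B Rs A] by (simp add: rs W_def y_def profile_def)
  also have "\<dots> = pcomp P r0 (length as') (pcomp P W (length (concat (map (inp P) B))) y)"
    by (rule pcomp_pcomp[OF r0 W(1) W'(2,1) y])
  also have "pcomp P W (length (concat (map (inp P) B))) y = ?o q0 (B @ y # A)"
    unfolding W_def by (rule pcomp_ocomp_idop[OF q0 B A c refl y])
  also have "\<dots> = ?o (pcomp P q0 (length as) (?o p qs)) rs"
    unfolding rs y_eq by (rule ocomp_pcomp[OF q0 comp outp_ocomp[OF pq] B A, symmetric])
  finally show ?thesis by simp
qed

lemma planar_tuple_id:
  assumes "a \<in> profiles P"
  shows "planar_tuple a a (idop P (snd a)) [] [] (map (idop P) (fst a))"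
    "ptuple_id P a = PTuple (idop P (snd a)) 0 (map (idop P) (fst a))"
  using assms by (auto simp: planar_tuple_def profiles_def idop_opn inp_idop outp_idop concat_inp_idop family_idop simp del: map_map)

text \<open>A planar tuple is recovered from its two factors. Since every composable pair of an upper
and a lower tuple is of the form displayed here, this gives uniqueness of the factorization as
well as existence.\<close>

lemma ptuple_comp_factors:
  assumes "r0 \<in> opn P" "j < arity P r0" "inp P r0 ! j = c" "set qs \<subseteq> opn P"
  shows "ptuple_comp P (PTuple r0 j (map (idop P) (concat (map (inp P) qs)))) (PTuple (idop P c) 0 qs) = PTuple r0 j qs"
proof -
  have c: "c \<in> col P" using inp_col[OF assms(1)] assms(2,3) by auto
  have r0: "inp P r0 = take j (inp P r0) @ c # drop (Suc j) (inp P r0)"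
    using id_take_nth_drop[OF assms(2)] assms(3) by simp
  have "ocomp P (idop P c) [idop P c] = idop P c"
    using ocomp_idop_left[of "idop P c"] c by (simp add: idop_opn outp_idop)
  moreover have "pcomp P r0 j (idop P c) = r0"
    using pcomp_idop_right[OF assms(1) r0] assms(2) by simp
  ultimately show ?thesis
    using ptuple_comp_split[OF families_lengths[OF families_idop[OF assms(4)]], of r0 j "[]" "[]"
      "idop P c"] c
    by (simp add: map2_ocomp_idop[OF assms(4)] inp_idop map_concat)
qed

lemma factorized_tuples_planar:
  "factorized_tuples (profiles P) (ptuple_from P) (ptuple_tgt_profile P) (ptuple_id P) (ptuple_comp P)
    upper_planar lower_planar"
proof -
  note id = planar_tuple_id
  have id_from: "ptuple_from P a (ptuple_id P a)"
    "ptuple_tgt_profile P (ptuple_id P a) = a" if "a \<in> profiles P" for a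
    using planar_tuple_from[OF id(1)[OF that]] id(2)[OF that] by simp_all
  have target: "ptuple_tgt_profile P f \<in> profiles P" if "a \<in> profiles P" "ptuple_from P a f" for a f
  proof (rule planar_tupleE[OF that(2)])
    fix q0 as bs qs assume f: "planar_tuple a (ptuple_tgt_profile P f) q0 as bs qs"
    then have "q0 \<in> opn P" "inp P q0 = as @ snd a # bs" "set qs \<subseteq> opn P"
      by (simp_all add: planar_tuple_def family_def)
    moreover have "set (inp P q) \<subseteq> col P" if "q \<in> set qs" for q
      using that calculation(3) inp_col by blast
    ultimately show ?thesis
      using f inp_split_col outp_col by (auto simp: planar_tuple_def profiles_def)
  qed
  have comp: "ptuple_from P a (ptuple_comp P g f)"
    "ptuple_tgt_profile P (ptuple_comp P g f) = ptuple_tgt_profile P g"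
    if F: "ptuple_from P a f" and G: "ptuple_from P (ptuple_tgt_profile P f) g" for a f g
  proof -
    obtain q0 as bs qs where f: "f = PTuple q0 (length as) qs"
      "planar_tuple a (ptuple_tgt_profile P f) q0 as bs qs"
      by (rule planar_tupleE[OF F])
    obtain r0 as' bs' rs where g: "g = PTuple r0 (length as') rs"
      "planar_tuple (ptuple_tgt_profile P f) (ptuple_tgt_profile P g) r0 as' bs' rs"
      by (rule planar_tupleE[OF G])
    obtain B Rs A where *: "rs = B @ concat Rs @ A" "family as B" "families qs Rs" "family bs A"
      by (rule planar_tuple_splitE[OF f(2) g(2)])
    note c = planar_tuple_comp[OF f(2) g(2)[unfolded *(1)] *(2-4)]
    show "ptuple_from P a (ptuple_comp P g f)"
      "ptuple_tgt_profile P (ptuple_comp P g f) = ptuple_tgt_profile P g"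
      using planar_tuple_from[OF c(2)] c(1) f(1) g(1) *(1) by simp_all
  qed
  show ?thesis
  proof (unfold_locales, goal_cases)
    case (1 a f) then show ?case by (rule target)
  next
    case (2 a) then show ?case by (rule id_from)
  next
    case (3 a) then show ?case by (rule id_from)
  next
    case (4 a f g) then show ?case by (intro comp)
  next
    case (5 a f g) then show ?case by (intro comp)
  next
    case (6 a f)
    obtain q0 as bs qs where f: "f = PTuple q0 (length as) qs"
      "planar_tuple a (ptuple_tgt_profile P f) q0 as bs qs"
      by (rule planar_tupleE[OF 6(2)])
    have c: "set (fst a) \<subseteq> col P" "snd a \<in> col P" using 6(1) by (auto simp: profiles_def)
    note f' = f(2)[unfolded planar_tuple_def]
    have qs: "family (fst a) qs" using f' by blast
    have "ocomp P (idop P (snd a)) [idop P (snd a)] = idop P (snd a)"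
      using ocomp_idop_left[of "idop P (snd a)"] c by (simp add: idop_opn outp_idop)
    moreover have "pcomp P q0 (length as) (idop P (snd a)) = q0"
      using f' by (intro pcomp_idop_right) blast+
    ultimately show ?case
      using ptuple_comp_split[OF families_lengths[OF families_singletons[OF qs c(1)]], of q0 "length as" "[]" "[]"]
      by (simp add: f(1) id(2)[OF 6(1)] concat_singletons map2_idop_ocomp[OF qs] inp_idop c del: ptuple_comp.simps)
  next
    case (7 a f)
    obtain q0 as bs qs where f: "f = PTuple q0 (length as) qs"
      "planar_tuple a (ptuple_tgt_profile P f) q0 as bs qs"
      by (rule planar_tupleE[OF 7(2)])
    note f' = f(2)[unfolded planar_tuple_def]
    have q0: "q0 \<in> opn P" "inp P q0 = as @ snd a # bs" and qs: "set qs \<subseteq> opn P"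
      and b: "ptuple_tgt_profile P f = (as @ concat (map (inp P) qs) @ bs, outp P q0)"
      using f' by (auto simp: family_def)
    have "map (idop P) (fst (ptuple_tgt_profile P f)) =
        map (idop P) as @ concat (map (map (idop P) \<circ> inp P) qs) @ map (idop P) bs"
      by (simp add: b map_concat)
    moreover have "concat (map (inp P) (map (idop P) as)) = as"
      using concat_inp_idop[OF inp_split_col(1)[OF q0]] .
    moreover have "ocomp P q0 (map (idop P) as @ idop P (snd a) # map (idop P) bs) = q0"
      using ocomp_idop_right[OF q0(1)] by (simp add: q0(2))
    moreover have "pcomp P (idop P (outp P q0)) 0 q0 = q0" by (rule pcomp_idop_left[OF q0(1) refl])
    ultimately show ?case
      using ptuple_comp_split[OF families_lengths[OF families_idop[OF qs]],
          of "idop P (outp P q0)" 0 "map (idop P) as" "map (idop P) bs" q0]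
      by (simp add: id(2)[OF target[OF 7]] f(1) b q0(2) map2_ocomp_idop[OF qs] del: map_map ptuple_comp.simps)
  next
    case (8 a f g h)
    show ?case
      by (rule planar_tupleE[OF 8(2)], rule planar_tupleE[OF 8(3)], rule planar_tupleE[OF 8(4)])
        (metis ptuple_comp_assoc)
  next
    case (9 a) then show ?case by (auto simp: upper_planar_def profiles_def)
  next
    case (10 a) then show ?case by (auto simp: lower_planar_def profiles_def intro!: imageI dest: subsetD)
  next
    case (11 a f g)
    obtain q0 as bs qs where f: "f = PTuple q0 (length as) qs"
      "planar_tuple a (ptuple_tgt_profile P f) q0 as bs qs"
      by (rule planar_tupleE[OF 11(2)])
    obtain r0 as' bs' rs where g: "g = PTuple r0 (length as') rs"
      "planar_tuple (ptuple_tgt_profile P f) (ptuple_tgt_profile P g) r0 as' bs' rs"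
      by (rule planar_tupleE[OF 11(3)])
    obtain B Rs A where *: "rs = B @ concat Rs @ A" "family as B" "families qs Rs" "family bs A"
      by (rule planar_tuple_splitE[OF f(2) g(2)])
    note f' = f(2)[unfolded planar_tuple_def] and g' = g(2)[unfolded planar_tuple_def]
    have c: "snd a \<in> col P" using 11(1) by (auto simp: profiles_def)
    have q0: "q0 = idop P (snd a)" "as = []" "bs = []"
      using 11(4) f' unfolding upper_planar_def f(1) by (auto simp: inp_idop Cons_eq_append_conv)
    have b: "snd (ptuple_tgt_profile P f) = snd a"
      using f' q0 c by (metis outp_idop snd_conv)
    have r0: "r0 = idop P (snd a)" "as' = []"
      using 11(5) g' b unfolding upper_planar_def g(1) by (auto simp: inp_idop Cons_eq_append_conv)
    have AB: "A = []" "B = []" using * q0 by (simp_all add: family_Nil)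
    have "ocomp P (idop P (snd a)) [idop P (snd a)] = idop P (snd a)"
      using ocomp_idop_left[of "idop P (snd a)"] c by (simp add: idop_opn outp_idop)
    then have "plow (ptuple_comp P g f) = idop P (snd a)"
      using planar_tuple_comp(1)[OF f(2) g(2)[unfolded *(1)] *(2-4)] c
      by (simp add: f(1) g(1) *(1) AB q0 r0 pcomp_idop_left idop_opn outp_idop)
    then show ?case using c by (simp add: upper_planar_def)
  next
    case (12 a f g)
    obtain q0 as bs qs where f: "f = PTuple q0 (length as) qs"
      "planar_tuple a (ptuple_tgt_profile P f) q0 as bs qs"
      by (rule planar_tupleE[OF 12(2)])
    obtain r0 as' bs' rs where g: "g = PTuple r0 (length as') rs"
      "planar_tuple (ptuple_tgt_profile P f) (ptuple_tgt_profile P g) r0 as' bs' rs"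
      by (rule planar_tupleE[OF 12(3)])
    obtain B Rs A where *: "rs = B @ concat Rs @ A" "family as B" "families qs Rs" "family bs A"
      by (rule planar_tuple_splitE[OF f(2) g(2)])
    have ids: "set qs \<subseteq> idop P ` col P" "\<forall>R\<in>set Rs. set R \<subseteq> idop P ` col P"
      using 12(4,5) by (auto simp: lower_planar_def f(1) g(1) *(1))
    have ocomp_ids: "ocomp P q R \<in> idop P ` col P" if q: "q \<in> idop P ` col P" and R: "set R \<subseteq> idop P ` col P"
      and qR: "composable P q R" for q R
    proof -
      obtain c where c: "c \<in> col P" "q = idop P c" using q by blast
      then have "map (outp P) R = [c]" using qR by (simp add: composable_def inp_idop)
      then obtain x where x: "R = [x]" "outp P x = c" by auto
      then have "ocomp P q R = x" using qR c ocomp_idop_left[of x] by (auto simp: composable_def)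
      then show ?thesis using R x by simp
    qed
    have "ocomp P q R \<in> idop P ` col P" if qR: "(q, R) \<in> set (zip qs Rs)" for q R
    proof (rule ocomp_ids)
      show "q \<in> idop P ` col P" "set R \<subseteq> idop P ` col P"
        using set_zip_leftD[OF qR] set_zip_rightD[OF qR] ids by blast+
      show "composable P q R" using *(3) qR by (auto simp: list_all2_iff)
    qed
    then have "set (map2 (ocomp P) qs Rs) \<subseteq> idop P ` col P" by auto
    then show ?case
      using planar_tuple_comp(1)[OF f(2) g(2)[unfolded *(1)] *(2-4)] by (simp add: lower_planar_def f(1) g(1) *(1))
  next
    case (13 a f)
    obtain q0 i qs where f: "f = PTuple q0 i qs" by (cases f)
    obtain cs c where a: "a = (cs, c)" by fastforce
    have f': "q0 \<in> opn P" "i < arity P q0" "inp P q0 ! i = c" "set qs \<subseteq> opn P"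
      "map (outp P) qs = cs" "c \<in> col P"
      using 13 by (simp_all add: f a profiles_def)
    let ?X = "concat (map (inp P) qs)"
    have X: "set ?X \<subseteq> col P" using f'(4) inp_col by fastforce
    have "ptuple_from P a (PTuple (idop P c) 0 qs)"
      using f' by (simp add: a idop_opn inp_idop)
    moreover have "ptuple_tgt_profile P (PTuple (idop P c) 0 qs) = (?X, c)"
      using f' by (simp add: inp_idop outp_idop)
    moreover have "ptuple_from P (?X, c) (PTuple q0 i (map (idop P) ?X))"
      using f' family_idop[OF X] by (simp add: family_def)
    ultimately show ?case
      using ptuple_comp_factors[OF f'(1-4)] f'(6) X
      by (intro exI[of _ "PTuple (idop P c) 0 qs"] exI[of _ "PTuple q0 i (map (idop P) ?X)"])
        (simp add: f upper_planar_def lower_planar_def image_mono del: set_concat)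
  next
    case (14 a l r l' r')
    obtain cs c where a: "a = (cs, c)" by fastforce
    have factors: "\<exists>r0 j qs. l = PTuple (idop P c) 0 qs \<and> r = PTuple r0 j (map (idop P) (concat (map (inp P) qs)))
        \<and> ptuple_comp P r l = PTuple r0 j qs"
      if l: "ptuple_from P a l" and r: "ptuple_from P (ptuple_tgt_profile P l) r" and "upper_planar l" "lower_planar r" for l r
    proof -
      obtain q0 i qs where l': "l = PTuple q0 i qs" by (cases l)
      obtain d where d: "d \<in> col P" "q0 = idop P d"
        using \<open>upper_planar l\<close> by (auto simp: upper_planar_def l')
      have q0: "q0 = idop P c" "i = 0" and c: "c \<in> col P" and qs: "set qs \<subseteq> opn P"
        using l d by (auto simp: l' a inp_idop)
      obtain r0 j rs where r': "r = PTuple r0 j rs" by (cases r)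
      have r0: "r0 \<in> opn P" "j < arity P r0" "inp P r0 ! j = c"
        "map (outp P) rs = concat (map (inp P) qs)"
        using r by (simp_all add: r' l' q0 inp_idop outp_idop c)
      have "map (idop P) (map (outp P) rs) = rs"
        using \<open>lower_planar r\<close> by (auto simp: lower_planar_def r' outp_idop intro!: map_idI)
      then have "rs = map (idop P) (concat (map (inp P) qs))" by (simp only: r0(4))
      then show ?thesis
        using ptuple_comp_factors[OF r0(1-3) qs] by (simp add: l' r' q0)
    qed
    show ?case
      using factors[OF 14(2-5)] factors[OF 14(6-9)] 14(10) by auto
  qed
qed

theorem strict_factorization_system_planar:
  "strict_factorization_system (pTw P) (pUpper P (pTw P)) (pLower P (pTw P))"
  "strict_factorization_system (pU P) (pUpper P (pU P)) (pLower P (pU P))"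
proof -
  interpret S: factorized_tuples "profiles P" "ptuple_from P" "ptuple_tgt_profile P" "ptuple_id P"
    "ptuple_comp P" upper_planar lower_planar
    by (rule factorized_tuples_planar)
  have Tw: "pTw P = elements (opn P) (profile P) (ptuple_from P) (ptuple_tgt P) (ptuple_id P) (ptuple_comp P)"
    by (simp add: pTw_def elements_def)
  have U: "pU P = elements (profiles P) (\<lambda>a. a) (ptuple_from P) (\<lambda>a. ptuple_tgt_profile P) (ptuple_id P) (ptuple_comp P)"
    by (simp add: pU_def elements_def)
  have classes: "pUpper P C = {(x, f) \<in> Ar C. upper_planar f}"
    "pLower P C = {(x, f) \<in> Ar C. lower_planar f}"
    for C :: "('x, _) cat_data"
    by (simp_all add: pUpper_def pLower_def upper_planar_def lower_planar_def)
  show "strict_factorization_system (pTw P) (pUpper P (pTw P)) (pLower P (pTw P))"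
    unfolding classes Tw
  proof (rule S.strict_factorization_system_elements)
    fix p assume p: "p \<in> opn P"
    then show prof: "profile P p \<in> profiles P"
      using inp_col outp_col by (auto simp: profile_def profiles_def)
    show "ptuple_tgt P p (ptuple_id P (profile P p)) = p"
      using p pcomp_idop_left[OF p refl] by (simp add: profile_def ocomp_idop_right)
    fix f assume f: "ptuple_from P (profile P p) f"
    show "ptuple_tgt P p f \<in> opn P" "profile P (ptuple_tgt P p f) = ptuple_tgt_profile P f"
      by (rule planar_tupleE[OF f], use ptuple_tgt_props[OF p] in metis)+
    fix g assume g: "ptuple_from P (ptuple_tgt_profile P f) g"
    show "ptuple_tgt P p (ptuple_comp P g f) = ptuple_tgt P (ptuple_tgt P p f) g"
      by (rule planar_tupleE[OF f], rule planar_tupleE[OF g], use ptuple_tgt_comp[OF p] in metis)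
  qed
  show "strict_factorization_system (pU P) (pUpper P (pU P)) (pLower P (pU P))"
    unfolding classes U
    by (rule S.strict_factorization_system_elements)
      (auto intro: S.target_in S.ident_target S.composite_target)
qed

end

section \<open>Permutations in one-line notation\<close>

lemma mset_upt_iff: "mset L = mset [0..<n] \<longleftrightarrow> distinct L \<and> set L = {..<n}"
proof
  assume eq: "mset L = mset [0..<n]"
  have "distinct L" unfolding mset_eq_imp_distinct_iff[OF eq] by (rule distinct_upt)
  moreover have "set L = {..<n}" unfolding mset_eq_setD[OF eq] set_upt by (rule atLeast0LessThan)
  ultimately show "distinct L \<and> set L = {..<n}" ..
next
  assume "distinct L \<and> set L = {..<n}"
  then show "mset L = mset [0..<n]"
    by (intro set_eq_iff_mset_eq_distinct[THEN iffD1]) (simp_all add: atLeast0LessThan)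
qed

lemma lperm_permutes:
  assumes "mset L = mset [0..<length L]"
  shows "lperm L permutes {..<length L}"
proof -
  have d: "distinct L" and "set L = {..<length L}"
    using assms unfolding mset_upt_iff by blast+
  then have "bij_betw ((!) L) {..<length L} {..<length L}"
    by (metis bij_betw_nth d)
  then have "bij_betw (lperm L) {..<length L} {..<length L}"
    by (rule bij_betw_cong[THEN iffD1, rotated]) (simp add: lperm_def)
  then show ?thesis by (rule bij_imp_permutes) (simp add: lperm_def)
qed

lemma permute_list_lperm:
  assumes "length xs = length L"
  shows "permute_list (lperm L) xs = map ((!) xs) L"
  using assms by (intro nth_equalityI) (simp_all add: permute_list_def lperm_def)

lemma mset_concat_permute_blocks:
  assumes "s permutes {..<length ms}"
  shows "mset (concat (permute_list s (blocks ms))) = mset [0..<sum_list ms]"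
proof -
  have "length (blocks ms) = length ms" by (simp add: blocks_def)
  then have "mset (permute_list s (blocks ms)) = mset (blocks ms)" using assms by simp
  then show ?thesis by (metis concat_blocks mset_concat sum_mset_sum_list mset_map)
qed

lemma mset_concat_map2_permute_list:
  assumes "list_all2 (\<lambda>t xs. t permutes {..<length xs}) ts xss"
  shows "mset (concat (map2 permute_list ts xss)) = mset (concat xss)"
  using assms by (induction rule: list_all2_induct) simp_all

text \<open>The ranks of the entries of a list form the permutation that turns the sorted list into the
list itself.\<close>

lemma lperm_ranks:
  assumes "distinct L"
  shows "lperm (ranks L) permutes {..<length L}" "permute_list (lperm (ranks L)) (sort L) = L"
proof -
  have len: "length (ranks L) = length L" by (simp add: ranks_def)
  have rank: "card {y \<in> set L. y < sort L ! i} = i" if "i < length L" for i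
  proof -
    have *: "distinct (sort L)" "sorted (sort L)" using assms by simp_all
    have "{y \<in> set L. y < sort L ! i} = (!) (sort L) ` {..<i}"
    proof -
      have "y \<in> (!) (sort L) ` {..<i}" if y: "y \<in> set L" "y < sort L ! i" for y
      proof -
        obtain k where k: "k < length L" "y = sort L ! k"
          using y(1) by (metis in_set_conv_nth length_sort set_sort)
        then have "k < i" using y(2) *(2) \<open>i < length L\<close>
          by (metis leD length_sort not_le_imp_less sorted_nth_mono)
        with k show ?thesis by auto
      qed
      moreover have "sort L ! k \<in> set L \<and> sort L ! k < sort L ! i" if "k < i" for k
        using that * \<open>i < length L\<close>
        by (metis dual_order.strict_trans length_sort nth_mem set_sort sorted_wrt_nth_less strict_sorted_iff)
      ultimately show ?thesis by auto
    qed
    moreover have "inj_on ((!) (sort L)) {..<i}"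
      using *(1) \<open>i < length L\<close> by (auto simp: inj_on_def nth_eq_iff_index_eq)
    ultimately show ?thesis by (simp add: card_image)
  qed
  define r where "r x = card {y \<in> set L. y < x}" for x
  have ranks: "ranks L = map r L" by (simp add: ranks_def r_def)
  have "mset (ranks L) = mset (map r (sort L))" by (simp add: ranks)
  also have "map r (sort L) = [0..<length L]"
    by (rule nth_equalityI) (simp_all add: r_def rank)
  finally show "lperm (ranks L) permutes {..<length L}"
    by (rule lperm_permutes[of "ranks L", unfolded len])
  have "sort L ! r x = x" if x: "x \<in> set L" for x
  proof -
    have "x \<in> set (sort L)" using x by simp
    then obtain i where i: "i < length (sort L)" "sort L ! i = x"
      unfolding in_set_conv_nth by blast
    then have "r x = i" using rank[of i] by (simp add: r_def)
    then show ?thesis using i by simp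
  qed
  then have "map ((!) (sort L)) (ranks L) = L"
    unfolding ranks by (simp add: map_idI)
  then show "permute_list (lperm (ranks L)) (sort L) = L"
    using len by (simp add: permute_list_lperm)
qed

text \<open>The lower vertex of a composite fixes its first input and permutes the others. With the
first input labelled 0 and the other labels raised by one this is an ordinary sorting of labels.\<close>

lemma ranks_Cons_Suc: "ranks (0 # map Suc L) = 0 # map Suc (ranks L)"
proof -
  have "card {y. (y = 0 \<or> y \<in> Suc ` set L) \<and> y < Suc x} = Suc (card {y \<in> set L. y < x})" for x
  proof -
    have "{y. (y = 0 \<or> y \<in> Suc ` set L) \<and> y < Suc x} = insert 0 (Suc ` {y \<in> set L. y < x})"
      by auto
    then show ?thesis by (simp add: card_image)
  qed
  then show ?thesis by (simp add: ranks_def)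
qed

text \<open>The target profile of a tuple is defined by an inverse permutation. Equivalently, it is the
list whose entry at the number of a leaf is the colour of that leaf.\<close>

lemma permute_list_inv_lperm_iff:
  assumes "mset L = mset [0..<length L]" "length C = length L"
  shows "permute_list (inv (lperm L)) C = ds \<longleftrightarrow> length ds = length L \<and> map ((!) ds) L = C"
proof -
  have L: "lperm L permutes {..<length L}" by (rule lperm_permutes[OF assms(1)])
  have "permute_list (lperm L) (permute_list (inv (lperm L)) C) = C"
    using assms(2) L permutes_inv_o(2)[OF L] by (simp flip: permute_list_compose)
  moreover have "permute_list (inv (lperm L)) (permute_list (lperm L) ds) = ds" if "length ds = length L"
    using that L permutes_inv_o(1)[OF L] permutes_inv[OF L] by (simp flip: permute_list_compose)
  ultimately show ?thesis
    using assms(2) permute_list_lperm[of _ L] by (metis length_permute_list)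
qed

lemma map_eq_concat_iff:
  assumes "map length xss = map length yss"
  shows "map f (concat xss) = map g (concat yss) \<longleftrightarrow> map (map f) xss = map (map g) yss"
proof -
  have "length xss = length yss" using assms by (metis length_map)
  then show ?thesis using assms by (induction xss yss rule: list_induct2) auto
qed

text \<open>Replacing the numbers of the leaves of one tuple by the leaves of the vertices grafted there
yields every leaf of these vertices exactly once.\<close>

lemma mset_concat_nth:
  assumes "mset L = mset [0..<length xss]"
  shows "mset (concat (map ((!) xss) L)) = mset (concat xss)"
proof -
  have "mset (map ((!) xss) L) = mset (map ((!) xss) [0..<length xss])"
    using assms by (simp only: mset_map)
  then have "mset (map ((!) xss) L) = mset xss" by (simp only: map_nth)
  then have "mset (map mset (map ((!) xss) L)) = mset (map mset xss)" by (metis mset_map)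
  then show ?thesis by (simp only: mset_concat flip: sum_mset_sum_list)
qed

lemma insort_0_sort_map_Suc: "insort 0 (sort (map Suc L)) = 0 # map Suc (sort L)"
proof -
  have "sort (map Suc L) = map Suc (sort L)"
    by (rule properties_for_sort) (simp_all add: sorted_map)
  then show ?thesis by (simp add: insort_is_Cons)
qed

text \<open>Positions in an increasing list; they number the leaves between the two factors of a
symmetric tuple.\<close>

lemma strict_sorted_pos:
  fixes X :: "nat list"
  assumes "sorted_wrt (<) X"
  defines "pos \<equiv> inv_into {..<length X} ((!) X)"
  shows "x \<in> set X \<Longrightarrow> pos x < length X" "x \<in> set X \<Longrightarrow> X ! pos x = x"
    "i < length X \<Longrightarrow> pos (X ! i) = i"
    "\<lbrakk>x \<in> set X; y \<in> set X; x < y\<rbrakk> \<Longrightarrow> pos x < pos y"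
proof -
  have im: "(!) X ` {..<length X} = set X" by (auto simp: in_set_conv_nth)
  have inj: "inj_on ((!) X) {..<length X}"
    using assms(1) by (auto simp: inj_on_def nth_eq_iff_index_eq strict_sorted_iff)
  have 1: "pos x < length X" "X ! pos x = x" if "x \<in> set X" for x
    using inv_into_into[of x "(!) X" "{..<length X}"] f_inv_into_f[of x "(!) X"
      "{..<length X}"] that
    by (simp_all add: im pos_def)
  then show "x \<in> set X \<Longrightarrow> pos x < length X" "x \<in> set X \<Longrightarrow> X ! pos x = x" by blast+
  show "i < length X \<Longrightarrow> pos (X ! i) = i"
    unfolding pos_def by (rule inv_into_f_f[OF inj]) simp
  assume xy: "x \<in> set X" "y \<in> set X" "x < y"
  show "pos x < pos y"
  proof (rule ccontr)
    assume "\<not> pos x < pos y"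
    moreover have "sorted X" using assms(1) by (simp add: strict_sorted_iff)
    ultimately have "X ! pos y \<le> X ! pos x"
      using 1(1)[OF xy(1)] by (intro sorted_nth_mono) simp_all
    then show False using xy 1(2) by simp
  qed
qed

section \<open>Grafting labelled operations\<close>

context planar_operad
begin

text \<open>A pair of an operation and a list of labels, one for each input. The partial function \<open>\<kappa>\<close>
gives the colours of the labels that may occur, much as a typing context does for the free
variables of a term.\<close>

definition labelled :: "('a \<rightharpoonup> 'c) \<Rightarrow> 'o \<times> 'a list \<Rightarrow> bool" where
  "labelled \<kappa> x \<longleftrightarrow> fst x \<in> opn P \<and> map \<kappa> (snd x) = map Some (inp P (fst x))"

text \<open>A substitution of labelled operations for labels that respects colours.\<close>

definition grafting :: "('a \<rightharpoonup> 'c) \<Rightarrow> ('b \<rightharpoonup> 'c) \<Rightarrow> ('a \<Rightarrow> 'o \<times> 'b list) \<Rightarrow> bool" where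
  "grafting \<kappa> \<kappa>' \<rho> \<longleftrightarrow> (\<forall>l c. \<kappa> l = Some c \<longrightarrow> labelled \<kappa>' (\<rho> l) \<and> outp P (fst (\<rho> l)) = c)"

text \<open>Simultaneous substitution: each input is composed with the labelled operation assigned to
its label.\<close>

definition graft :: "'o \<times> 'a list \<Rightarrow> ('a \<Rightarrow> 'o \<times> 'b list) \<Rightarrow> 'o \<times> 'b list" where
  "graft x \<rho> = (ocomp P (fst x) (map (fst \<circ> \<rho>) (snd x)), concat (map (snd \<circ> \<rho>) (snd x)))"

text \<open>The operation that consists of a single label; it is the variable of the substitution
calculus.\<close>

definition unit :: "('a \<rightharpoonup> 'c) \<Rightarrow> 'a \<Rightarrow> 'o \<times> 'a list" where
  "unit \<kappa> l = (idop P (the (\<kappa> l)), [l])"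

lemma labelled_opn: "labelled \<kappa> x \<Longrightarrow> fst x \<in> opn P"
  by (simp add: labelled_def)

lemma labelled_length: "labelled \<kappa> x \<Longrightarrow> length (snd x) = arity P (fst x)"
  unfolding labelled_def by (metis length_map)

lemma labelled_dom: "\<lbrakk>labelled \<kappa> x; l \<in> set (snd x)\<rbrakk> \<Longrightarrow> \<exists>c\<in>col P. \<kappa> l = Some c"
proof -
  assume x: "labelled \<kappa> x" and l: "l \<in> set (snd x)"
  then have "\<kappa> l \<in> set (map Some (inp P (fst x)))"
    unfolding labelled_def by (metis image_eqI list.set_map)
  then show ?thesis using x inp_col[of "fst x"] by (auto simp: labelled_def)
qed

lemma graft_cong:
  assumes "labelled \<kappa> x" "\<And>l c. \<kappa> l = Some c \<Longrightarrow> \<rho> l = \<rho>' l"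
  shows "graft x \<rho> = graft x \<rho>'"
proof -
  have "\<rho> l = \<rho>' l" if "l \<in> set (snd x)" for l
    using labelled_dom[OF assms(1) that] assms(2) by blast
  then have "map (fst \<circ> \<rho>) (snd x) = map (fst \<circ> \<rho>') (snd x)"
    "map (snd \<circ> \<rho>) (snd x) = map (snd \<circ> \<rho>') (snd x)" by simp_all
  then show ?thesis by (simp only: graft_def)
qed

lemma grafting_at:
  assumes "labelled \<kappa> x" "grafting \<kappa> \<kappa>' \<rho>" "l \<in> set (snd x)"
  shows "labelled \<kappa>' (\<rho> l)" "\<kappa> l = Some (outp P (fst (\<rho> l)))"
  using labelled_dom[OF assms(1,3)] assms(2) by (auto simp: grafting_def)

lemma composable_grafting:
  assumes "labelled \<kappa> x" "grafting \<kappa> \<kappa>' \<rho>"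
  shows "composable P (fst x) (map (fst \<circ> \<rho>) (snd x))"
proof -
  have "map \<kappa> (snd x) = map Some (map (outp P) (map (fst \<circ> \<rho>) (snd x)))"
    using grafting_at(2)[OF assms] by simp
  then have "map (outp P) (map (fst \<circ> \<rho>) (snd x)) = inp P (fst x)"
    using assms(1) unfolding labelled_def by (metis inj_Some inj_map_eq_map)
  then show ?thesis
    using assms(1) grafting_at(1)[OF assms] by (auto simp: composable_def labelled_def)
qed

lemma outp_graft:
  assumes "labelled \<kappa> x" "grafting \<kappa> \<kappa>' \<rho>"
  shows "outp P (fst (graft x \<rho>)) = outp P (fst x)"
  using outp_ocomp[OF composable_grafting[OF assms]] by (simp add: graft_def)

lemma labelled_graft:
  assumes "labelled \<kappa> x" "grafting \<kappa> \<kappa>' \<rho>"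
  shows "labelled \<kappa>' (graft x \<rho>)"
proof -
  have "map \<kappa>' (snd (\<rho> l)) = map Some (inp P (fst (\<rho> l)))" if "l \<in> set (snd x)" for l
    using grafting_at(1)[OF assms that] by (simp add: labelled_def)
  then have eq: "map (map \<kappa>' \<circ> (snd \<circ> \<rho>)) (snd x) = map (map Some \<circ> (inp P \<circ> (fst \<circ> \<rho>))) (snd x)"
    by simp
  then show ?thesis
    using ocomp_opn[OF composable_grafting[OF assms]] inp_ocomp[OF composable_grafting[OF assms]]
    by (simp add: labelled_def graft_def map_concat eq del: map_eq_conv)
qed

lemma labelled_unit: "\<lbrakk>\<kappa> l = Some c; c \<in> col P\<rbrakk> \<Longrightarrow> labelled \<kappa> (unit \<kappa> l)"
  by (simp add: labelled_def unit_def idop_opn inp_idop)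

lemma grafting_unit: "ran \<kappa> \<subseteq> col P \<Longrightarrow> grafting \<kappa> \<kappa> (unit \<kappa>)"
  unfolding grafting_def using labelled_unit[of \<kappa>] by (auto simp: unit_def outp_idop ranI subset_iff)

lemma grafting_graft:
  "\<lbrakk>grafting \<kappa> \<kappa>' \<rho>; grafting \<kappa>' \<kappa>'' \<tau>\<rbrakk> \<Longrightarrow> grafting \<kappa> \<kappa>'' (\<lambda>l. graft (\<rho> l) \<tau>)"
  using labelled_graft[of \<kappa>' _ \<kappa>'' \<tau>] outp_graft[of \<kappa>' _ \<kappa>'' \<tau>] by (simp add: grafting_def)

text \<open>The label lists are concatenated in the same order in which the operad concatenates inputs,
so this is associativity in the operad without any rearrangement.\<close>

lemma graft_graft:
  assumes "labelled \<kappa> x" "grafting \<kappa> \<kappa>' \<rho>" "grafting \<kappa>' \<kappa>'' \<tau>"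
  shows "graft (graft x \<rho>) \<tau> = graft x (\<lambda>l. graft (\<rho> l) \<tau>)"
proof -
  let ?rss = "map (\<lambda>l. map (fst \<circ> \<tau>) (snd (\<rho> l))) (snd x)"
  have "list_all2 (composable P) (map (fst \<circ> \<rho>) (snd x)) ?rss"
    using composable_grafting[OF grafting_at(1)[OF assms(1,2)] assms(3)]
    by (auto simp: list_all2_conv_all_nth)
  from ocomp_assoc[OF composable_grafting[OF assms(1,2)] this]
  show ?thesis by (simp add: graft_def map_concat o_def map2_map_map concat_concat_map)
qed

lemma graft_unit_right: "labelled \<kappa> x \<Longrightarrow> graft x (unit \<kappa>) = x"
proof -
  assume x: "labelled \<kappa> x"
  have "map (fst \<circ> unit \<kappa>) (snd x) = map (idop P \<circ> the) (map \<kappa> (snd x))"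
    by (simp add: unit_def)
  also have "\<dots> = map (idop P) (inp P (fst x))"
    using x by (simp add: labelled_def)
  finally show ?thesis
    using x ocomp_idop_right[of "fst x"]
    by (simp add: graft_def labelled_def) (simp add: unit_def o_def)
qed

lemma graft_unit_left:
  assumes "grafting \<kappa> \<kappa>' \<rho>" "\<kappa> l = Some c"
  shows "graft (unit \<kappa> l) \<rho> = \<rho> l"
  using assms ocomp_idop_left[of "fst (\<rho> l)"]
  by (auto simp: graft_def unit_def grafting_def labelled_def)

text \<open>Labels of the lower vertex are raised by one, which frees the label 0 for its first input.\<close>

abbreviation shift :: "'o \<times> nat list \<Rightarrow> 'o \<times> nat list" where
  "shift \<equiv> map_prod id (map Suc)"

lemma shift_graft: "shift (graft x \<rho>) = graft x (shift \<circ> \<rho>)"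
  by (simp add: graft_def map_concat o_def)

lemma graft_shift: "graft (shift x) \<rho> = graft x (\<rho> \<circ> Suc)"
  by (simp add: graft_def o_def)

lemma labelled_shift: "labelled (case_nat a \<kappa>) (shift x) \<longleftrightarrow> labelled \<kappa> x"
  by (simp add: labelled_def o_def)

lemma grafting_shift: "grafting \<kappa> \<kappa>' \<rho> \<Longrightarrow> grafting \<kappa> (case_nat a \<kappa>') (shift \<circ> \<rho>)"
  by (simp add: grafting_def labelled_shift)

text \<open>A lower vertex has the special label 0; all substitutions into lower vertices used below
treat it separately from the labels of leaves.\<close>

lemma grafting_case_nat:
  "\<lbrakk>labelled \<kappa>' y; outp P (fst y) = c; grafting \<kappa> \<kappa>' \<rho>\<rbrakk>
    \<Longrightarrow> grafting (case_nat (Some c) \<kappa>) \<kappa>' (case_nat y \<rho>)"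
  by (auto simp: grafting_def split: nat.splits)

end

section \<open>Renumbering the inputs of labelled operations\<close>

context symmetric_operad
begin

text \<open>Equality up to a permutation of inputs that carries the labels along; as input \<open>i\<close> of
\<open>fst x\<close> becomes input \<open>s i\<close> of \<open>fst y\<close>, both carry the same label.\<close>

definition sim :: "'o \<times> 'a list \<Rightarrow> 'o \<times> 'a list \<Rightarrow> bool" where
  "sim x y \<longleftrightarrow> (\<exists>s. s permutes {..<arity P (fst x)} \<and> length (snd y) = arity P (fst x) \<and>
     fst y = act P s (fst x) \<and> snd x = permute_list s (snd y))"

lemma arity_act: "\<lbrakk>p \<in> opn P; s permutes {..<arity P p}\<rbrakk> \<Longrightarrow> arity P (act P s p) = arity P p"
  by (simp add: inp_act)

lemma sim_refl: "labelled \<kappa> x \<Longrightarrow> sim x x"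
  unfolding sim_def
  by (rule exI[of _ id]) (simp add: permutes_id act_id labelled_opn labelled_length)

lemma labelled_sim:
  assumes "labelled \<kappa> x" "sim x y"
  shows "labelled \<kappa> y" "outp P (fst y) = outp P (fst x)" "mset (snd y) = mset (snd x)"
proof -
  obtain s where s: "s permutes {..<arity P (fst x)}" "length (snd y) = arity P (fst x)"
    "fst y = act P s (fst x)" "snd x = permute_list s (snd y)" using assms(2)
      by (auto simp: sim_def)
  have x: "fst x \<in> opn P" "map \<kappa> (snd x) = map Some (inp P (fst x))"
    using assms(1) by (auto simp: labelled_def)
  have "map Some (inp P (fst y)) = permute_list (inv s) (map \<kappa> (snd x))"
    using s x by (simp add: inp_act permute_list_map[symmetric] permutes_inv)
  also have "\<dots> = permute_list (s \<circ> inv s) (map \<kappa> (snd y))"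
    using s by (simp add: permute_list_map permute_list_compose permutes_inv)
  finally show "labelled \<kappa> y"
    using s x permutes_inv_o(1)[OF s(1)] by (simp add: labelled_def act_opn)
  show "outp P (fst y) = outp P (fst x)" "mset (snd y) = mset (snd x)"
    using s x by (simp_all add: outp_act)
qed

lemma sim_sym:
  assumes "labelled \<kappa> x" "sim x y"
  shows "sim y x"
proof -
  obtain s where s: "s permutes {..<arity P (fst x)}" "length (snd y) = arity P (fst x)"
    "fst y = act P s (fst x)" "snd x = permute_list s (snd y)" using assms(2)
      by (auto simp: sim_def)
  have x: "fst x \<in> opn P" using assms(1) by (simp add: labelled_def)
  show ?thesis
    unfolding sim_def
  proof (intro exI[of _ "inv s"] conjI)
    show "inv s permutes {..<arity P (fst y)}" using s x by (simp add: arity_act permutes_inv)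
    show "length (snd x) = arity P (fst y)" using s x by (simp add: arity_act)
    show "fst x = act P (inv s) (fst y)"
      using s x by (simp add: act_comp permutes_inv permutes_inv_o(2) act_id)
    have "permute_list (inv s) (snd x) = permute_list (s \<circ> inv s) (snd y)"
      using s by (simp add: permute_list_compose permutes_inv)
    then show "snd y = permute_list (inv s) (snd x)" using permutes_inv_o(1)[OF s(1)] by simp
  qed
qed

lemma sim_trans:
  assumes "labelled \<kappa> x" "sim x y" "sim y z"
  shows "sim x z"
proof -
  obtain s where s: "s permutes {..<arity P (fst x)}" "length (snd y) = arity P (fst x)"
    "fst y = act P s (fst x)" "snd x = permute_list s (snd y)" using assms(2)
      by (auto simp: sim_def)
  obtain t where t: "t permutes {..<arity P (fst y)}" "length (snd z) = arity P (fst y)"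
    "fst z = act P t (fst y)" "snd y = permute_list t (snd z)" using assms(3)
      by (auto simp: sim_def)
  have x: "fst x \<in> opn P" using assms(1) by (simp add: labelled_def)
  have y: "arity P (fst y) = arity P (fst x)" using s x by (simp add: arity_act)
  show ?thesis
    unfolding sim_def
    by (rule exI[of _ "t \<circ> s"])
      (use s t x y in \<open>simp add: permutes_compose act_comp permute_list_compose\<close>)
qed

text \<open>A permutation which carries a list of distinct labels to itself is the identity.\<close>

lemma sim_sorted_eq:
  assumes "labelled \<kappa> x" "sim x y" "sorted_wrt (<) (snd x)" "sorted_wrt (<) (snd y)"
  shows "x = (y :: 'o \<times> nat list)"
proof -
  obtain s where s: "s permutes {..<arity P (fst x)}" "length (snd y) = arity P (fst x)"
    "fst y = act P s (fst x)" "snd x = permute_list s (snd y)" using assms(2)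
      by (auto simp: sim_def)
  have "set (snd x) = set (snd y)"
    using labelled_sim(3)[OF assms(1,2)] by (metis mset_eq_setD)
  then have eq: "snd x = snd y"
    using assms(3,4) by (simp add: strict_sorted_equal)
  have "s i = i" for i
  proof (cases "i < arity P (fst x)")
    case True
    then have "snd y ! s i = snd y ! i"
      using s eq permute_list_nth[of s "snd y" i] by simp
    moreover have "s i < arity P (fst x)" using permutes_in_image[OF s(1), of i] True by simp
    moreover have "distinct (snd y)" using assms(4) strict_sorted_iff by blast
    ultimately show ?thesis using s(2) True by (simp add: nth_eq_iff_index_eq)
  next
    case False then show ?thesis using s(1) by (simp add: permutes_def)
  qed
  then have "s = id" by auto
  then show ?thesis
    using s(3) eq assms(1) by (simp add: labelled_def act_id prod_eq_iff)
qed

lemma sim_sort: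
  assumes "labelled \<kappa> x" "distinct (snd x)"
  shows "sim x (act P (lperm (ranks (snd x))) (fst x), sort (snd x))"
  unfolding sim_def
  by (rule exI[of _ "lperm (ranks (snd x))"])
    (use lperm_ranks[OF assms(2)] labelled_length[OF assms(1)] in simp)

text \<open>Equivariance of composition in the outer operation. The block permutation of the axiom
carries the concatenated label lists along because it permutes whole blocks.\<close>

lemma sim_graft_left:
  assumes x: "labelled \<kappa> x" and xy: "sim x y" and \<rho>: "grafting \<kappa> \<kappa>' \<rho>"
  shows "sim (graft x \<rho>) (graft y \<rho>)"
proof -
  obtain s where s: "s permutes {..<arity P (fst x)}" "length (snd y) = arity P (fst x)"
    "fst y = act P s (fst x)" "snd x = permute_list s (snd y)" using xy by (auto simp: sim_def)
  have y: "labelled \<kappa> y" by (rule labelled_sim(1)[OF x xy])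
  define qs where "qs = map (fst \<circ> \<rho>) (snd y)"
  define Ms where "Ms = map (snd \<circ> \<rho>) (snd y)"
  define B where "B = concat (permute_list s (blocks (map length Ms)))"
  have ar: "map (arity P) qs = map length Ms"
    using labelled_length[OF grafting_at(1)[OF y \<rho>]] by (simp add: qs_def Ms_def)
  have s': "s permutes {..<length (map length Ms)}" using s by (simp add: Ms_def)
  have mB: "mset B = mset [0..<length (concat Ms)]"
    unfolding B_def length_concat by (rule mset_concat_permute_blocks[OF s'])
  then have lB: "length B = length (concat Ms)" by (metis length_upt minus_nat.diff_0 size_mset)
  have "ocomp P (fst y) qs = act P (lperm B) (ocomp P (fst x) (permute_list s qs))"
    unfolding B_def ar[symmetric] s(3)
    using x s composable_grafting[OF y \<rho>] by (intro ocomp_act_outer) (auto simp: labelled_def qs_def)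
  also have "permute_list s qs = map (fst \<circ> \<rho>) (snd x)"
    using s by (simp add: qs_def permute_list_map)
  finally have op: "fst (graft y \<rho>) = act P (lperm B) (fst (graft x \<rho>))"
    by (simp add: graft_def qs_def)
  have "permute_list (lperm B) (concat Ms) = concat (map (map ((!) (concat Ms))) (permute_list s (blocks (map length Ms))))"
    using lB by (simp add: permute_list_lperm) (simp add: B_def map_concat)
  also have "\<dots> = concat (permute_list s Ms)"
    using s' by (subst permute_list_map[symmetric]) (simp_all add: map_nth_blocks length_blocks)
  also have "\<dots> = concat (map (snd \<circ> \<rho>) (snd x))"
    using s by (simp add: Ms_def permute_list_map)
  finally have lab: "snd (graft x \<rho>) = permute_list (lperm B) (snd (graft y \<rho>))"
    by (simp add: graft_def Ms_def)
  have "length (concat Ms) = arity P (fst (graft x \<rho>))"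
    using labelled_length[OF labelled_graft[OF x \<rho>]] arg_cong[OF lab, of length]
    by (simp add: graft_def Ms_def)
  then show ?thesis
    unfolding sim_def using op lab lperm_permutes[of B] mB lB
    by (intro exI[of _ "lperm B"]) (simp add: graft_def Ms_def)
qed

text \<open>Equivariance of composition in the inner operations. Each similarity contributes a
permutation within one block.\<close>

lemma sim_graft_right:
  assumes x: "labelled \<kappa> x" and \<rho>: "grafting \<kappa> \<kappa>' \<rho>"
    and sim: "\<And>l c. \<kappa> l = Some c \<Longrightarrow> sim (\<rho> l) (\<rho>' l)"
  shows "sim (graft x \<rho>) (graft x \<rho>')"
proof -
  have "\<forall>l\<in>set (snd x). \<exists>s. s permutes {..<arity P (fst (\<rho> l))} \<and>
      length (snd (\<rho>' l)) = arity P (fst (\<rho> l)) \<and>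
      fst (\<rho>' l) = act P s (fst (\<rho> l)) \<and> snd (\<rho> l) = permute_list s (snd (\<rho>' l))"
    using sim labelled_dom[OF x] unfolding sim_def by blast
  then obtain t where t: "\<And>l. l \<in> set (snd x) \<Longrightarrow> t l permutes {..<arity P (fst (\<rho> l))}"
    "\<And>l. l \<in> set (snd x) \<Longrightarrow> length (snd (\<rho>' l)) = arity P (fst (\<rho> l))"
    "\<And>l. l \<in> set (snd x) \<Longrightarrow> fst (\<rho>' l) = act P (t l) (fst (\<rho> l))"
    "\<And>l. l \<in> set (snd x) \<Longrightarrow> snd (\<rho> l) = permute_list (t l) (snd (\<rho>' l))"
    by (auto dest!: bchoice)
  define ts where "ts = map t (snd x)"
  define qs where "qs = map (fst \<circ> \<rho>) (snd x)"
  define Ms where "Ms = map (snd \<circ> \<rho>') (snd x)"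
  define bs where "bs = blocks (map length Ms)"
  define B where "B = concat (map2 permute_list ts bs)"
  have ar: "map (arity P) qs = map length Ms" using t(2) by (simp add: qs_def Ms_def)
  have bs: "map length bs = map length Ms" by (simp add: bs_def map_length_blocks)
  have len: "length bs = length (snd x)" using bs by (metis Ms_def length_map)
  have bs_nth: "length (bs ! i) = arity P (fst (\<rho> (snd x ! i)))" if "i < length (snd x)" for i
    using arg_cong[OF bs, of "\<lambda>xs. xs ! i"] that len t(2) by (simp add: Ms_def)
  have ts: "list_all2 (\<lambda>t b. t permutes {..<length b}) ts bs"
    using len bs_nth t(1) by (auto simp: list_all2_conv_all_nth ts_def)
  have mB: "mset B = mset [0..<length (concat Ms)]"
  proof -
    have "mset B = mset (concat bs)"
      unfolding B_def by (rule mset_concat_map2_permute_list[OF ts])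
    then show ?thesis by (simp only: bs_def concat_blocks length_concat)
  qed
  then have lB: "length B = length (concat Ms)" by (metis length_upt minus_nat.diff_0 size_mset)
  have "map2 (act P) ts qs = map (fst \<circ> \<rho>') (snd x)"
    using t(3) by (simp add: ts_def qs_def map2_map_map)
  moreover have "ocomp P (fst x) (map2 (act P) ts qs) = act P (lperm B) (ocomp P (fst x) qs)"
    unfolding B_def bs_def ar[symmetric]
    using composable_grafting[OF x \<rho>] t(1)
    by (intro ocomp_act_inner) (auto simp: qs_def ts_def list_all2_conv_all_nth)
  ultimately have op: "fst (graft x \<rho>') = act P (lperm B) (fst (graft x \<rho>))"
    by (simp add: graft_def qs_def)
  have "permute_list (lperm B) (concat Ms) = concat (map (map ((!) (concat Ms))) (map2 permute_list ts bs))"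
    using lB by (simp add: permute_list_lperm) (simp add: B_def map_concat)
  also have "map (map ((!) (concat Ms))) (map2 permute_list ts bs)
      = map2 permute_list ts (map (map ((!) (concat Ms))) bs)"
    using len list_all2_nthD[OF ts]
    by (intro nth_equalityI) (simp_all add: ts_def permute_list_map)
  also have "\<dots> = map2 permute_list ts Ms"
    by (simp add: bs_def map_nth_blocks)
  also have "\<dots> = map (snd \<circ> \<rho>) (snd x)"
    using t(4) by (simp add: ts_def Ms_def map2_map_map)
  finally have lab: "snd (graft x \<rho>) = permute_list (lperm B) (snd (graft x \<rho>'))"
    by (simp add: graft_def Ms_def)
  have "length (concat Ms) = arity P (fst (graft x \<rho>))"
    using labelled_length[OF labelled_graft[OF x \<rho>]] arg_cong[OF lab, of length]
    by (simp add: graft_def Ms_def)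
  then show ?thesis
    unfolding sim_def using op lab lperm_permutes[of B] mB lB
    by (intro exI[of _ "lperm B"]) (simp add: graft_def Ms_def)
qed

end

section \<open>Symmetric tuples as grafts of labelled operations\<close>

context symmetric_operad
begin

definition up :: "'o stuple \<Rightarrow> nat \<Rightarrow> 'o \<times> nat list" where
  "up f i = (sups f ! i, suplab f ! i)"

definition low :: "'o stuple \<Rightarrow> 'o \<times> nat list" where
  "low f = (slow f, 0 # map Suc (slowlab f))"

text \<open>The colours of the leaves of a tuple with target inputs \<open>cs\<close>: the label of a leaf is its
number.\<close>

definition colouring :: "'c list \<Rightarrow> nat \<rightharpoonup> 'c" where
  "colouring cs i = (if i < length cs then Some (cs ! i) else None)"

text \<open>A symmetric tuple from \<open>a\<close> to \<open>b\<close>, viewed as a grafting \<open>up f\<close> of labelled operations onto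
the inputs of \<open>a\<close> and a labelled operation \<open>low f\<close>, in whose labels 0 stands for the first input.
The last condition says that every leaf has exactly one number.\<close>

definition tuple :: "'c list \<times> 'c \<Rightarrow> 'c list \<times> 'c \<Rightarrow> 'o stuple \<Rightarrow> bool" where
  "tuple a b f \<longleftrightarrow>
     length (sups f) = length (fst a) \<and> length (suplab f) = length (fst a) \<and>
     grafting (colouring (fst a)) (colouring (fst b)) (up f) \<and>
     labelled (case_nat (Some (snd a)) (colouring (fst b))) (low f) \<and> outp P (slow f) = snd b \<and>
     sorted_wrt (<) (slowlab f) \<and> (\<forall>l\<in>set (suplab f). sorted_wrt (<) l) \<and>
     mset (concat (suplab f) @ slowlab f) = mset [0..<length (fst b)]"

lemma colouring_eq_Some: "colouring cs i = Some c \<longleftrightarrow> i < length cs \<and> c = cs ! i"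
  by (auto simp: colouring_def)

lemma ran_colouring: "ran (colouring cs) = set cs"
  by (auto simp: ran_def colouring_eq_Some in_set_conv_nth)

lemma map_colouring_eq:
  "set L \<subseteq> {..<length ds} \<Longrightarrow> map (colouring ds) L = map Some C \<longleftrightarrow> map ((!) ds) L = C"
proof -
  assume "set L \<subseteq> {..<length ds}"
  then have "map (colouring ds) L = map Some (map ((!) ds) L)"
    by (auto simp: colouring_def)
  then show ?thesis by (simp only: inj_map_eq_map inj_Some)
qed

lemma grafting_colouring:
  "grafting (colouring cs) \<kappa> \<rho> \<longleftrightarrow> (\<forall>i<length cs. labelled \<kappa> (\<rho> i) \<and> outp P (fst (\<rho> i)) = cs ! i)"
  by (auto simp: grafting_def colouring_eq_Some)

text \<open>The target profile is the only one for which the vertices of the tuple are labelled with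
matching colours.\<close>

lemma tuple_iff: "tuple a b f \<longleftrightarrow> stuple_from P a f \<and> stuple_tgt_profile P f = b"
proof -
  obtain cs c ds d where [simp]: "a = (cs, c)" "b = (ds, d)" by fastforce
  obtain q0 qs l0 ls where [simp]: "f = STuple q0 qs l0 ls" by (cases f)
  let ?L = "concat ls @ l0" and ?C = "concat (map (inp P) qs) @ tl (inp P q0)"
  let ?shape = "map length ls = map (arity P) qs \<and> length l0 = arity P q0 - 1"
  let ?rest = "q0 \<in> opn P \<and> arity P q0 \<ge> 1 \<and> inp P q0 ! 0 = c \<and> set qs \<subseteq> opn P \<and> map (outp P) qs = cs \<and>
     sorted_wrt (<) l0 \<and> (\<forall>l\<in>set ls. sorted_wrt (<) l) \<and> outp P q0 = d"
  let ?cov = "mset ?L = mset [0..<length ds]"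
  have low: "labelled (case_nat (Some c) (colouring ds)) (low f) \<longleftrightarrow>
      q0 \<in> opn P \<and> arity P q0 \<ge> 1 \<and> inp P q0 ! 0 = c \<and> map (colouring ds) l0 = map Some (tl (inp P q0))"
    by (cases "inp P q0") (auto simp: labelled_def low_def o_def)
  have up: "length qs = length cs \<and> length ls = length cs \<and> grafting (colouring cs) (colouring ds) (up f) \<longleftrightarrow>
      map (map (colouring ds)) ls = map (map Some) (map (inp P) qs) \<and> set qs \<subseteq> opn P \<and> map (outp P) qs = cs"
    (is "?l \<longleftrightarrow> ?r")
  proof
    assume ?l then show ?r
      by (auto simp: grafting_colouring up_def labelled_def list_eq_iff_nth_eq in_set_conv_nth)
  next
    assume r: ?r
    then have "length qs = length cs" "length ls = length qs" by (metis length_map)+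
    with r show ?l
      by (auto simp: grafting_colouring up_def labelled_def list_eq_iff_nth_eq)
  qed
  have "tuple a b f \<longleftrightarrow> ?rest \<and> ?cov \<and> map (map (colouring ds)) ls = map (map Some) (map (inp P) qs) \<and>
      map (colouring ds) l0 = map Some (tl (inp P q0))"
    unfolding tuple_def using low up by auto
  also have "\<dots> \<longleftrightarrow> ?rest \<and> ?cov \<and> ?shape \<and> map (colouring ds) ?L = map Some ?C"
  proof -
    have "?shape" if "map (map (colouring ds)) ls = map (map Some) (map (inp P) qs)"
      "map (colouring ds) l0 = map Some (tl (inp P q0))"
      using arg_cong[OF that(1), of "map length"] arg_cong[OF that(2), of length] by (simp add: o_def)
    moreover have "map (colouring ds) ?L = map Some ?C \<longleftrightarrow>
      map (map (colouring ds)) ls = map (map Some) (map (inp P) qs) \<and>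
      map (colouring ds) l0 = map Some (tl (inp P q0))" if ?shape
    proof -
      have "map length ls = map length (map (inp P) qs)" using that by simp
      then have "length (concat ls) = length (concat (map (inp P) qs))"
        by (simp only: length_concat)
      then show ?thesis
        using map_eq_concat_iff[of ls "map (inp P) qs" "colouring ds" Some] that by simp
    qed
    ultimately show ?thesis by blast
  qed
  also have "\<dots> \<longleftrightarrow> ?rest \<and> ?shape \<and> mset ?L = mset [0..<length ?L] \<and> length ds = length ?L \<and>
      map ((!) ds) ?L = ?C"
  proof -
    have "?cov \<longleftrightarrow> mset ?L = mset [0..<length ?L] \<and> length ds = length ?L"
      by (metis diff_zero length_upt size_mset)
    moreover have "map (colouring ds) ?L = map Some ?C \<longleftrightarrow> map ((!) ds) ?L = ?C" if ?cov
      using that unfolding mset_upt_iff by (intro map_colouring_eq) simp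
    ultimately show ?thesis by blast
  qed
  also have "\<dots> \<longleftrightarrow> ?rest \<and> ?shape \<and> mset ?L = mset [0..<length ?L] \<and>
      permute_list (inv (lperm ?L)) ?C = ds"
  proof -
    have "length ?C = length ?L" if ?shape
    proof -
      have "map length ls = map length (map (inp P) qs)" using that by simp
      then show ?thesis using that by (simp add: length_concat o_def)
    qed
    then show ?thesis using permute_list_inv_lperm_iff[of ?L ?C ds] by blast
  qed
  also have "\<dots> \<longleftrightarrow> stuple_from P a f \<and> stuple_tgt_profile P f = b"
    unfolding mset_upt_iff by auto
  finally show ?thesis .
qed

lemma tuple_target_in_profiles:
  assumes "tuple a b f"
  shows "set (fst b) \<subseteq> col P" "snd b \<in> col P"
proof -
  note f = assms[unfolded tuple_def]
  show "snd b \<in> col P"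
    using f outp_col[of "slow f"] by (auto simp: labelled_def low_def)
  show "set (fst b) \<subseteq> col P"
  proof
    fix c assume "c \<in> set (fst b)"
    then obtain j where j: "j < length (fst b)" "c = fst b ! j" by (auto simp: in_set_conv_nth)
    then have "j \<in> set (concat (suplab f) @ slowlab f)"
      using f unfolding mset_upt_iff by simp
    then consider i where "i < length (fst a)" "j \<in> set (suplab f ! i)" | "j \<in> set (slowlab f)"
      using f by (fastforce simp: in_set_conv_nth)
    then show "c \<in> col P"
    proof cases
      case (1 i)
      then have "labelled (colouring (fst b)) (up f i)" using f by (simp add: grafting_colouring)
      from labelled_dom[OF this, of j] show ?thesis using 1 j by (auto simp: up_def colouring_eq_Some)
    next
      case 2
      from f have "labelled (case_nat (Some (snd a)) (colouring (fst b))) (low f)" by blast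
      from labelled_dom[OF this, of "Suc j"] show ?thesis using 2 j by (auto simp: low_def colouring_eq_Some)
    qed
  qed
qed

text \<open>Substitution that composes \<open>y\<close> with the first input of a lower vertex and keeps its other
inputs.\<close>

definition insert_low :: "'c list \<Rightarrow> 'o \<times> nat list \<Rightarrow> nat \<Rightarrow> 'o \<times> nat list" where
  "insert_low ds y = case_nat y (shift \<circ> unit (colouring ds))"

text \<open>Substitution that grafts vertices onto the inputs of a lower vertex other than the first
one, which stays open.\<close>

definition below :: "'c \<Rightarrow> (nat \<Rightarrow> 'o \<times> nat list) \<Rightarrow> nat \<Rightarrow> 'o \<times> nat list" where
  "below c \<rho> = case_nat (idop P c, [0]) (shift \<circ> \<rho>)"

definition sorted_inputs :: "'o \<times> nat list \<Rightarrow> 'o \<times> nat list" where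
  "sorted_inputs x = (act P (lperm (ranks (snd x))) (fst x), sort (snd x))"

lemma grafting_below:
  assumes "grafting \<kappa> \<kappa>' \<rho>" "c \<in> col P"
  shows "grafting (case_nat (Some c) \<kappa>) (case_nat (Some c) \<kappa>') (below c \<rho>)"
  unfolding below_def
  by (rule grafting_case_nat[OF _ _ grafting_shift[OF assms(1)]])
    (simp_all add: labelled_def assms(2) idop_opn inp_idop outp_idop)

lemma grafting_insert_low:
  assumes "labelled (case_nat (Some c) (colouring ds)) y" "outp P (fst y) = d" "set ds \<subseteq> col P"
  shows "grafting (case_nat (Some d) (colouring ds)) (case_nat (Some c) (colouring ds)) (insert_low ds y)"
  unfolding insert_low_def
  by (rule grafting_case_nat[OF assms(1,2) grafting_shift[OF grafting_unit]])
    (simp add: ran_colouring assms(3))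

text \<open>The definition of composition of symmetric tuples in terms of grafts: the vertices of the
composite are obtained by grafting and then sorting labels.\<close>

lemma stuple_comp_components:
  assumes f: "tuple a b f" and g: "tuple b e g"
  defines "h \<equiv> stuple_comp P g f"
  shows "length (sups h) = length (fst a)" "length (suplab h) = length (fst a)"
    "i < length (fst a) \<Longrightarrow> up h i = sorted_inputs (graft (up f i) (up g))"
    "low h = sorted_inputs (graft (low g) (insert_low (fst e) (graft (low f) (below (snd a) (up g)))))"
proof -
  obtain q0 qs l0 ls where ff: "f = STuple q0 qs l0 ls" by (cases f)
  obtain r0 rs m0 ms where gg: "g = STuple r0 rs m0 ms" by (cases g)
  note f' = f[unfolded tuple_def] note g' = g[unfolded tuple_def]
  have len: "length qs = length (fst a)" "length ls = length (fst a)" using f' by (simp_all add: ff)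
  show "length (sups h) = length (fst a)" "length (suplab h) = length (fst a)"
    using len by (simp_all add: h_def ff gg Let_def)
  show "up h i = sorted_inputs (graft (up f i) (up g))" if "i < length (fst a)"
    using that len by (simp add: h_def ff gg Let_def up_def sorted_inputs_def graft_def o_def)
  have lf: "labelled (case_nat (Some (snd a)) (colouring (fst b))) (low f)" using f' by blast
  have lg: "labelled (case_nat (Some (snd b)) (colouring (fst e))) (low g)" using g' by blast
  have c: "inp P q0 ! 0 = snd a"
    using lf by (cases "inp P q0") (auto simp: labelled_def low_def ff)
  have r0: "map (idop P) (inp P r0) = idop P (snd b) # map (\<lambda>j. idop P (the (colouring (fst e) j))) m0"
  proof -
    have "map (idop P \<circ> the) (map Some (inp P r0))
        = map (idop P \<circ> the) (map (case_nat (Some (snd b)) (colouring (fst e))) (0 # map Suc m0))"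
      using lg by (simp only: labelled_def low_def gg fst_conv snd_conv stuple.sel)
    then show ?thesis by (simp add: o_def)
  qed
  have Suc_concat: "concat (map (\<lambda>j. map Suc (ms ! j)) l0) = map Suc (concat (map ((!) ms) l0))"
    by (simp add: map_concat o_def)
  show "low h = sorted_inputs (graft (low g) (insert_low (fst e) (graft (low f) (below (snd a) (up g)))))"
    by (simp add: h_def ff gg Let_def low_def sorted_inputs_def graft_def insert_low_def below_def o_def
        pcomp_def r0 c up_def unit_def ranks_Cons_Suc insort_0_sort_map_Suc Suc_concat flip: map_append)
qed

lemma sim_sorted_inputs:
  assumes "labelled \<kappa> x" "distinct (snd x)"
  shows "sim x (sorted_inputs x)"
  using sim_sort[OF assms] by (simp add: sorted_inputs_def)

lemma stuple_comp_labels: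
  assumes "length (sups f) = length (suplab f)"
  shows "suplab (stuple_comp P g f) = map (\<lambda>l. sort (concat (map ((!) (suplab g)) l))) (suplab f)"
    "slowlab (stuple_comp P g f) = sort (concat (map ((!) (suplab g)) (slowlab f)) @ slowlab g)"
  using assms by (cases f; cases g; simp add: Let_def)+

lemma tuple_grafting: "tuple a b f \<Longrightarrow> grafting (colouring (fst a)) (colouring (fst b)) (up f)"
  and tuple_labelled_low:
    "tuple a b f \<Longrightarrow> labelled (case_nat (Some (snd a)) (colouring (fst b))) (low f)"
  and tuple_outp_low: "tuple a b f \<Longrightarrow> outp P (fst (low f)) = snd b"
  by (simp_all add: tuple_def low_def)

lemma tuple_labelled_up: "\<lbrakk>tuple a b f; i < length (fst a)\<rbrakk> \<Longrightarrow> labelled (colouring (fst b)) (up f i)"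
  and tuple_outp_up: "\<lbrakk>tuple a b f; i < length (fst a)\<rbrakk> \<Longrightarrow> outp P (fst (up f i)) = fst a ! i"
  using tuple_grafting by (auto simp: grafting_colouring)

lemma tuple_sorted_up: "\<lbrakk>tuple a b f; i < length (fst a)\<rbrakk> \<Longrightarrow> sorted_wrt (<) (snd (up f i))"
  by (simp add: tuple_def up_def)

lemma tuple_sorted_low: "tuple a b f \<Longrightarrow> sorted_wrt (<) (snd (low f))"
  by (simp add: tuple_def low_def sorted_wrt_map)

lemma labelled_inner_low:
  assumes "tuple a b f" "tuple b e g" "snd a \<in> col P"
  shows "labelled (case_nat (Some (snd a)) (colouring (fst e))) (graft (low f) (below (snd a) (up g)))"
    and "outp P (fst (graft (low f) (below (snd a) (up g)))) = snd b"
  using labelled_graft[OF tuple_labelled_low[OF assms(1)]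
    grafting_below[OF tuple_grafting[OF assms(2)] assms(3)]]
    outp_graft[OF tuple_labelled_low[OF assms(1)]
      grafting_below[OF tuple_grafting[OF assms(2)] assms(3)]]
    tuple_outp_low[OF assms(1)] by simp_all

lemma grafting_low:
  assumes "tuple a b f" "tuple b e g" "snd a \<in> col P"
  shows "grafting (case_nat (Some (snd b)) (colouring (fst e))) (case_nat (Some (snd a)) (colouring (fst e)))
    (insert_low (fst e) (graft (low f) (below (snd a) (up g))))"
  by (rule grafting_insert_low[OF labelled_inner_low[OF assms] tuple_target_in_profiles(1)[OF assms(2)]])

text \<open>Sorting distinct labels stays within the similarity class, and distinctness holds because
the labels of all vertices of the composite together are the numbers of the leaves of \<open>g\<close>.\<close>

lemma tuple_stuple_comp:
  assumes f: "tuple a b f" and g: "tuple b e g" and a: "snd a \<in> col P"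
  shows "tuple a e (stuple_comp P g f)"
    and "i < length (fst a) \<Longrightarrow> sim (graft (up f i) (up g)) (up (stuple_comp P g f) i)"
    and "sim (graft (low g) (insert_low (fst e) (graft (low f) (below (snd a) (up g))))) (low (stuple_comp P g f))"
proof -
  let ?h = "stuple_comp P g f"
  let ?U = "\<lambda>l. concat (map ((!) (suplab g)) l)"
  let ?low = "graft (low g) (insert_low (fst e) (graft (low f) (below (snd a) (up g))))"
  note f' = f[unfolded tuple_def] note g' = g[unfolded tuple_def]
  have lens: "length (sups f) = length (fst a)" "length (suplab f) = length (fst a)"
    "length (suplab g) = length (fst b)" using f' g' by blast+
  note comps = stuple_comp_components[OF f g]
  have labels: "suplab ?h = map (\<lambda>l. sort (?U l)) (suplab f)"
    "slowlab ?h = sort (?U (slowlab f) @ slowlab g)"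
    using lens by (simp_all add: stuple_comp_labels)
  have U_concat: "concat (map ?U (suplab f)) = ?U (concat (suplab f))"
    by (simp add: map_concat concat_concat_map o_def)
  have mset_U: "mset (?U (concat (suplab f) @ slowlab f)) = mset (concat (suplab g))"
    using f' lens by (intro mset_concat_nth) simp
  then have all: "mset (concat (map ?U (suplab f)) @ ?U (slowlab f) @ slowlab g) = mset [0..<length (fst e)]"
  proof -
    have "mset (concat (suplab g)) + mset (slowlab g) = mset [0..<length (fst e)]"
      using g' by (simp only: mset_append)
    then show ?thesis
      using mset_U by (simp only: U_concat mset_append concat_append map_append add.assoc[symmetric])
  qed
  then have dist: "distinct (concat (map ?U (suplab f)) @ ?U (slowlab f) @ slowlab g)"
    unfolding mset_upt_iff by blast
  have dist_U: "distinct (?U l)" if "l \<in> set (suplab f)" for l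
  proof -
    have "?U l \<in> set (map ?U (suplab f))" using that by simp
    moreover have "distinct (concat (map ?U (suplab f)))" using dist by (metis distinct_append)
    ultimately show ?thesis by (metis distinct_concat_iff)
  qed
  have snd_up: "snd (graft (up f i) (up g)) = ?U (suplab f ! i)" for i
    by (simp add: graft_def up_def o_def)
  have snd_low: "snd ?low = 0 # map Suc (?U (slowlab f) @ slowlab g)"
    by (simp add: graft_def low_def insert_low_def below_def up_def unit_def map_concat o_def)
  have lab_up: "labelled (colouring (fst e)) (graft (up f i) (up g))" if "i < length (fst a)" for i
    by (rule labelled_graft[OF tuple_labelled_up[OF f that] tuple_grafting[OF g]])
  have lab_low: "labelled (case_nat (Some (snd a)) (colouring (fst e))) ?low"
    by (rule labelled_graft[OF tuple_labelled_low[OF g] grafting_low[OF f g a]])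
  show up: "sim (graft (up f i) (up g)) (up ?h i)" if i: "i < length (fst a)" for i
  proof -
    have "distinct (?U (suplab f ! i))" using dist_U i lens by simp
    then show ?thesis
      unfolding comps(3)[OF i] by (intro sim_sorted_inputs[OF lab_up[OF i]]) (simp add: snd_up)
  qed
  have "distinct (?U (slowlab f) @ slowlab g)" using dist by (metis distinct_append)
  then have "distinct (snd ?low)" unfolding snd_low by (simp add: distinct_map del: map_append)
  then show low: "sim ?low (low ?h)"
    unfolding comps(4) by (rule sim_sorted_inputs[OF lab_low])
  have "grafting (colouring (fst a)) (colouring (fst e)) (up ?h)"
    unfolding grafting_colouring
  proof (intro allI impI)
    fix i assume i: "i < length (fst a)"
    show "labelled (colouring (fst e)) (up ?h i) \<and> outp P (fst (up ?h i)) = fst a ! i"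
      using labelled_sim[OF lab_up[OF i] up[OF i]] tuple_outp_up[OF f i]
        outp_graft[OF tuple_labelled_up[OF f i] tuple_grafting[OF g]] by simp
  qed
  moreover have "labelled (case_nat (Some (snd a)) (colouring (fst e))) (low ?h)"
    by (rule labelled_sim(1)[OF lab_low low])
  moreover have "outp P (slow ?h) = snd e"
    using labelled_sim(2)[OF lab_low low] outp_graft[OF tuple_labelled_low[OF g]
      grafting_low[OF f g a]]
      tuple_outp_low[OF g] by (simp add: low_def)
  moreover have "sorted_wrt (<) (slowlab ?h)"
    using dist unfolding labels by (simp add: strict_sorted_iff)
  moreover have "\<forall>l\<in>set (suplab ?h). sorted_wrt (<) l"
    using dist_U unfolding labels by (simp add: strict_sorted_iff)
  moreover have "mset (concat (suplab ?h) @ slowlab ?h) = mset [0..<length (fst e)]"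
    using all unfolding labels by (simp add: mset_concat o_def)
  ultimately show "tuple a e ?h"
    unfolding tuple_def using comps(1,2) by blast
qed

lemma tuple_eqI:
  assumes h: "tuple a e h" and h': "tuple a e h'"
    and up: "\<And>i. i < length (fst a) \<Longrightarrow> sim (up h i) (up h' i)" and low: "sim (low h) (low h')"
  shows "h = h'"
proof -
  have "up h i = up h' i" if i: "i < length (fst a)" for i
    by (rule sim_sorted_eq[OF tuple_labelled_up[OF h i] up[OF i] tuple_sorted_up[OF h i]
      tuple_sorted_up[OF h' i]])
  moreover have "low h = low h'"
    by (rule sim_sorted_eq[OF tuple_labelled_low[OF h] low tuple_sorted_low[OF h]
      tuple_sorted_low[OF h']])
  ultimately show ?thesis
    using h h' by (intro stuple.expand) (auto simp: up_def low_def tuple_def intro!: nth_equalityI)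
qed

text \<open>Composites are characterized up to similarity, so that sorting never has to be computed
again.\<close>

lemma stuple_compI:
  assumes f: "tuple a b f" and g: "tuple b e g" and h: "tuple a e h" and a: "snd a \<in> col P"
    and up: "\<And>i. i < length (fst a) \<Longrightarrow> sim (graft (up f i) (up g)) (up h i)"
    and low: "sim (graft (low g) (insert_low (fst e) (graft (low f) (below (snd a) (up g))))) (low h)"
  shows "stuple_comp P g f = h"
proof (rule tuple_eqI[OF tuple_stuple_comp(1)[OF f g a] h])
  have lab_up: "labelled (colouring (fst e)) (graft (up f i) (up g))" if "i < length (fst a)" for i
    by (rule labelled_graft[OF tuple_labelled_up[OF f that] tuple_grafting[OF g]])
  have lab_low: "labelled (case_nat (Some (snd a)) (colouring (fst e)))
      (graft (low g) (insert_low (fst e) (graft (low f) (below (snd a) (up g)))))"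
    by (rule labelled_graft[OF tuple_labelled_low[OF g] grafting_low[OF f g a]])
  note c = tuple_stuple_comp[OF f g a]
  show "sim (up (stuple_comp P g f) i) (up h i)" if i: "i < length (fst a)" for i
    by (rule sim_trans[OF labelled_sim(1)[OF lab_up[OF i] c(2)[OF i]]
      sim_sym[OF lab_up[OF i] c(2)[OF i]] up[OF i]])
  show "sim (low (stuple_comp P g f)) (low h)"
    by (rule sim_trans[OF labelled_sim(1)[OF lab_low c(3)] sim_sym[OF lab_low c(3)] low])
qed

lemma graft_idop: "\<lbrakk>fst (\<rho> l) \<in> opn P; outp P (fst (\<rho> l)) = c\<rbrakk> \<Longrightarrow> graft (idop P c, [l]) \<rho> = \<rho> l"
  using ocomp_idop_left[of "fst (\<rho> l)"] by (auto simp: graft_def)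

lemma below_0: "below c \<rho> 0 = (idop P c, [0])" and below_Suc: "below c \<rho> (Suc j) = shift (\<rho> j)"
  and insert_low_0: "insert_low ds y 0 = y"
  and insert_low_Suc: "insert_low ds y (Suc j) = shift (unit (colouring ds) j)"
  by (simp_all add: below_def insert_low_def)

lemma below_o_Suc: "below c \<rho> \<circ> Suc = shift \<circ> \<rho>"
  and insert_low_o_Suc: "insert_low ds y \<circ> Suc = shift \<circ> unit (colouring ds)"
  by (simp_all add: fun_eq_iff below_Suc insert_low_Suc)

text \<open>The following rules for composing the substitutions \<open>below\<close> and \<open>insert_low\<close> evaluate the
iterated grafts in the associativity law.\<close>

lemma graft_below_below:
  "c \<in> col P \<Longrightarrow> graft (below c \<rho> l) (below c \<tau>) = below c (\<lambda>j. graft (\<rho> j) \<tau>) l"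
  by (cases l)
    (simp_all add: below_0 below_Suc graft_idop idop_opn outp_idop graft_shift below_o_Suc shift_graft)

lemma graft_unit_shift:
  assumes "grafting (colouring ds) \<kappa> \<tau>" "j < length ds"
  shows "graft (unit (colouring ds) j) (shift \<circ> \<tau>) = shift (\<tau> j)"
  using graft_unit_left[OF assms(1), of j "ds ! j"] assms(2)
  by (simp add: shift_graft[symmetric] colouring_def)

lemma graft_insert_low_below:
  assumes "grafting (colouring ds) \<kappa> \<tau>" "case_nat (Some d) (colouring ds) l = Some k"
  shows "graft (insert_low ds y l) (below c \<tau>) = case_nat (graft y (below c \<tau>)) (shift \<circ> \<tau>) l"
  using assms graft_unit_shift[OF assms(1)]
  by (cases l) (simp_all add: insert_low_0 insert_low_Suc graft_shift below_o_Suc colouring_eq_Some)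

lemma graft_below_insert_low:
  assumes "grafting \<kappa> (colouring ds) \<tau>" "case_nat (Some d) \<kappa> l = Some k"
    "fst y \<in> opn P" "outp P (fst y) = d"
  shows "graft (below d \<tau> l) (insert_low ds y) = case_nat y (shift \<circ> \<tau>) l"
proof (cases l)
  case 0 then show ?thesis using assms by (simp add: below_0 insert_low_0 graft_idop)
next
  case (Suc j)
  then have "labelled (colouring ds) (\<tau> j)" using assms by (simp add: grafting_def)
  then show ?thesis
    using Suc by (simp add: below_Suc graft_shift insert_low_o_Suc shift_graft[symmetric] graft_unit_right)
qed

lemma graft_insert_low_insert_low:
  assumes "set ds \<subseteq> col P" "case_nat (Some d) (colouring ds) l = Some k"
  shows "graft (insert_low ds z l) (insert_low ds y) = insert_low ds (graft z (insert_low ds y)) l"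
  using assms graft_unit_shift[OF grafting_unit[of "colouring ds"]]
  by (cases l) (simp_all add: insert_low_0 insert_low_Suc graft_shift insert_low_o_Suc colouring_eq_Some ran_colouring)

lemma sim_insert_low:
  assumes "sim z y" "set ds \<subseteq> col P" "case_nat (Some d) (colouring ds) l = Some k"
  shows "sim (insert_low ds z l) (insert_low ds y l)"
proof (cases l)
  case 0 then show ?thesis using assms by (simp add: insert_low_0)
next
  case (Suc j)
  then have "labelled (case_nat None (colouring ds)) (shift (unit (colouring ds) j))"
    using assms unfolding labelled_shift by (intro labelled_unit) (auto simp: colouring_eq_Some)
  then show ?thesis using Suc by (simp add: insert_low_Suc sim_refl)
qed

lemma sim_shift: "sim x y \<Longrightarrow> sim (shift x) (shift y)"
  unfolding sim_def by (auto simp: permute_list_map)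

lemma sim_below:
  assumes "grafting \<kappa> \<kappa>' \<rho>" "c \<in> col P" "case_nat (Some d) \<kappa> l = Some k"
    "\<And>j b. \<kappa> j = Some b \<Longrightarrow> sim (\<rho> j) (\<rho>' j)"
  shows "sim (below c \<rho> l) (below c \<rho>' l)"
proof (cases l)
  case 0
  have "labelled (case_nat (Some c) (\<lambda>_. None)) (idop P c, [0])"
    using assms by (simp add: labelled_def idop_opn inp_idop)
  then show ?thesis using 0 by (simp add: below_0 sim_refl)
next
  case (Suc j) then show ?thesis using assms by (simp add: below_Suc sim_shift)
qed

text \<open>For upper vertices this is associativity of grafting. For lower vertices, both composites
are similar to the lower vertex of \<open>h\<close>, composed at its first input with the lower vertex of \<open>g\<close>,
composed at its first input with that of \<open>f\<close>, where the vertices of \<open>h\<close> have been grafted onto all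
other inputs of the lower vertex of \<open>g\<close> and the grafts of vertices of \<open>g\<close> and \<open>h\<close> onto those of
the lower vertex of \<open>f\<close>.\<close>

lemma stuple_comp_assoc:
  assumes f: "tuple a b f" and g: "tuple b e g" and h: "tuple e w h" and a: "snd a \<in> col P"
  shows "stuple_comp P h (stuple_comp P g f) = stuple_comp P (stuple_comp P h g) f"
proof -
  let ?gf = "stuple_comp P g f" and ?hg = "stuple_comp P h g"
  have b: "snd b \<in> col P" by (rule tuple_target_in_profiles[OF f])
  have w: "set (fst w) \<subseteq> col P" by (rule tuple_target_in_profiles[OF h])
  note gf = tuple_stuple_comp[OF f g a] note hg = tuple_stuple_comp[OF g h b]
  note hgf = tuple_stuple_comp[OF f hg(1) a]
  note Uf = tuple_grafting[OF f] and Ug = tuple_grafting[OF g] and Uh = tuple_grafting[OF h]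
  note Lf = tuple_labelled_low[OF f] and Lg = tuple_labelled_low[OF g] and Lh = tuple_labelled_low[OF h]
  note UgUh = grafting_graft[OF Ug Uh]
  show ?thesis
  proof (rule stuple_compI[OF gf(1) h hgf(1) a])
    fix i assume i: "i < length (fst a)"
    note fi = tuple_labelled_up[OF f i]
    have 1: "sim (graft (graft (up f i) (up g)) (up h)) (graft (up ?gf i) (up h))"
      by (rule sim_graft_left[OF labelled_graft[OF fi Ug] gf(2)[OF i] Uh])
    have 2: "sim (graft (up f i) (\<lambda>j. graft (up g j) (up h))) (graft (up f i) (up ?hg))"
      by (rule sim_graft_right[OF fi UgUh]) (simp add: hg(2) colouring_eq_Some)
    note lab = labelled_graft[OF labelled_graft[OF fi Ug] Uh]
    from 2 have "sim (graft (graft (up f i) (up g)) (up h)) (graft (up f i) (up ?hg))"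
      unfolding graft_graft[OF fi Ug Uh] .
    from sim_trans[OF lab this hgf(2)[OF i]]
    show "sim (graft (up ?gf i) (up h)) (up (stuple_comp P ?hg f) i)"
      by (rule sim_trans[OF labelled_sim(1)[OF lab 1] sim_sym[OF lab 1]])
  next
    let ?c = "snd a"
    define Y where "Y = graft (low f) (below ?c (up g))"
    define Y' where "Y' = graft (low f) (below ?c (\<lambda>j. graft (up g j) (up h)))"
    define Z where "Z = graft (low g) (below (snd b) (up h))"
    define X where "X = graft (low g) (insert_low (fst e) Y)"
    note Y = labelled_inner_low[OF f g a, folded Y_def] and Z = labelled_inner_low[OF g h b, folded Z_def]
    have ins_Y: "grafting (case_nat (Some (snd b)) (colouring (fst e))) (case_nat (Some ?c) (colouring (fst e)))
        (insert_low (fst e) Y)"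
      by (rule grafting_low[OF f g a, folded Y_def])
    note X = labelled_graft[OF Lg ins_Y, folded X_def]
    note cUh = grafting_below[OF Uh a] and dUh = grafting_below[OF Uh b]
      and cUg = grafting_below[OF Ug a] and cUgUh = grafting_below[OF UgUh a]
    have Y': "labelled (case_nat (Some ?c) (colouring (fst w))) Y'" "outp P (fst Y') = snd b"
      unfolding Y'_def
      using labelled_graft[OF Lf cUgUh] outp_graft[OF Lf cUgUh] tuple_outp_low[OF f] by simp_all
    have Y'_eq: "graft Y (below ?c (up h)) = Y'"
      unfolding Y_def Y'_def graft_graft[OF Lf cUg cUh] by (simp add: graft_below_below a)
    have inner: "graft X (below ?c (up h)) = graft Z (insert_low (fst w) Y')"
    proof -
      have "graft X (below ?c (up h)) = graft (low g) (case_nat Y' (shift \<circ> up h))"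
        unfolding X_def graft_graft[OF Lg ins_Y cUh]
        by (rule graft_cong[OF Lg]) (simp only: graft_insert_low_below[OF Uh] Y'_eq)
      also have "\<dots> = graft Z (insert_low (fst w) Y')"
        unfolding Z_def graft_graft[OF Lg dUh grafting_insert_low[OF Y' w]]
        by (rule graft_cong[OF Lg, symmetric])
          (simp only: graft_below_insert_low[OF Uh _ labelled_opn[OF Y'(1)] Y'(2)])
      finally show ?thesis .
    qed
    have XcUh: "labelled (case_nat (Some ?c) (colouring (fst w))) (graft X (below ?c (up h)))"
      "outp P (fst (graft X (below ?c (up h)))) = snd e"
      using labelled_graft[OF X cUh] outp_graft[OF X cUh] outp_graft[OF Lg ins_Y, folded X_def]
        tuple_outp_low[OF g] by simp_all
    let ?T = "graft (low h) (insert_low (fst w) (graft X (below ?c (up h))))"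
    note gT = grafting_insert_low[OF XcUh w] and gZ = grafting_insert_low[OF Z w]
    note T = labelled_graft[OF Lh gT]
    have left: "sim ?T (graft (low h) (insert_low (fst w) (graft (low ?gf) (below ?c (up h)))))"
    proof (rule sim_graft_right[OF Lh gT])
      have "sim (graft X (below ?c (up h))) (graft (low ?gf) (below ?c (up h)))"
        by (rule sim_graft_left[OF X gf(3)[folded Y_def X_def] cUh])
      then show "sim (insert_low (fst w) (graft X (below ?c (up h))) l)
          (insert_low (fst w) (graft (low ?gf) (below ?c (up h))) l)"
        if "case_nat (Some (snd e)) (colouring (fst w)) l = Some k" for l k
        using sim_insert_low w that by blast
    qed
    note gY' = grafting_insert_low[OF Y' w]
    \<comment> \<open>Here the two bracketings of the unsorted grafts are compared.\<close>
    have T_eq: "?T = graft (graft (low h) (insert_low (fst w) Z)) (insert_low (fst w) Y')"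
      unfolding graft_graft[OF Lh gZ gY'] inner
      by (rule graft_cong[OF Lh, symmetric]) (rule graft_insert_low_insert_low[OF w])
    have right1: "sim ?T (graft (low ?hg) (insert_low (fst w) Y'))"
      unfolding T_eq by (rule sim_graft_left[OF labelled_graft[OF Lh gZ] hg(3)[folded Z_def] gY'])
    have right2: "sim (graft (low ?hg) (insert_low (fst w) Y'))
        (graft (low ?hg) (insert_low (fst w) (graft (low f) (below ?c (up ?hg)))))"
    proof (rule sim_graft_right[OF tuple_labelled_low[OF hg(1)] gY'])
      have "sim Y' (graft (low f) (below ?c (up ?hg)))"
        unfolding Y'_def
        by (rule sim_graft_right[OF Lf cUgUh], rule sim_below[OF UgUh a])
          (auto simp: hg(2) colouring_eq_Some)
      then show "sim (insert_low (fst w) Y' l) (insert_low (fst w) (graft (low f) (below ?c (up ?hg))) l)"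
        if "case_nat (Some (snd b)) (colouring (fst w)) l = Some k" for l k
        using sim_insert_low w that by blast
    qed
    have "sim ?T (low (stuple_comp P ?hg f))"
      by (rule sim_trans[OF T right1 sim_trans[OF labelled_sim(1)[OF T right1] right2 hgf(3)]])
    then show "sim (graft (low h) (insert_low (fst w) (graft (low ?gf) (below ?c (up h)))))
        (low (stuple_comp P ?hg f))"
      by (rule sim_trans[OF labelled_sim(1)[OF T left] sim_sym[OF T left]])
  qed
qed

section \<open>Upper and lower symmetric tuples\<close>

definition upper :: "'o stuple \<Rightarrow> bool" where
  "upper f \<longleftrightarrow> slow f \<in> idop P ` col P"

definition lower :: "'o stuple \<Rightarrow> bool" where
  "lower f \<longleftrightarrow> set (sups f) \<subseteq> idop P ` col P \<and> sorted_wrt (<) (map (\<lambda>l. l ! 0) (suplab f))"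

lemma tuple_stuple_id:
  assumes "set cs \<subseteq> col P" "c \<in> col P"
  shows "tuple (cs, c) (cs, c) (stuple_id P (cs, c))"
proof -
  have "concat (map (\<lambda>i. [i]) [0..<length cs]) = [0..<length cs]" by (induction "length cs") auto
  moreover have "grafting (colouring cs) (colouring cs) (up (stuple_id P (cs, c)))"
    using subsetD[OF assms(1) nth_mem]
    by (simp add: grafting_colouring up_def labelled_def idop_opn inp_idop outp_idop colouring_def)
  ultimately show ?thesis
    using assms(2) by (simp add: tuple_def low_def labelled_def idop_opn inp_idop outp_idop)
qed

lemma up_stuple_id: "i < length cs \<Longrightarrow> up (stuple_id P (cs, c)) i = unit (colouring cs) i"
  and low_stuple_id: "low (stuple_id P (cs, c)) = (idop P c, [0])"
  by (simp_all add: up_def unit_def colouring_def low_def)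

lemma insert_low_idop: "insert_low ds (idop P c, [0]) = unit (case_nat (Some c) (colouring ds))"
proof
  show "insert_low ds (idop P c, [0]) l = unit (case_nat (Some c) (colouring ds)) l" for l
    by (cases l) (simp_all add: insert_low_0 insert_low_Suc unit_def)
qed

lemma stuple_comp_id_right:
  assumes f: "tuple a b f" and a: "set (fst a) \<subseteq> col P" "snd a \<in> col P"
  shows "stuple_comp P f (stuple_id P a) = f"
proof -
  obtain cs c where a': "a = (cs, c)" by fastforce
  have id: "tuple a a (stuple_id P a)" using tuple_stuple_id a by (simp add: a')
  have b: "set (fst b) \<subseteq> col P" by (rule tuple_target_in_profiles[OF f])
  show ?thesis
  proof (rule stuple_compI[OF id f f a(2)])
    fix i assume i: "i < length (fst a)"
    have "graft (up (stuple_id P a) i) (up f) = up f i"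
      using graft_unit_left[OF tuple_grafting[OF f], of i "fst a ! i"] i
      by (simp add: a' up_stuple_id colouring_def del: stuple_id.simps)
    then show "sim (graft (up (stuple_id P a) i) (up f)) (up f i)"
      using sim_refl[OF tuple_labelled_up[OF f i]] by simp
  next
    have "graft (low (stuple_id P a)) (below (snd a) (up f)) = (idop P c, [0])"
      using a by (simp add: a' low_stuple_id graft_idop below_0 idop_opn outp_idop del: stuple_id.simps)
    then have "graft (low f) (insert_low (fst b) (graft (low (stuple_id P a)) (below (snd a) (up f)))) = low f"
      using graft_unit_right[OF tuple_labelled_low[OF f]] b by (simp add: a' insert_low_idop)
    then show "sim (graft (low f) (insert_low (fst b) (graft (low (stuple_id P a)) (below (snd a) (up f))))) (low f)"
      using sim_refl[OF tuple_labelled_low[OF f]] by simp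
  qed
qed

lemma stuple_comp_id_left:
  assumes f: "tuple a b f" and a: "set (fst a) \<subseteq> col P" "snd a \<in> col P"
  shows "stuple_comp P (stuple_id P b) f = f"
proof -
  obtain ds d where b': "b = (ds, d)" by fastforce
  have b: "set ds \<subseteq> col P" "d \<in> col P" using tuple_target_in_profiles[OF f] by (simp_all add: b')
  have id: "tuple b b (stuple_id P b)" using tuple_stuple_id b by (simp add: b')
  show ?thesis
  proof (rule stuple_compI[OF f id f a(2)])
    fix i assume i: "i < length (fst a)"
    note fi = tuple_labelled_up[OF f i]
    have "graft (up f i) (up (stuple_id P b)) = graft (up f i) (unit (colouring ds))"
      by (rule graft_cong[OF fi]) (simp add: b' colouring_eq_Some up_stuple_id del: stuple_id.simps)
    then have "graft (up f i) (up (stuple_id P b)) = up f i"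
      using graft_unit_right[OF fi] by (simp add: b')
    then show "sim (graft (up f i) (up (stuple_id P b))) (up f i)"
      using sim_refl[OF fi] by simp
  next
    note Lf = tuple_labelled_low[OF f]
    let ?Y = "graft (low f) (below (snd a) (up (stuple_id P b)))"
    have "?Y = graft (low f) (unit (case_nat (Some (snd a)) (colouring (fst b))))"
    proof (rule graft_cong[OF Lf])
      fix l k assume "case_nat (Some (snd a)) (colouring (fst b)) l = Some k"
      then show "below (snd a) (up (stuple_id P b)) l = unit (case_nat (Some (snd a)) (colouring (fst b))) l"
        by (cases l) (simp_all add: b' colouring_eq_Some below_0 below_Suc up_stuple_id unit_def del: stuple_id.simps)
    qed
    then have Y: "?Y = low f" using graft_unit_right[OF Lf] by simp
    have "graft (low (stuple_id P b)) (insert_low (fst b) ?Y) = low f"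
      unfolding Y using labelled_opn[OF Lf] tuple_outp_low[OF f]
      by (simp add: b' low_stuple_id graft_idop insert_low_0 del: stuple_id.simps)
    then show "sim (graft (low (stuple_id P b)) (insert_low (fst b) ?Y)) (low f)"
      using sim_refl[OF Lf] by simp
  qed
qed

lemma upper_iff_low:
  assumes "tuple a b f" "snd a \<in> col P"
  shows "upper f \<longleftrightarrow> low f = (idop P (snd a), [0])"
proof
  assume "upper f"
  then obtain c where c: "c \<in> col P" "slow f = idop P c" by (auto simp: upper_def)
  then show "low f = (idop P (snd a), [0])"
    using tuple_labelled_low[OF assms(1)] by (auto simp: labelled_def low_def inp_idop)
qed (use assms in \<open>auto simp: upper_def low_def\<close>)

lemma upper_target: "\<lbrakk>tuple a b f; snd a \<in> col P; upper f\<rbrakk> \<Longrightarrow> snd b = snd a"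
  using upper_iff_low tuple_outp_low outp_idop by fastforce

text \<open>Upper vertices that are identities have one input each, so they amount to an increasing list
of leaf numbers.\<close>

lemma lower_iff_up:
  assumes f: "tuple a b f" and a: "set (fst a) \<subseteq> col P"
  shows "lower f \<longleftrightarrow> (\<exists>xs. sorted_wrt (<) xs \<and> length xs = length (fst a) \<and>
    (\<forall>i<length (fst a). up f i = (idop P (fst a ! i), [xs ! i])))"
proof
  assume l: "lower f"
  let ?xs = "map (\<lambda>l. l ! 0) (suplab f)"
  have len: "length (sups f) = length (fst a)" "length (suplab f) = length (fst a)"
    using f by (simp_all add: tuple_def)
  have "up f i = (idop P (fst a ! i), [?xs ! i])" if i: "i < length (fst a)" for i
  proof -
    have "sups f ! i \<in> idop P ` col P" using l i len by (auto simp: lower_def)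
    then obtain c where c: "c \<in> col P" "sups f ! i = idop P c" by blast
    then have "c = fst a ! i" using tuple_outp_up[OF f i] by (simp add: up_def outp_idop)
    moreover have "length (suplab f ! i) = 1"
      using labelled_length[OF tuple_labelled_up[OF f i]] c by (simp add: up_def inp_idop)
    ultimately show ?thesis
      using c i len by (cases "suplab f ! i") (auto simp: up_def)
  qed
  then show "\<exists>xs. sorted_wrt (<) xs \<and> length xs = length (fst a) \<and>
    (\<forall>i<length (fst a). up f i = (idop P (fst a ! i), [xs ! i]))"
    using l len by (intro exI[of _ ?xs]) (simp add: lower_def)
next
  assume "\<exists>xs. sorted_wrt (<) xs \<and> length xs = length (fst a) \<and>
    (\<forall>i<length (fst a). up f i = (idop P (fst a ! i), [xs ! i]))"
  then obtain xs where xs: "sorted_wrt (<) xs" "length xs = length (fst a)"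
    "\<And>i. i < length (fst a) \<Longrightarrow> up f i = (idop P (fst a ! i), [xs ! i])" by blast
  have len: "length (sups f) = length (fst a)" "length (suplab f) = length (fst a)"
    using f by (simp_all add: tuple_def)
  have "map (\<lambda>l. l ! 0) (suplab f) = xs"
    using xs len by (intro nth_equalityI) (simp_all add: up_def)
  moreover have "set (sups f) \<subseteq> idop P ` col P"
    using xs(3) a len by (auto simp: in_set_conv_nth up_def subset_iff)
  ultimately show "lower f" using xs(1) by (simp add: lower_def)
qed

lemma upper_stuple_comp:
  assumes f: "tuple a b f" and g: "tuple b e g" and a: "snd a \<in> col P" and "upper f" "upper g"
  shows "upper (stuple_comp P g f)"
proof -
  note gf = tuple_stuple_comp[OF f g a]
  have b: "snd b = snd a" by (rule upper_target[OF f a \<open>upper f\<close>])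
  have lows: "low f = (idop P (snd a), [0])" "low g = (idop P (snd a), [0])"
    using upper_iff_low[OF f a] upper_iff_low[OF g] assms b by simp_all
  have "graft (low g) (insert_low (fst e) (graft (low f) (below (snd a) (up g)))) = (idop P (snd a), [0])"
    using a by (simp add: lows graft_idop below_0 insert_low_0 idop_opn outp_idop)
  then have "sim (low f) (low (stuple_comp P g f))" using gf(3) lows by simp
  from sim_sorted_eq[OF tuple_labelled_low[OF f] this tuple_sorted_low[OF f]
    tuple_sorted_low[OF gf(1)]]
  show ?thesis using upper_iff_low[OF gf(1) a] lows by simp
qed

lemma lower_stuple_comp:
  assumes f: "tuple a b f" and g: "tuple b e g" and a: "set (fst a) \<subseteq> col P" "snd a \<in> col P"
    and "lower f" "lower g"
  shows "lower (stuple_comp P g f)"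
proof -
  note gf = tuple_stuple_comp[OF f g a(2)]
  have b: "set (fst b) \<subseteq> col P" by (rule tuple_target_in_profiles[OF f])
  obtain xs where xs: "sorted_wrt (<) xs" "length xs = length (fst a)"
    "\<And>i. i < length (fst a) \<Longrightarrow> up f i = (idop P (fst a ! i), [xs ! i])"
    using lower_iff_up[OF f a(1)] \<open>lower f\<close> by blast
  obtain ys where ys: "sorted_wrt (<) ys" "length ys = length (fst b)"
    "\<And>i. i < length (fst b) \<Longrightarrow> up g i = (idop P (fst b ! i), [ys ! i])"
    using lower_iff_up[OF g b] \<open>lower g\<close> by blast
  have up_f: "xs ! i < length (fst b) \<and> fst b ! (xs ! i) = fst a ! i" if i: "i < length (fst a)" for i
    using tuple_labelled_up[OF f i] a i
    by (auto simp: xs(3)[OF i] labelled_def inp_idop colouring_eq_Some subset_iff)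
  have "up (stuple_comp P g f) i = (idop P (fst a ! i), [ys ! (xs ! i)])" if i: "i < length (fst a)" for i
  proof -
    have j: "xs ! i < length (fst b)" using up_f[OF i] by simp
    have "graft (up f i) (up g) = up g (xs ! i)"
      unfolding xs(3)[OF i] using tuple_labelled_up[OF g j] tuple_outp_up[OF g j] up_f[OF i]
      by (intro graft_idop) (simp_all add: labelled_opn)
    then have "sim (up g (xs ! i)) (up (stuple_comp P g f) i)" using gf(2)[OF i] by simp
    from sim_sorted_eq[OF tuple_labelled_up[OF g j] this tuple_sorted_up[OF g j]
      tuple_sorted_up[OF gf(1) i]]
    show ?thesis using ys(3)[OF j] up_f[OF i] by simp
  qed
  then have *: "\<forall>i<length (fst a). up (stuple_comp P g f) i = (idop P (fst a ! i), [map ((!) ys) xs ! i])"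
    using xs(2) by simp
  have "sorted_wrt (<) (map ((!) ys) xs)"
    using xs(1,2) ys(1,2) up_f by (auto simp: sorted_wrt_iff_nth_less)
  then show ?thesis
    unfolding lower_iff_up[OF gf(1) a(1)] using * xs(2) by (intro exI[of _ "map ((!) ys) xs"]) simp
qed

text \<open>The leaves of the upper vertices are renumbered by their rank.\<close>

definition upper_factor :: "'c \<Rightarrow> 'o stuple \<Rightarrow> 'o stuple" where
  "upper_factor c f = (let X = sort (concat (suplab f)) in
     STuple (idop P c) (sups f) [] (map (map (inv_into {..<length X} ((!) X))) (suplab f)))"

text \<open>The upper vertices become identities whose leaves carry, in increasing order, the numbers
that \<open>f\<close> gives to the leaves of its upper vertices.\<close>

definition lower_factor :: "'c list \<Rightarrow> 'o stuple \<Rightarrow> 'o stuple" where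
  "lower_factor ds f = (let X = sort (concat (suplab f)) in
     STuple (slow f) (map (\<lambda>x. idop P (ds ! x)) X) (slowlab f) (map (\<lambda>x. [x]) X))"

lemma factors:
  assumes f: "tuple a b f" and a: "snd a \<in> col P"
  defines "m \<equiv> (map ((!) (fst b)) (sort (concat (suplab f))), snd a)"
  shows "tuple a m (upper_factor (snd a) f)" "tuple m b (lower_factor (fst b) f)"
    "upper (upper_factor (snd a) f)" "lower (lower_factor (fst b) f)"
    "stuple_comp P (lower_factor (fst b) f) (upper_factor (snd a) f) = f"
proof -
  define X where "X = sort (concat (suplab f))"
  \<comment> \<open>\<open>pos\<close> numbers the intermediate leaves; \<open>X\<close> is its inverse.\<close>
  define pos where "pos = inv_into {..<length X} ((!) X)"
  let ?l = "upper_factor (snd a) f" and ?r = "lower_factor (fst b) f"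
  note f' = f[unfolded tuple_def]
  have b: "set (fst b) \<subseteq> col P" by (rule tuple_target_in_profiles[OF f])
  have m: "m = (map ((!) (fst b)) X, snd a)" by (simp add: m_def X_def)
  have l: "?l = STuple (idop P (snd a)) (sups f) [] (map (map pos) (suplab f))"
    by (simp add: upper_factor_def X_def pos_def Let_def)
  have r: "?r = STuple (slow f) (map (\<lambda>x. idop P (fst b ! x)) X) (slowlab f) (map (\<lambda>x. [x]) X)"
    by (simp add: lower_factor_def X_def Let_def)
  have cov: "distinct (concat (suplab f) @ slowlab f)"
    "set (concat (suplab f) @ slowlab f) = {..<length (fst b)}"
    using f' mset_upt_iff by blast+
  have setX: "set X = set (concat (suplab f))" by (simp add: X_def)
  have X: "sorted_wrt (<) X" using cov by (simp add: X_def strict_sorted_iff)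
  have X_less: "x < length (fst b)" if "x \<in> set X" for x using that cov setX by auto
  note pos = strict_sorted_pos[OF X, folded pos_def]
  have sub: "set (suplab f ! i) \<subseteq> set X" if "i < length (fst a)" for i
    using that f' setX by auto
  show tl: "tuple a m ?l"
  proof -
    have "grafting (colouring (fst a)) (colouring (fst m)) (up ?l)"
      unfolding grafting_colouring
    proof (intro allI impI)
      fix i assume i: "i < length (fst a)"
      have "colouring (fst m) (pos x) = colouring (fst b) x" if "x \<in> set (suplab f ! i)" for x
        using that sub[OF i] pos(1,2) X_less by (auto simp: colouring_def m)
      then have "map (colouring (fst m)) (map pos (suplab f ! i)) = map (colouring (fst b)) (suplab f ! i)"
        by simp
      then show "labelled (colouring (fst m)) (up ?l i) \<and> outp P (fst (up ?l i)) = fst a ! i"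
        using tuple_labelled_up[OF f i] tuple_outp_up[OF f i] i f'
        by (simp add: l up_def labelled_def del: map_map)
    qed
    moreover have "sorted_wrt (<) (map pos (suplab f ! i))" if i: "i < length (fst a)" for i
      using tuple_sorted_up[OF f i] sub[OF i] pos(4)
      by (auto simp: up_def sorted_wrt_map elim!: sorted_wrt_mono_rel[rotated])
    moreover have "mset (concat (map (map pos) (suplab f))) = mset [0..<length X]"
    proof -
      have "map pos X = [0..<length X]" by (rule nth_equalityI) (simp_all add: pos(3))
      then have "mset (map pos X) = mset [0..<length X]" by simp
      then show ?thesis by (simp add: X_def flip: map_concat)
    qed
    ultimately show ?thesis
      using f' a by (auto simp: tuple_def l m low_def labelled_def idop_opn inp_idop outp_idop in_set_conv_nth)
  qed
  have low_r: "low ?r = low f" by (simp add: low_def r)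
  have up_r: "up ?r j = (idop P (fst b ! (X ! j)), [X ! j])" if "j < length X" for j
    using that by (simp add: up_def r)
  show tr: "tuple m b ?r"
  proof -
    have "grafting (colouring (fst m)) (colouring (fst b)) (up ?r)"
      unfolding grafting_colouring
      using subsetD[OF b nth_mem] X_less
      by (simp add: up_r m labelled_def colouring_def idop_opn inp_idop outp_idop)
    moreover have "mset (X @ slowlab f) = mset [0..<length (fst b)]"
      using f' by (simp add: X_def)
    ultimately show ?thesis
      using f' low_r unfolding tuple_def by (auto simp: r m concat_singletons)
  qed
  show "upper ?l" using a by (simp add: upper_def l)
  show "lower ?r" using X b X_less by (auto simp: lower_def r o_def subset_iff)
  show "stuple_comp P ?r ?l = f"
  proof (rule stuple_compI[OF tl tr f a])
    fix i assume i: "i < length (fst a)"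
    have p: "up ?r (pos x) = unit (colouring (fst b)) x" if "x \<in> set (suplab f ! i)" for x
    proof -
      have "x \<in> set X" using that sub[OF i] by blast
      then show ?thesis using pos(1,2) X_less by (simp add: up_r unit_def colouring_def)
    qed
    have "up ?l i = (sups f ! i, map pos (suplab f ! i))"
      using i f' by (simp add: up_def l)
    then have "graft (up ?l i) (up ?r) = graft (sups f ! i, suplab f ! i) (up ?r \<circ> pos)"
      by (simp add: graft_def o_def)
    also have "\<dots> = graft (up f i) (unit (colouring (fst b)))"
      using p by (simp add: graft_def up_def[of f] cong: map_cong)
    also have "\<dots> = up f i" by (rule graft_unit_right[OF tuple_labelled_up[OF f i]])
    finally show "sim (graft (up ?l i) (up ?r)) (up f i)"
      using sim_refl[OF tuple_labelled_up[OF f i]] by simp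
  next
    have "graft (low ?l) (below (snd a) (up ?r)) = (idop P (snd a), [0])"
      using a by (simp add: low_def l graft_idop below_0 idop_opn outp_idop)
    then have "graft (low ?r) (insert_low (fst b) (graft (low ?l) (below (snd a) (up ?r)))) = low f"
      using graft_unit_right[OF tuple_labelled_low[OF f]] b by (simp add: low_r insert_low_idop)
    then show "sim (graft (low ?r) (insert_low (fst b) (graft (low ?l) (below (snd a) (up ?r))))) (low f)"
      using sim_refl[OF tuple_labelled_low[OF f]] by simp
  qed
qed

text \<open>Composing with an upper tuple does not change the lower vertex, so the lower vertex of \<open>r\<close>
is that of \<open>f\<close>. The numbers \<open>X\<close> on the identities of \<open>r\<close> are the remaining ones in increasing
order, and the labels of \<open>l\<close> are mapped to those of \<open>f\<close> by indexing \<open>X\<close>, which is injective.\<close>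

lemma factors_unique:
  assumes l: "tuple a m l" and r: "tuple m b r" and a: "snd a \<in> col P" and "upper l" "lower r"
  defines "f \<equiv> stuple_comp P r l"
  shows "l = upper_factor (snd a) f" "r = lower_factor (fst b) f"
proof -
  note f = tuple_stuple_comp[OF l r a, folded f_def]
  note l' = l[unfolded tuple_def] note r' = r[unfolded tuple_def] note f' = f(1)[unfolded tuple_def]
  have m: "set (fst m) \<subseteq> col P" by (rule tuple_target_in_profiles[OF l])
  have b: "set (fst b) \<subseteq> col P" by (rule tuple_target_in_profiles[OF r])
  have low_l: "low l = (idop P (snd a), [0])" using upper_iff_low[OF l a] \<open>upper l\<close> by simp
  obtain X where X: "sorted_wrt (<) X" "length X = length (fst m)"
    "\<And>i. i < length (fst m) \<Longrightarrow> up r i = (idop P (fst m ! i), [X ! i])"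
    using lower_iff_up[OF r m] \<open>lower r\<close> by blast
  have X_b: "X ! i < length (fst b) \<and> fst b ! (X ! i) = fst m ! i" if i: "i < length (fst m)" for i
    using tuple_labelled_up[OF r i] m i
    by (auto simp: X(3)[OF i] labelled_def inp_idop colouring_eq_Some subset_iff)
  have "graft (low l) (below (snd a) (up r)) = (idop P (snd a), [0])"
    using a by (simp add: low_l graft_idop below_0 idop_opn outp_idop)
  moreover have "snd m = snd a" by (rule upper_target[OF l a \<open>upper l\<close>])
  ultimately have "graft (low r) (insert_low (fst b) (graft (low l) (below (snd a) (up r)))) = low r"
    using graft_unit_right[OF tuple_labelled_low[OF r]] b by (simp add: insert_low_idop)
  then have "sim (low r) (low f)" using f(3) by simp
  then have low_r: "low r = low f"
    by (rule sim_sorted_eq[OF tuple_labelled_low[OF r] _ tuple_sorted_low[OF r]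
      tuple_sorted_low[OF f(1)]])
  have up_l: "up f i = (sups l ! i, map ((!) X) (suplab l ! i))"
    "set (suplab l ! i) \<subseteq> {..<length X}"
    if i: "i < length (fst a)" for i
  proof -
    have less: "j < length X" if "j \<in> set (suplab l ! i)" for j
      using labelled_dom[OF tuple_labelled_up[OF l i], of j] that X(2)
        by (auto simp: up_def colouring_eq_Some)
    then show "set (suplab l ! i) \<subseteq> {..<length X}" by blast
    let ?x = "(sups l ! i, map ((!) X) (suplab l ! i))"
    have "map (colouring (fst b)) (map ((!) X) (suplab l ! i)) = map (colouring (fst m)) (suplab l ! i)"
      using less X_b X(2) by (auto simp: colouring_def)
    then have x: "labelled (colouring (fst b)) ?x"
      using tuple_labelled_up[OF l i] by (simp add: labelled_def up_def del: map_map)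
    have "up r j = unit (colouring (fst b)) (X ! j)" if "j \<in> set (suplab l ! i)" for j
      using less[OF that] X X_b by (simp add: unit_def colouring_def)
    then have "graft (up l i) (up r) = graft ?x (unit (colouring (fst b)))"
      by (simp add: graft_def up_def[of l] cong: map_cong)
    also have "\<dots> = ?x" by (rule graft_unit_right[OF x])
    finally have "sim ?x (up f i)" using f(2)[OF i] by simp
    moreover have "sorted_wrt (<) (snd ?x)"
      using tuple_sorted_up[OF l i] less X(1)
      by (auto simp: up_def sorted_wrt_map sorted_wrt_iff_nth_less)
    ultimately show "up f i = ?x"
      using sim_sorted_eq[OF x _ _ tuple_sorted_up[OF f(1) i]] by metis
  qed
  have len: "length (sups l) = length (fst a)" "length (suplab l) = length (fst a)"
    "length (sups f) = length (fst a)" "length (suplab f) = length (fst a)"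
    "length (sups r) = length X" "length (suplab r) = length X"
    using l' f' r' X(2) by simp_all
  have sups_f: "sups f = sups l" and suplab_f: "suplab f = map (map ((!) X)) (suplab l)"
    using up_l len by (auto simp: up_def intro!: nth_equalityI)
  have suplab_r: "suplab r = map (\<lambda>x. [x]) X" and sups_r: "sups r = map (\<lambda>x. idop P (fst b ! x)) X"
    using X len X_b by (auto simp: up_def intro!: nth_equalityI)
  have slow: "slow r = slow f" "slowlab r = slowlab f"
    using low_r by (simp_all add: low_def inj_map_eq_map)
  have "mset (concat (suplab f) @ slowlab f) = mset (X @ slowlab f)"
    using f' r' slow by (simp add: suplab_r concat_singletons)
  then have "sort (concat (suplab f)) = X"
    using X(1) by (intro properties_for_sort) (simp_all add: strict_sorted_iff)
  note X_eq = this
  show "r = lower_factor (fst b) f"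
    unfolding lower_factor_def X_eq Let_def
    by (rule stuple.expand) (simp add: slow suplab_r sups_r)
  have pos: "map (inv_into {..<length X} ((!) X)) (map ((!) X) xs) = xs" if "set xs \<subseteq> {..<length X}" for xs
    unfolding map_map using that strict_sorted_pos(3)[OF X(1)] by (intro map_idI) auto
  have "map (map (inv_into {..<length X} ((!) X))) (suplab f) = suplab l"
    unfolding suplab_f using up_l(2) len pos by (intro nth_equalityI) simp_all
  then show "l = upper_factor (snd a) f"
    unfolding upper_factor_def X_eq Let_def
    using low_l by (intro stuple.expand) (simp add: sups_f low_def)
qed

section \<open>Action of symmetric tuples on operations\<close>

lemma factorized_tuples_symmetric:
  "factorized_tuples (profiles P) (stuple_from P) (stuple_tgt_profile P) (stuple_id P) (stuple_comp P) upper lower"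
proof -
  have A: "set (fst a) \<subseteq> col P" "snd a \<in> col P" if "a \<in> profiles P" for a
    using that by (auto simp: profiles_def)
  have T: "tuple a (stuple_tgt_profile P f) f" if "stuple_from P a f" for a f
    using that by (simp add: tuple_iff)
  have S: "stuple_from P a f" "stuple_tgt_profile P f = b" if "tuple a b f" for a b f
    using that by (simp_all add: tuple_iff)
  have id: "tuple a a (stuple_id P a)" if "a \<in> profiles P" for a
    using that tuple_stuple_id by (auto simp: profiles_def simp del: stuple_id.simps)
  have upper_id: "upper (stuple_id P a)" if "a \<in> profiles P" for a
    using that by (auto simp: profiles_def upper_def)
  have lower_id: "lower (stuple_id P a)" if "a \<in> profiles P" for a
    using that by (auto simp: profiles_def lower_def sorted_wrt_iff_nth_less intro!: imageI dest: subsetD)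
  show ?thesis
  proof (unfold_locales, goal_cases)
    case (1 a f)
    then show ?case
      using tuple_target_in_profiles[OF T[OF 1(2)]]
      by (cases "stuple_tgt_profile P f") (simp add: profiles_def)
  next
    case (2 a) then show ?case using S(1)[OF id] by simp
  next
    case (3 a) then show ?case using S(2)[OF id] by simp
  next
    case (4 a f g) then show ?case using S(1)[OF tuple_stuple_comp(1)[OF T T A(2)]] by simp
  next
    case (5 a f g) then show ?case using S(2)[OF tuple_stuple_comp(1)[OF T T A(2)]] by simp
  next
    case (6 a f) then show ?case using stuple_comp_id_right[OF T A] by simp
  next
    case (7 a f) then show ?case using stuple_comp_id_left[OF T A] by simp
  next
    case (8 a f g h) then show ?case using stuple_comp_assoc[OF T T T A(2)] by simp
  next
    case (9 a) then show ?case by (rule upper_id)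
  next
    case (10 a) then show ?case by (rule lower_id)
  next
    case (11 a f g) then show ?case using upper_stuple_comp[OF T T A(2)] by simp
  next
    case (12 a f g) then show ?case using lower_stuple_comp[OF T T A] by simp
  next
    case (13 a f)
    note F = factors[OF T[OF 13(2)] A(2)[OF 13(1)]]
    show ?case using S[OF F(1)] S(1)[OF F(2)] F(3-5) by metis
  next
    case (14 a l r l' r')
    have l: "tuple a (stuple_tgt_profile P l) l" and r: "tuple (stuple_tgt_profile P l) (stuple_tgt_profile P r) r"
      and l': "tuple a (stuple_tgt_profile P l') l'" and r': "tuple (stuple_tgt_profile P l') (stuple_tgt_profile P r') r'"
      using 14 T by blast+
    note a = A(2)[OF 14(1)]
    have "stuple_tgt_profile P r = stuple_tgt_profile P r'"
      using S(2)[OF tuple_stuple_comp(1)[OF l r a]] S(2)[OF tuple_stuple_comp(1)[OF l' r' a]] 14(10)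
        by simp
    then show ?case
      using factors_unique[OF l r a 14(4,5)] factors_unique[OF l' r' a 14(8,9)] 14(10) by metis
  qed
qed

definition numbered :: "'o \<Rightarrow> 'o \<times> nat list" where
  "numbered p = (p, [0..<arity P p])"

text \<open>Substitution that composes \<open>y\<close> with the first input of a lower vertex and lowers the labels
of the other inputs to the numbers of the leaves.\<close>

definition fill_low :: "'c list \<Rightarrow> 'o \<times> nat list \<Rightarrow> nat \<Rightarrow> 'o \<times> nat list" where
  "fill_low ds y = case_nat y (unit (colouring ds))"

lemma labelled_numbered: "p \<in> opn P \<Longrightarrow> labelled (colouring (inp P p)) (numbered p)"
  unfolding labelled_def numbered_def
  by (simp add: map_colouring_eq map_nth atLeast0LessThan)

lemma grafting_fill_low:
  assumes "labelled (colouring ds) y" "outp P (fst y) = c" "set ds \<subseteq> col P"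
  shows "grafting (case_nat (Some c) (colouring ds)) (colouring ds) (fill_low ds y)"
  unfolding fill_low_def
  by (rule grafting_case_nat[OF assms(1,2) grafting_unit]) (simp add: ran_colouring assms(3))

lemma fill_low_0: "fill_low ds y 0 = y" and fill_low_Suc: "fill_low ds y (Suc j) = unit (colouring ds) j"
  and fill_low_o_Suc: "fill_low ds y \<circ> Suc = unit (colouring ds)"
  by (simp_all add: fill_low_def fun_eq_iff)

lemma labelled_fill:
  assumes "p \<in> opn P" "tuple (profile P p) b f"
  shows "labelled (colouring (fst b)) (graft (numbered p) (up f))"
    "outp P (fst (graft (numbered p) (up f))) = outp P p"
    "labelled (colouring (fst b)) (graft (low f) (fill_low (fst b) (graft (numbered p) (up f))))"
    "outp P (fst (graft (low f) (fill_low (fst b) (graft (numbered p) (up f))))) = snd b"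
proof -
  have g: "grafting (colouring (inp P p)) (colouring (fst b)) (up f)"
    using tuple_grafting[OF assms(2)] by (simp add: profile_def)
  show 1: "labelled (colouring (fst b)) (graft (numbered p) (up f))"
    by (rule labelled_graft[OF labelled_numbered[OF assms(1)] g])
  show 2: "outp P (fst (graft (numbered p) (up f))) = outp P p"
    using outp_graft[OF labelled_numbered[OF assms(1)] g] by (simp add: numbered_def)
  have "grafting (case_nat (Some (outp P p)) (colouring (fst b))) (colouring (fst b))
      (fill_low (fst b) (graft (numbered p) (up f)))"
    by (rule grafting_fill_low[OF 1 2 tuple_target_in_profiles(1)[OF assms(2)]])
  then have gl: "grafting (case_nat (Some (snd (profile P p))) (colouring (fst b))) (colouring (fst b))
      (fill_low (fst b) (graft (numbered p) (up f)))"
    by (simp add: profile_def)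
  show "labelled (colouring (fst b)) (graft (low f) (fill_low (fst b) (graft (numbered p) (up f))))"
    by (rule labelled_graft[OF tuple_labelled_low[OF assms(2)] gl])
  show "outp P (fst (graft (low f) (fill_low (fst b) (graft (numbered p) (up f))))) = snd b"
    using outp_graft[OF tuple_labelled_low[OF assms(2)] gl] tuple_outp_low[OF assms(2)] by simp
qed

text \<open>The target is the graft of all vertices around \<open>p\<close>, renumbered such that the labels of its
inputs are their positions.\<close>

lemma stuple_tgt_sim:
  assumes p: "p \<in> opn P" and f: "tuple (profile P p) b f"
  shows "sim (graft (low f) (fill_low (fst b) (graft (numbered p) (up f)))) (numbered (stuple_tgt P p f))"
    and "stuple_tgt P p f \<in> opn P" and "profile P (stuple_tgt P p f) = b"
proof -
  obtain q0 qs l0 ls where ff: "f = STuple q0 qs l0 ls" by (cases f)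
  let ?x = "graft (low f) (fill_low (fst b) (graft (numbered p) (up f)))"
  let ?L = "concat ls @ l0"
  note f' = f[unfolded tuple_def]
  have len: "length qs = arity P p" "length ls = arity P p"
    using f' by (simp_all add: ff profile_def)
  have cov: "mset ?L = mset [0..<length (fst b)]" using f' by (simp add: ff)
  then have lenL: "length ?L = length (fst b)" by (metis diff_zero length_upt size_mset)
  have q0: "map (idop P) (inp P q0) = idop P (outp P p) # map (\<lambda>j. idop P (the (colouring (fst b) j))) l0"
  proof -
    have "map (idop P \<circ> the) (map Some (inp P q0))
        = map (idop P \<circ> the) (map (case_nat (Some (outp P p)) (colouring (fst b))) (0 # map Suc l0))"
      using tuple_labelled_low[OF f] by (simp add: labelled_def low_def ff profile_def del: map_map)
    then show ?thesis by (simp add: o_def)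
  qed
  have "map (\<lambda>i. up f i) [0..<arity P p] = zip qs ls"
    using len by (intro nth_equalityI) (simp_all add: up_def ff)
  then have "map fst (map (\<lambda>i. up f i) [0..<arity P p]) = qs"
    "map snd (map (\<lambda>i. up f i) [0..<arity P p]) = ls"
    using len by simp_all
  then have "graft (numbered p) (up f) = (ocomp P p qs, concat ls)"
    by (simp add: graft_def numbered_def o_def)
  then have x: "?x = (pcomp P q0 0 (ocomp P p qs), ?L)"
    by (simp add: graft_def low_def ff fill_low_def o_def unit_def pcomp_def q0)
  note lab = labelled_fill(3)[OF p f]
  have L: "lperm ?L permutes {..<length ?L}" by (rule lperm_permutes) (simp only: cov lenL)
  have opn: "fst ?x \<in> opn P" and ar: "length ?L = arity P (fst ?x)"
    using labelled_opn[OF lab] labelled_length[OF lab] unfolding x by simp_all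
  have tgt: "stuple_tgt P p f = act P (lperm ?L) (fst ?x)" unfolding x by (simp add: ff)
  have ar_tgt: "arity P (stuple_tgt P p f) = length ?L"
    unfolding tgt using arity_act[OF opn] L ar by simp
  show sim: "sim ?x (numbered (stuple_tgt P p f))"
    unfolding sim_def
  proof (intro exI[of _ "lperm ?L"] conjI)
    show "lperm ?L permutes {..<arity P (fst ?x)}" using L ar by simp
    show "length (snd (numbered (stuple_tgt P p f))) = arity P (fst ?x)"
      using ar_tgt ar by (simp add: numbered_def)
    show "fst (numbered (stuple_tgt P p f)) = act P (lperm ?L) (fst ?x)"
      by (simp add: numbered_def tgt)
    have "permute_list (lperm ?L) [0..<length ?L] = map ((!) [0..<length ?L]) ?L"
      by (rule permute_list_lperm) simp
    also have "\<dots> = ?L"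
      using cov lenL unfolding mset_upt_iff by (intro map_idI) simp
    finally show "snd ?x = permute_list (lperm ?L) (snd (numbered (stuple_tgt P p f)))"
      unfolding x unfolding numbered_def ar_tgt by simp
  qed
  show "stuple_tgt P p f \<in> opn P" using labelled_opn[OF labelled_sim(1)[OF lab sim]] by (simp add: numbered_def)
  have "map (colouring (fst b)) [0..<length (fst b)] = map Some (inp P (stuple_tgt P p f))"
    using labelled_sim(1)[OF lab sim] ar_tgt lenL by (simp add: labelled_def numbered_def)
  then have "map ((!) (fst b)) [0..<length (fst b)] = inp P (stuple_tgt P p f)"
    by (subst (asm) map_colouring_eq) auto
  moreover have "outp P (stuple_tgt P p f) = snd b"
    using labelled_sim(2)[OF lab sim] labelled_fill(4)[OF p f] by (simp add: numbered_def)
  ultimately show "profile P (stuple_tgt P p f) = b" by (simp add: profile_def map_nth prod_eq_iff)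
qed

lemma stuple_tgtI:
  assumes p: "p \<in> opn P" and f: "tuple (profile P p) b f"
    and t: "sim (graft (low f) (fill_low (fst b) (graft (numbered p) (up f)))) (numbered t)"
  shows "stuple_tgt P p f = t"
proof -
  note lab = labelled_fill(3)[OF p f] and s = stuple_tgt_sim(1)[OF p f]
  have "numbered (stuple_tgt P p f) = numbered t"
    by (rule sim_sorted_eq[OF labelled_sim(1)[OF lab s] sim_trans[OF labelled_sim(1)[OF lab s]
      sim_sym[OF lab s] t]])
      (simp_all add: numbered_def)
  then show ?thesis by (simp add: numbered_def)
qed

lemma stuple_tgt_id:
  assumes p: "p \<in> opn P"
  shows "stuple_tgt P p (stuple_id P (profile P p)) = p"
proof -
  let ?id = "stuple_id P (inp P p, outp P p)"
  have cols: "set (inp P p) \<subseteq> col P" "outp P p \<in> col P" using p inp_col outp_col by blast+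
  have id: "tuple (profile P p) (profile P p) ?id"
    unfolding profile_def by (rule tuple_stuple_id[OF cols])
  note lab = labelled_numbered[OF p]
  have "graft (numbered p) (up ?id) = graft (numbered p) (unit (colouring (inp P p)))"
    by (rule graft_cong[OF lab]) (simp add: colouring_eq_Some up_stuple_id del: stuple_id.simps)
  then have 1: "graft (numbered p) (up ?id) = numbered p" using graft_unit_right[OF lab] by simp
  have "graft (low ?id) (fill_low (inp P p) (graft (numbered p) (up ?id))) = numbered p"
    unfolding 1 low_stuple_id using p by (subst graft_idop) (simp_all add: fill_low_0 numbered_def)
  then have "sim (graft (low ?id) (fill_low (fst (profile P p)) (graft (numbered p) (up ?id)))) (numbered p)"
    using sim_refl[OF lab] by (simp add: profile_def del: stuple_id.simps)
  then have "stuple_tgt P p ?id = p" by (rule stuple_tgtI[OF p id])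
  then show ?thesis by (simp add: profile_def del: stuple_id.simps stuple_tgt.simps)
qed

lemma sim_fill_low:
  assumes "sim z y" "set ds \<subseteq> col P" "case_nat (Some d) (colouring ds) l = Some k"
  shows "sim (fill_low ds z l) (fill_low ds y l)"
proof (cases l)
  case 0 then show ?thesis using assms by (simp add: fill_low_0)
next
  case (Suc j)
  then have "labelled (colouring ds) (unit (colouring ds) j)"
    using assms by (intro labelled_unit) (auto simp: colouring_eq_Some)
  then show ?thesis using Suc by (simp add: fill_low_Suc sim_refl)
qed

text \<open>Both sides are similar to the graft of the vertices of \<open>g\<close> around the graft of those of \<open>f\<close>
around \<open>p\<close>.\<close>

lemma stuple_tgt_comp:
  assumes p: "p \<in> opn P" and f: "tuple (profile P p) b f" and g: "tuple b e g"
  shows "stuple_tgt P p (stuple_comp P g f) = stuple_tgt P (stuple_tgt P p f) g"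
proof -
  let ?gf = "stuple_comp P g f" and ?t = "stuple_tgt P p f"
  let ?c = "outp P p"
  have c: "?c \<in> col P" "snd (profile P p) = ?c" using p outp_col by (simp_all add: profile_def)
  note t = stuple_tgt_sim[OF p f]
  have g_t: "tuple (profile P ?t) e g" using g t(3) by simp
  note gf = tuple_stuple_comp[OF f g, unfolded c(2), OF c(1)]
  have e: "set (fst e) \<subseteq> col P" by (rule tuple_target_in_profiles[OF g])
  note Lf = tuple_labelled_low[OF f, unfolded c(2)] and Lg = tuple_labelled_low[OF g]
  have Uf: "grafting (colouring (inp P p)) (colouring (fst b)) (up f)"
    using tuple_grafting[OF f] by (simp add: profile_def)
  note Ug = tuple_grafting[OF g]
  note np = labelled_numbered[OF p]
  define W where "W = graft (numbered p) (\<lambda>i. graft (up f i) (up g))"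
  define Y where "Y = graft (low f) (below ?c (up g))"
  define X where "X = graft (low f) (fill_low (fst b) (graft (numbered p) (up f)))"
  note X = labelled_fill(3,4)[OF p f, folded X_def]
  note Y = labelled_inner_low[OF f g, unfolded c(2), OF c(1), folded Y_def]
  have W_eq: "W = graft (graft (numbered p) (up f)) (up g)"
    unfolding W_def by (rule graft_graft[OF np Uf Ug, symmetric])
  have W: "labelled (colouring (fst e)) W" "outp P (fst W) = ?c"
    unfolding W_eq
    using labelled_graft[OF labelled_fill(1)[OF p f] Ug] outp_graft[OF labelled_fill(1)[OF p f] Ug]
      labelled_fill(2)[OF p f] by simp_all
  note fW = grafting_fill_low[OF W e]
  have XUg: "graft X (up g) = graft (low f) (case_nat W (up g))"
  proof -
    have ff: "grafting (case_nat (Some ?c) (colouring (fst b))) (colouring (fst b))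
        (fill_low (fst b) (graft (numbered p) (up f)))"
      by (rule grafting_fill_low[OF labelled_fill(1,2)[OF p f] tuple_target_in_profiles(1)[OF f]])
    show ?thesis
      unfolding X_def graft_graft[OF Lf ff Ug]
    proof (rule graft_cong[OF Lf])
      fix l k assume "case_nat (Some ?c) (colouring (fst b)) l = Some k"
      then show "graft (fill_low (fst b) (graft (numbered p) (up f)) l) (up g) = case_nat W (up g) l"
        using graft_unit_left[OF Ug] by (cases l) (simp_all add: fill_low_0 fill_low_Suc W_eq)
    qed
  qed
  have YW: "graft Y (fill_low (fst e) W) = graft X (up g)"
    unfolding XUg Y_def graft_graft[OF Lf grafting_below[OF Ug c(1)] fW]
  proof (rule graft_cong[OF Lf])
    fix l k assume l: "case_nat (Some ?c) (colouring (fst b)) l = Some k"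
    show "graft (below ?c (up g) l) (fill_low (fst e) W) = case_nat W (up g) l"
    proof (cases l)
      case 0 then show ?thesis using W by (simp add: below_0 graft_idop fill_low_0 labelled_opn)
    next
      case (Suc j)
      then have "labelled (colouring (fst e)) (up g j)" using Ug l by (simp add: grafting_def)
      then show ?thesis using Suc by (simp add: below_Suc graft_shift fill_low_o_Suc graft_unit_right)
    qed
  qed
  have XUg_lab: "labelled (colouring (fst e)) (graft X (up g))"
    "outp P (fst (graft X (up g))) = snd b"
    using labelled_graft[OF X(1) Ug] outp_graft[OF X(1) Ug] X(2) by simp_all
  note fXUg = grafting_fill_low[OF XUg_lab e]
  let ?T = "graft (low g) (fill_low (fst e) (graft X (up g)))"
  note T = labelled_graft[OF Lg fXUg]
  note insY = grafting_low[OF f g, unfolded c(2), OF c(1), folded Y_def]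
  have T_eq: "?T = graft (graft (low g) (insert_low (fst e) Y)) (fill_low (fst e) W)"
    unfolding graft_graft[OF Lg insY fW]
  proof (rule graft_cong[OF Lg])
    fix l k assume l: "case_nat (Some (snd b)) (colouring (fst e)) l = Some k"
    show "fill_low (fst e) (graft X (up g)) l = graft (insert_low (fst e) Y l) (fill_low (fst e) W)"
    proof (cases l)
      case 0 then show ?thesis by (simp add: insert_low_0 fill_low_0 YW)
    next
      case (Suc j)
      then have "labelled (colouring (fst e)) (unit (colouring (fst e)) j)"
        using l e by (intro labelled_unit) (auto simp: colouring_eq_Some)
      then show ?thesis
        using Suc by (simp add: insert_low_Suc fill_low_Suc graft_shift fill_low_o_Suc graft_unit_right)
    qed
  qed
  have left: "sim ?T (numbered (stuple_tgt P ?t g))"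
  proof -
    have "sim (graft X (up g)) (graft (numbered ?t) (up g))"
      by (rule sim_graft_left[OF X(1) t(1)[folded X_def] Ug])
    then have "sim ?T (graft (low g) (fill_low (fst e) (graft (numbered ?t) (up g))))"
      using sim_fill_low[OF _ e] by (intro sim_graft_right[OF Lg fXUg]) blast
    from sim_trans[OF T this stuple_tgt_sim(1)[OF t(2) g_t]] show ?thesis .
  qed
  have right: "sim ?T (graft (low ?gf) (fill_low (fst e) (graft (numbered p) (up ?gf))))"
  proof -
    have 1: "sim ?T (graft (low ?gf) (fill_low (fst e) W))"
      unfolding T_eq by (rule sim_graft_left[OF labelled_graft[OF Lg insY] gf(3)[folded Y_def] fW])
    have "sim W (graft (numbered p) (up ?gf))"
      unfolding W_def
      by (rule sim_graft_right[OF np grafting_graft[OF Uf Ug]]) (simp add: gf(2) colouring_eq_Some profile_def)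
    then have "sim (graft (low ?gf) (fill_low (fst e) W)) (graft (low ?gf) (fill_low (fst e) (graft (numbered p) (up ?gf))))"
      using sim_fill_low[OF _ e]
      by (intro sim_graft_right[OF tuple_labelled_low[OF gf(1), unfolded c(2)] fW]) blast
    from sim_trans[OF T 1 this] show ?thesis .
  qed
  show ?thesis
    by (rule stuple_tgtI[OF p gf(1) sim_trans[OF labelled_sim(1)[OF T right]
      sim_sym[OF T right] left]])
qed

theorem strict_factorization_system_symmetric:
  "strict_factorization_system (sTw P) (sUpper P (sTw P)) (sLower P (sTw P))"
  "strict_factorization_system (sU P) (sUpper P (sU P)) (sLower P (sU P))"
proof -
  interpret S: factorized_tuples "profiles P" "stuple_from P" "stuple_tgt_profile P" "stuple_id P"
    "stuple_comp P" upper lower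
    by (rule factorized_tuples_symmetric)
  have T: "tuple a (stuple_tgt_profile P f) f" if "stuple_from P a f" for a f
    using that by (simp add: tuple_iff)
  have Tw: "sTw P = elements (opn P) (profile P) (stuple_from P) (stuple_tgt P) (stuple_id P) (stuple_comp P)"
    by (simp add: sTw_def elements_def)
  have U: "sU P = elements (profiles P) (\<lambda>a. a) (stuple_from P) (\<lambda>a. stuple_tgt_profile P) (stuple_id P) (stuple_comp P)"
    by (simp add: sU_def elements_def)
  have classes: "sUpper P C = {(x, f) \<in> Ar C. upper f}"
    "sLower P C = {(x, f) \<in> Ar C. lower f}" for C :: "('x, _) cat_data"
    by (simp_all add: sUpper_def sLower_def upper_def lower_def)
  show "strict_factorization_system (sTw P) (sUpper P (sTw P)) (sLower P (sTw P))"
    unfolding classes Tw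
  proof (rule S.strict_factorization_system_elements)
    fix p assume p: "p \<in> opn P"
    then show "profile P p \<in> profiles P" using inp_col outp_col by (auto simp: profile_def profiles_def)
    show "stuple_tgt P p (stuple_id P (profile P p)) = p" by (rule stuple_tgt_id[OF p])
    fix f assume f: "stuple_from P (profile P p) f"
    show "stuple_tgt P p f \<in> opn P" "profile P (stuple_tgt P p f) = stuple_tgt_profile P f"
      using stuple_tgt_sim[OF p T[OF f]] by blast+
    fix g assume "stuple_from P (stuple_tgt_profile P f) g"
    then show "stuple_tgt P p (stuple_comp P g f) = stuple_tgt P (stuple_tgt P p f) g"
      using stuple_tgt_comp[OF p T[OF f] T] by blast
  qed
  show "strict_factorization_system (sU P) (sUpper P (sU P)) (sLower P (sU P))"
    unfolding classes U
    by (rule S.strict_factorization_system_elements)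
      (auto intro: S.target_in S.ident_target S.composite_target)
qed

end

section \<open>The factorization theorem\<close>

theorem proposition2p42:
  fixes P :: "('c, 'o) operad" and Q :: "('d, 'u) sym_operad"
  shows "(planar_operad P \<longrightarrow>
            strict_factorization_system (pTw P) (pUpper P (pTw P)) (pLower P (pTw P)) \<and>
            strict_factorization_system (pU P) (pUpper P (pU P)) (pLower P (pU P))) \<and>
         (symmetric_operad Q \<longrightarrow>
            strict_factorization_system (sTw Q) (sUpper Q (sTw Q)) (sLower Q (sTw Q)) \<and>
            strict_factorization_system (sU Q) (sUpper Q (sU Q)) (sLower Q (sU Q)))"
  using planar_operad.strict_factorization_system_planar[of P]
    symmetric_operad.strict_factorization_system_symmetric[of Q] by blast

end
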